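(* There exist enhanced triangulated categories $\mathcal A,\mathcal B$ over an algebraically closed field $\mathbf k$ of characteristic zero, and an enhanced exact functor $F\colon \mathcal A\to\mathcal B$ admitting a left adjoint $L$ and a right adjoint $R$, such that $F$ is a $\mathbb P$-functor (i.e. $F$ admits the structure of a $\mathbb P^n$-functor for some positive integer $n$), but the adjoints $L\colon\mathcal B\to\mathcal A$ and $R\colon\mathcal B\to\mathcal A$ are not $\mathbb P$-functors (i.e. neither of them admits the structure of a $\mathbb P^m$-functor for any positive integer $m$ and any autoequivalence of $\mathcal B$).
   Context: $\mathbf k$ is an algebraically closed field of characteristic zero. Categories are enhanced ($\mathbf k$-linear, DG-enhanced) triangulated categories, functors are enhanced exact functors, and natural transformations, cones and triangles of functors are taken on the enhanced level; e.g. $D(X)$, the bounded derived category of coherent sheaves on a smooth projective variety $X$, with Fourier--Mukai functors, and exact triangles of Fourier--Mukai kernels. Definition ($\mathbb P^n$-functor in the sense of Anno and Logvinenko, "$\mathbb P^n$-functors", Def. 4.1). Let $F\colon\mathcal A\to\mathcal B$ be an enhanced exact functor with left adjoint $L$ and right adjoint $R$; write $\mathrm{act}$ and $\mathrm{tr}$ for adjunction units and counits. The structure of a $\mathbb P^n$-functor on $F$ consists of an autoequivalence $H$ of $\mathcal A$ with $H(\ker F)=\ker F$, a Postnikov system $$\mathrm{id}=Q_0\to Q_1\to\cdots\to Q_n$$ of endofunctors of $\mathcal A$, i.e. exact triangles $Q_{i-1}\to Q_i\xrightarrow{\mu_i}H^i\to Q_{i-1}[1]$ for $i=1,\dots,n$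 (so $Q_n$ is filtered by $\mathrm{id},H,\dots,H^n$), and an isomorphism $\gamma\colon Q_n\xrightarrow{\sim}RF$ identifying the composite $\mathrm{id}\to Q_n$ with the unit $\mathrm{act}\colon\mathrm{id}\to RF$, subject to the three conditions below. Let $\psi\colon FHR\to FR$ be the unique map such that the composite $FQ_1R\xrightarrow{F\mu_1R}FHR\xrightarrow{\psi}FR$ equals $FQ_1R\to FQ_nR\cong FRFR\xrightarrow{FR\,\mathrm{tr}-\mathrm{tr}\,FR}FR$. Let $H'$ be the left adjoint (inverse) of $H$ and $\psi'\colon FL\to FH'L$ the map corresponding to $\psi$ by passing to left adjoints. (1) Monad condition: the composite $FHQ_{n-1}\to FHQ_n\cong FHRF\xrightarrow{\psi F}FRF\to F\,\mathrm{Cone}(\mathrm{id}\xrightarrow{\mathrm{act}}RF)$ is an isomorphism. (2) Adjoints condition: the composite $FR\xrightarrow{FR\,\mathrm{act}}FRFL\cong FQ_nL\xrightarrow{F\mu_nL}FH^nL$ is an isomorphism. (3) Highest degree term condition: there is an isomorphism $FH^nL\cong FHH^nH'L$ which identifies the composite $FHQ_{n-1}L\to FHRFL\xrightarrow{\psi FL}FRFL\cong FQ_nL\xrightarrow{F\mu_nL}FH^nL$ with the composite $FHQ_{n-1}L\to FHRFL\xrightarrow{FHR\psi'}FHRFH'L\cong FHQ_nH'L\xrightarrow{FH\mu_nH'L}FHH^nH'L$. $F$ is called a $\mathbb P^n$-functor if it admits such a structure, and a $\mathbb P$-functor if it is a $\mathbb P^n$-functor for some positive integer $n$. Every split $\mathbb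 P^n$-functor in the sense of Addington and Cautis is a $\mathbb P^n$-functor in this sense. In particular, a $\mathbb P^m$-functor structure on $G\colon\mathcal B\to\mathcal A$ with right adjoint $G^R$ includes an autoequivalence $H$ of $\mathcal B$ and a Postnikov system of endofunctors of $\mathcal B$ filtering $G^RG$ by $\mathrm{id},H,\dots,H^m$. *)

theory Defs
  imports
    "HOL-Library.Function_Algebras"
    "HOL-Computational_Algebra.Polynomial"
begin

section \<open>DG categories\<close>

text \<open>
  A homogeneous element of a graded Hom space, together with its source, target and degree.
  All Hom spaces of a DG category are subspaces of one ambient vector space, so the bare element
  does not determine the other three data.
\<close>

datatype ('o, 'm) arr = Arr (src: 'o) (tgt: 'o) (deg: int) (val: 'm)

record ('k, 'o, 'm) dgcat =
  Obj :: "'o set"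
  Hom :: "'o \<Rightarrow> 'o \<Rightarrow> int \<Rightarrow> 'm set"
  smul :: "'k \<Rightarrow> 'm \<Rightarrow> 'm"
  dgdiff :: "('o, 'm) arr \<Rightarrow> 'm"
  dgcomp :: "('o, 'm) arr \<Rightarrow> ('o, 'm) arr \<Rightarrow> 'm"
  dgunit :: "'o \<Rightarrow> 'm"

definition ksign :: "int \<Rightarrow> 'm::ab_group_add \<Rightarrow> 'm" where
  "ksign n x = (if even n then x else - x)"

definition arrow :: "('k, 'o, 'm) dgcat \<Rightarrow> ('o, 'm) arr \<Rightarrow> bool" where
  "arrow C a \<longleftrightarrow> src a \<in> Obj C \<and> tgt a \<in> Obj C \<and> val a \<in> Hom C (src a) (tgt a) (deg a)"

definition arrow_in :: "('k, 'o, 'm) dgcat \<Rightarrow> ('o, 'm) arr \<Rightarrow> 'o \<Rightarrow> 'o \<Rightarrow> int \<Rightarrow> bool" where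
  "arrow_in C a X Y n \<longleftrightarrow> arrow C a \<and> src a = X \<and> tgt a = Y \<and> deg a = n"

definition dd :: "('k, 'o, 'm) dgcat \<Rightarrow> ('o, 'm) arr \<Rightarrow> ('o, 'm) arr" where
  "dd C a = Arr (src a) (tgt a) (deg a + 1) (dgdiff C a)"

definition cmp :: "('k, 'o, 'm) dgcat \<Rightarrow> ('o, 'm) arr \<Rightarrow> ('o, 'm) arr \<Rightarrow> ('o, 'm) arr" where
  "cmp C b a = Arr (src a) (tgt b) (deg a + deg b) (dgcomp C b a)"

definition ident :: "('k, 'o, 'm) dgcat \<Rightarrow> 'o \<Rightarrow> ('o, 'm) arr" where
  "ident C X = Arr X X 0 (dgunit C X)"

definition asub :: "('o, 'm::minus) arr \<Rightarrow> ('o, 'm) arr \<Rightarrow> ('o, 'm) arr" where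
  "asub a b = Arr (src a) (tgt a) (deg a) (val a - val b)"

definition dg_category :: "('k::field, 'o, 'm::ab_group_add) dgcat \<Rightarrow> bool" where
  "dg_category C \<longleftrightarrow>
     vector_space (smul C) \<and>
     (\<forall>X\<in>Obj C. \<forall>Y\<in>Obj C. \<forall>n. module.subspace (smul C) (Hom C X Y n)) \<and>
     (\<forall>a. arrow C a \<longrightarrow> arrow C (dd C a)) \<and>
     (\<forall>a b. arrow C a \<and> arrow C b \<and> tgt a = src b \<longrightarrow> arrow C (cmp C b a)) \<and>
     (\<forall>X\<in>Obj C. arrow C (ident C X)) \<and>
     (\<forall>X Y n x y c. arrow C (Arr X Y n x) \<and> arrow C (Arr X Y n y) \<longrightarrow>
        dgdiff C (Arr X Y n (smul C c x + y)) =
          smul C c (dgdiff C (Arr X Y n x)) + dgdiff C (Arr X Y n y)) \<and>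
     (\<forall>X Y n x y c b. arrow C (Arr X Y n x) \<and> arrow C (Arr X Y n y) \<and> arrow C b \<and> src b = Y \<longrightarrow>
        dgcomp C b (Arr X Y n (smul C c x + y)) =
          smul C c (dgcomp C b (Arr X Y n x)) + dgcomp C b (Arr X Y n y)) \<and>
     (\<forall>X Y n x y c a. arrow C (Arr X Y n x) \<and> arrow C (Arr X Y n y) \<and> arrow C a \<and> tgt a = X \<longrightarrow>
        dgcomp C (Arr X Y n (smul C c x + y)) a =
          smul C c (dgcomp C (Arr X Y n x) a) + dgcomp C (Arr X Y n y) a) \<and>
     (\<forall>a b c. arrow C a \<and> arrow C b \<and> arrow C c \<and> tgt a = src b \<and> tgt b = src c \<longrightarrow>
        cmp C c (cmp C b a) = cmp C (cmp C c b) a) \<and>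
     (\<forall>a. arrow C a \<longrightarrow> cmp C a (ident C (src a)) = a \<and> cmp C (ident C (tgt a)) a = a) \<and>
     (\<forall>a. arrow C a \<longrightarrow> dgdiff C (dd C a) = 0) \<and>
     (\<forall>a b. arrow C a \<and> arrow C b \<and> tgt a = src b \<longrightarrow>
        dgdiff C (cmp C b a) =
          dgcomp C (dd C b) a + ksign (deg b) (dgcomp C b (dd C a)))"


section \<open>The homotopy category and its exact triangles\<close>

definition closed_arrow :: "('k, 'o, 'm::zero) dgcat \<Rightarrow> ('o, 'm) arr \<Rightarrow> 'o \<Rightarrow> 'o \<Rightarrow> int \<Rightarrow> bool" where
  "closed_arrow C a X Y n \<longleftrightarrow> arrow_in C a X Y n \<and> dgdiff C a = 0"

text \<open>Equality of parallel closed arrows in cohomology.\<close>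

definition heq :: "('k, 'o, 'm::minus) dgcat \<Rightarrow> ('o, 'm) arr \<Rightarrow> ('o, 'm) arr \<Rightarrow> bool" where
  "heq C a b \<longleftrightarrow> (\<exists>s. arrow_in C s (src a) (tgt a) (deg a - 1) \<and> val a - val b = dgdiff C s)"

definition hinverse :: "('k, 'o, 'm::ab_group_add) dgcat \<Rightarrow> ('o, 'm) arr \<Rightarrow> ('o, 'm) arr \<Rightarrow> bool" where
  "hinverse C a b \<longleftrightarrow>
     closed_arrow C a (src a) (tgt a) (deg a) \<and>
     closed_arrow C b (tgt a) (src a) (- deg a) \<and>
     heq C (cmp C b a) (ident C (src a)) \<and> heq C (cmp C a b) (ident C (tgt a))"

text \<open>For an arrow of degree \<open>n\<close> this says that it is an isomorphism \<open>src a \<cong> tgt a[n]\<close>.\<close>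

definition hiso :: "('k, 'o, 'm::ab_group_add) dgcat \<Rightarrow> ('o, 'm) arr \<Rightarrow> bool" where
  "hiso C a \<longleftrightarrow> (\<exists>b. hinverse C a b)"

definition hzero :: "('k, 'o, 'm::ab_group_add) dgcat \<Rightarrow> 'o \<Rightarrow> bool" where
  "hzero C X \<longleftrightarrow> X \<in> Obj C \<and> heq C (ident C X) (Arr X X 0 0)"

definition hisomorphic :: "('k, 'o, 'm::ab_group_add) dgcat \<Rightarrow> 'o \<Rightarrow> 'o \<Rightarrow> bool" where
  "hisomorphic C X Y \<longleftrightarrow> (\<exists>a. arrow_in C a X Y 0 \<and> hiso C a)"

text \<open>
  Exactness of \<open>X \<rightarrow>f Y \<rightarrow>g Z \<rightarrow>h X[1]\<close>, the last map being given as a closed arrow \<open>h : Z \<rightarrow> X\<close> of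
  degree 1: the triangle is isomorphic, by the identity on \<open>X\<close> and \<open>Y\<close>, to the standard triangle
  of \<open>f\<close>.  The standard triangle lives on the twisted complex \<open>Cone f = (X[1] \<oplus> Y, f)\<close>; since the
  cone need not be an object of \<open>C\<close>, maps to and from it are written in components.

  The matrix \<open>(j, g) : Cone f \<rightarrow> Z\<close> is closed iff \<open>d j = g f\<close>, and \<open>(h, q) : Z \<rightarrow> Cone f\<close> is
  closed iff \<open>d h = 0\<close> and \<open>d q = - f h\<close>.  The last five equations say that the two are mutually
  inverse up to homotopy, \<open>k\<close> being the homotopy on \<open>Z\<close> and \<open>(x, b, c, y)\<close> the matrix entries
  \<open>X \<rightarrow> X\<close>, \<open>Y \<rightarrow> X\<close>, \<open>X \<rightarrow> Y\<close>, \<open>Y \<rightarrow> Y\<close> of the homotopy on \<open>Cone f\<close>.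
\<close>

definition exact_triangle ::
  "('k, 'o, 'm::ab_group_add) dgcat \<Rightarrow> ('o, 'm) arr \<Rightarrow> ('o, 'm) arr \<Rightarrow> ('o, 'm) arr \<Rightarrow> bool" where
  "exact_triangle C f g h \<longleftrightarrow> (\<exists>X Y Z j q k x b c y.
     closed_arrow C f X Y 0 \<and> closed_arrow C g Y Z 0 \<and> closed_arrow C h Z X 1 \<and>
     arrow_in C j X Z (-1) \<and> arrow_in C q Z Y 0 \<and> arrow_in C k Z Z (-1) \<and>
     arrow_in C x X X (-1) \<and> arrow_in C b Y X 0 \<and> arrow_in C c X Y (-2) \<and> arrow_in C y Y Y (-1) \<and>
     dgdiff C j = dgcomp C g f \<and>
     dgdiff C q = - dgcomp C f h \<and>
     dgcomp C j h + dgcomp C g q - dgunit C Z = dgdiff C k \<and>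
     dgcomp C h j - dgunit C X = - dgdiff C x + dgcomp C b f \<and>
     dgcomp C h g = - dgdiff C b \<and>
     dgcomp C q j = dgdiff C c + dgcomp C f x + dgcomp C y f \<and>
     dgcomp C q g - dgunit C Y = dgdiff C y + dgcomp C f b)"

text \<open>
  A pretriangulated DG category: a zero object, shifts and cones exist up to homotopy
  equivalence, i.e. the homotopy category is triangulated with the triangles above.
\<close>

definition enhanced_triangulated :: "('k::field, 'o, 'm::ab_group_add) dgcat \<Rightarrow> bool" where
  "enhanced_triangulated C \<longleftrightarrow>
     dg_category C \<and>
     (\<exists>X. hzero C X) \<and>
     (\<forall>X\<in>Obj C. \<forall>n\<in>{1, -1}. \<exists>Y s. arrow_in C s Y X n \<and> hiso C s) \<and>
     (\<forall>X Y f. closed_arrow C f X Y 0 \<longrightarrow> (\<exists>g h. exact_triangle C f g h))"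


section \<open>Enhanced exact functors\<close>

text \<open>
  Enhanced functors are quasi-functors, modelled as (cohomologically unital) A-infinity functors
  between DG categories.  Signs follow Seidel, ``Fukaya categories and Picard-Lefschetz theory'',
  Sections (1a)--(1e): a DG category is an A-infinity category with
  \<open>mu1 a = (-1)^|a| d a\<close> and \<open>mu2 b a = (-1)^|a| b a\<close>.

  Multilinear operations take a chain of composable homogeneous arrows
  \<open>X0 \<rightarrow>a1 X1 \<rightarrow> \<dots> \<rightarrow>ad Xd\<close> as the list \<open>[a1, \<dots>, ad]\<close> (the reverse of Seidel's order).
\<close>

definition mu1 :: "('k, 'o, 'm::ab_group_add) dgcat \<Rightarrow> ('o, 'm) arr \<Rightarrow> ('o, 'm) arr" where
  "mu1 C a = Arr (src a) (tgt a) (deg a + 1) (ksign (deg a) (dgdiff C a))"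

definition mu2 ::
  "('k, 'o, 'm::ab_group_add) dgcat \<Rightarrow> ('o, 'm) arr \<Rightarrow> ('o, 'm) arr \<Rightarrow> ('o, 'm) arr" where
  "mu2 C b a = Arr (src a) (tgt b) (deg a + deg b) (ksign (deg a) (dgcomp C b a))"

fun path :: "('k, 'o, 'm) dgcat \<Rightarrow> 'o \<Rightarrow> ('o, 'm) arr list \<Rightarrow> bool" where
  "path C X [] \<longleftrightarrow> X \<in> Obj C"
| "path C X (a # p) \<longleftrightarrow> arrow C a \<and> src a = X \<and> path C (tgt a) p"

definition path_end :: "'o \<Rightarrow> ('o, 'm) arr list \<Rightarrow> 'o" where
  "path_end X p = (if p = [] then X else tgt (last p))"

text \<open>Total reduced degree \<open>|a1| + \<dots> + |ad| - d\<close>.\<close>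

definition red :: "('o, 'm) arr list \<Rightarrow> int" where
  "red p = (\<Sum>a\<leftarrow>p. deg a - 1)"

text \<open>Divisions of a list into nonempty consecutive blocks.\<close>

definition blocks :: "'a list \<Rightarrow> 'a list list set" where
  "blocks p = {bs. concat bs = p \<and> [] \<notin> set bs}"

text \<open>The sum of all insertions of \<open>mu1\<close> and \<open>mu2\<close> into the arguments of \<open>\<phi>\<close>.\<close>

definition insert_mu ::
  "('k, 'o, 'm::ab_group_add) dgcat \<Rightarrow> (('o, 'm) arr list \<Rightarrow> 'n::ab_group_add) \<Rightarrow>
   ('o, 'm) arr list \<Rightarrow> 'n" where
  "insert_mu C \<phi> p =
     (\<Sum>(l, a, r) \<in> {(l, a, r). l @ a # r = p}. ksign (red l) (\<phi> (l @ mu1 C a # r))) +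
     (\<Sum>(l, a, b, r) \<in> {(l, a, b, r). l @ a # b # r = p}. ksign (red l) (\<phi> (l @ mu2 C b a # r)))"

definition multilinear ::
  "('k, 'o, 'm::plus) dgcat \<Rightarrow> ('k \<Rightarrow> 'n::plus \<Rightarrow> 'n) \<Rightarrow> 'o \<Rightarrow> (('o, 'm) arr list \<Rightarrow> 'n) \<Rightarrow> bool" where
  "multilinear C sm X \<phi> \<longleftrightarrow>
     (\<forall>l r Y Z n u v c. path C X (l @ Arr Y Z n u # r) \<and> path C X (l @ Arr Y Z n v # r) \<longrightarrow>
        \<phi> (l @ Arr Y Z n (smul C c u + v) # r) =
          sm c (\<phi> (l @ Arr Y Z n u # r)) + \<phi> (l @ Arr Y Z n v # r))"

record ('o, 'm, 'p, 'n) enhfun =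
  fob :: "'o \<Rightarrow> 'p"
  fmap :: "('o, 'm) arr list \<Rightarrow> 'n"

text \<open>
  \<open>fmap F [a1, \<dots>, ad]\<close> is the component \<open>F^d(ad, \<dots>, a1)\<close>, for \<open>d \<ge> 1\<close>, as an arrow of degree
  \<open>|a1| + \<dots> + |ad| + 1 - d\<close>.
\<close>

definition farr ::
  "('o, 'm, 'p, 'n) enhfun \<Rightarrow> ('o, 'm) arr list \<Rightarrow> ('p, 'n) arr" where
  "farr F p = Arr (fob F (src (hd p))) (fob F (tgt (last p))) (red p + 1) (fmap F p)"

definition enh_functor ::
  "('k, 'o, 'm::ab_group_add) dgcat \<Rightarrow> ('k, 'p, 'n::ab_group_add) dgcat \<Rightarrow>
   ('o, 'm, 'p, 'n) enhfun \<Rightarrow> bool" where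
  "enh_functor A B F \<longleftrightarrow>
     (\<forall>X\<in>Obj A. fob F X \<in> Obj B) \<and>
     (\<forall>X p. p \<noteq> [] \<and> path A X p \<longrightarrow> arrow B (farr F p)) \<and>
     (\<forall>X. multilinear A (smul B) X (fmap F)) \<and>
     (\<forall>X p. p \<noteq> [] \<and> path A X p \<longrightarrow>
        val (mu1 B (farr F p)) +
        (\<Sum>(l, r) \<in> {(l, r). l @ r = p \<and> l \<noteq> [] \<and> r \<noteq> []}. val (mu2 B (farr F r) (farr F l))) =
        insert_mu A (fmap F) p) \<and>
     (\<forall>X\<in>Obj A. heq B (farr F [ident A X]) (ident B (fob F X)))"

definition Idf :: "('o, 'm::zero, 'o, 'm) enhfun" where
  "Idf = \<lparr>fob = (\<lambda>X. X), fmap = (\<lambda>p. case p of [a] \<Rightarrow> val a | _ \<Rightarrow> 0)\<rparr>"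

definition fcomp ::
  "('p, 'n, 'q, 'r::comm_monoid_add) enhfun \<Rightarrow> ('o, 'm, 'p, 'n) enhfun \<Rightarrow> ('o, 'm, 'q, 'r) enhfun"
  (infixr \<open>\<bullet>\<close> 70) where
  "G \<bullet> F = \<lparr>fob = (\<lambda>X. fob G (fob F X)), fmap = (\<lambda>p. \<Sum>bs\<in>blocks p. fmap G (map (farr F) bs))\<rparr>"

fun fpow :: "('o, 'm::ab_group_add, 'o, 'm) enhfun \<Rightarrow> nat \<Rightarrow> ('o, 'm, 'o, 'm) enhfun" where
  "fpow H 0 = Idf"
| "fpow H (Suc i) = H \<bullet> fpow H i"


section \<open>The DG category of enhanced functors\<close>

text \<open>
  A pre-natural transformation \<open>F0 \<rightarrow> F1\<close> of degree \<open>g\<close> is a function \<open>T\<close> with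
  \<open>T X [a1, \<dots>, ad] \<in> Hom^(g + |a1| + \<dots> + |ad| - d) (F0 X) (F1 Xd)\<close>, where \<open>d \<ge> 0\<close> and \<open>X\<close> is the
  source of \<open>a1\<close> (needed as a separate argument when \<open>d = 0\<close>).
\<close>

type_synonym ('o, 'm, 'n) trans = "'o \<Rightarrow> ('o, 'm) arr list \<Rightarrow> 'n"

type_synonym ('o, 'm, 'p, 'n) tarr = "(('o, 'm, 'p, 'n) enhfun, ('o, 'm, 'n) trans) arr"

definition tarr :: "('o, 'm, 'p, 'n) tarr \<Rightarrow> 'o \<Rightarrow> ('o, 'm) arr list \<Rightarrow> ('p, 'n) arr" where
  "tarr \<alpha> X p =
     Arr (fob (src \<alpha>) X) (fob (tgt \<alpha>) (path_end X p)) (deg \<alpha> + red p) (val \<alpha> X p)"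

definition trans_hom ::
  "('k, 'o, 'm::ab_group_add) dgcat \<Rightarrow> ('k, 'p, 'n::ab_group_add) dgcat \<Rightarrow>
   ('o, 'm, 'p, 'n) enhfun \<Rightarrow> ('o, 'm, 'p, 'n) enhfun \<Rightarrow> int \<Rightarrow> ('o, 'm, 'n) trans set" where
  "trans_hom A B F G n = {T.
     (\<forall>X p. path A X p \<longrightarrow> arrow B (tarr (Arr F G n T) X p)) \<and>
     (\<forall>X. multilinear A (smul B) X (T X)) \<and>
     (\<forall>X p. \<not> path A X p \<longrightarrow> T X p = 0)}"

text \<open>Seidel's \<open>\<mu>^1\<close> and \<open>\<mu>^2\<close> on pre-natural transformations, for a DG target.\<close>

definition trans_mu1 ::
  "('k, 'o, 'm::ab_group_add) dgcat \<Rightarrow> ('k, 'p, 'n::ab_group_add) dgcat \<Rightarrow>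
   ('o, 'm, 'p, 'n) tarr \<Rightarrow> ('o, 'm, 'n) trans" where
  "trans_mu1 A B \<alpha> X p = (if path A X p then
     val (mu1 B (tarr \<alpha> X p)) +
     (\<Sum>(l, r) \<in> {(l, r). l @ r = p \<and> l \<noteq> []}.
        ksign ((deg \<alpha> - 1) * red l)
          (val (mu2 B (tarr \<alpha> (path_end X l) r) (farr (src \<alpha>) l)))) +
     (\<Sum>(l, r) \<in> {(l, r). l @ r = p \<and> r \<noteq> []}.
        val (mu2 B (farr (tgt \<alpha>) r) (tarr \<alpha> X l))) -
     ksign (deg \<alpha> - 1) (insert_mu A (val \<alpha> X) p)
   else 0)"

definition trans_mu2 ::
  "('k, 'o, 'm::ab_group_add) dgcat \<Rightarrow> ('k, 'p, 'n::ab_group_add) dgcat \<Rightarrow>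
   ('o, 'm, 'p, 'n) tarr \<Rightarrow> ('o, 'm, 'p, 'n) tarr \<Rightarrow> ('o, 'm, 'n) trans" where
  "trans_mu2 A B \<beta> \<alpha> X p = (if path A X p then
     (\<Sum>(l, r) \<in> {(l, r). l @ r = p}.
        ksign ((deg \<beta> - 1) * red l) (val (mu2 B (tarr \<beta> (path_end X l) r) (tarr \<alpha> X l))))
   else 0)"

text \<open>
  The functor category as a DG category; its homotopy category is the triangulated category of
  enhanced functors and (homotopy classes of) enhanced natural transformations.
\<close>

definition Fun ::
  "('k, 'o, 'm::ab_group_add) dgcat \<Rightarrow> ('k, 'p, 'n::ab_group_add) dgcat \<Rightarrow>
   ('k, ('o, 'm, 'p, 'n) enhfun, ('o, 'm, 'n) trans) dgcat" where
  "Fun A B = \<lparr>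
     Obj = {F. enh_functor A B F},
     Hom = trans_hom A B,
     smul = (\<lambda>c T X p. smul B c (T X p)),
     dgdiff = (\<lambda>\<alpha>. ksign (deg \<alpha>) (trans_mu1 A B \<alpha>)),
     dgcomp = (\<lambda>\<beta> \<alpha>. ksign (deg \<alpha>) (trans_mu2 A B \<beta> \<alpha>)),
     dgunit = (\<lambda>F X p. if X \<in> Obj A \<and> p = [] then dgunit B (fob F X) else 0)\<rparr>"

text \<open>Whiskering: \<open>wl A G \<alpha>\<close> is \<open>G \<alpha>\<close> for \<open>\<alpha>\<close> in \<open>Fun A B\<close>, and \<open>wr A \<alpha> G\<close> is \<open>\<alpha> G\<close> for
  \<open>G : A \<rightarrow> A'\<close> and \<open>\<alpha>\<close> in \<open>Fun A' B\<close>.\<close>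

definition wl ::
  "('k, 'o, 'm::ab_group_add) dgcat \<Rightarrow> ('p, 'n, 'q, 'r::ab_group_add) enhfun \<Rightarrow>
   ('o, 'm, 'p, 'n) tarr \<Rightarrow> ('o, 'm, 'q, 'r) tarr" where
  "wl A G \<alpha> = Arr (G \<bullet> src \<alpha>) (G \<bullet> tgt \<alpha>) (deg \<alpha>)
     (\<lambda>X p. if path A X p then
        (\<Sum>(bs, m, cs) \<in> {(bs, m, cs). concat bs @ m @ concat cs = p \<and> [] \<notin> set bs \<union> set cs}.
           ksign ((deg \<alpha> - 1) * red (concat bs))
             (fmap G (map (farr (src \<alpha>)) bs @ tarr \<alpha> (path_end X (concat bs)) m #
                      map (farr (tgt \<alpha>)) cs)))
      else 0)"

definition wr ::
  "('k, 'o, 'm::ab_group_add) dgcat \<Rightarrow> ('p, 'n, 'q, 'r::ab_group_add) tarr \<Rightarrow>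
   ('o, 'm, 'p, 'n) enhfun \<Rightarrow> ('o, 'm, 'q, 'r) tarr" where
  "wr A \<alpha> G = Arr (src \<alpha> \<bullet> G) (tgt \<alpha> \<bullet> G) (deg \<alpha>)
     (\<lambda>X p. if path A X p then (\<Sum>bs\<in>blocks p. val \<alpha> (fob G X) (map (farr G) bs)) else 0)"

text \<open>\<open>G : C \<rightarrow> D\<close> is left adjoint to \<open>F : D \<rightarrow> C\<close> with unit \<open>\<eta>\<close> and counit \<open>\<epsilon>\<close>.\<close>

definition adjunction ::
  "('k, 'o, 'm::ab_group_add) dgcat \<Rightarrow> ('k, 'p, 'n::ab_group_add) dgcat \<Rightarrow>
   ('o, 'm, 'p, 'n) enhfun \<Rightarrow> ('p, 'n, 'o, 'm) enhfun \<Rightarrow>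
   ('o, 'm, 'o, 'm) tarr \<Rightarrow> ('p, 'n, 'p, 'n) tarr \<Rightarrow> bool" where
  "adjunction C D G F \<eta> \<epsilon> \<longleftrightarrow>
     enh_functor C D G \<and> enh_functor D C F \<and>
     closed_arrow (Fun C C) \<eta> Idf (F \<bullet> G) 0 \<and>
     closed_arrow (Fun D D) \<epsilon> (G \<bullet> F) Idf 0 \<and>
     heq (Fun D C) (cmp (Fun D C) (wl D F \<epsilon>) (wr D \<eta> F)) (ident (Fun D C) F) \<and>
     heq (Fun C D) (cmp (Fun C D) (wr C \<epsilon> G) (wl C G \<eta>)) (ident (Fun C D) G)"


section \<open>P-functors (Anno--Logvinenko)\<close>

definition fker ::
  "('k, 'o, 'm::ab_group_add) dgcat \<Rightarrow> ('k, 'p, 'n::ab_group_add) dgcat \<Rightarrow>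
   ('o, 'm, 'p, 'n) enhfun \<Rightarrow> 'o set" where
  "fker A B F = {X \<in> Obj A. hzero B (fob F X)}"

text \<open>Essential image of a set of objects under an enhanced endofunctor.\<close>

definition ess_image ::
  "('k, 'o, 'm::ab_group_add) dgcat \<Rightarrow> ('o, 'm, 'o, 'm) enhfun \<Rightarrow> 'o set \<Rightarrow> 'o set" where
  "ess_image A H S = {Y \<in> Obj A. \<exists>X\<in>S. hisomorphic A (fob H X) Y}"

text \<open>The composite \<open>Q_m \<rightarrow> Q_(m+k)\<close> of the maps \<open>\<iota> i : Q_(i-1) \<rightarrow> Q_i\<close>.\<close>

fun postnikov_map ::
  "('k, 'o, 'm) dgcat \<Rightarrow> (nat \<Rightarrow> 'o) \<Rightarrow> (nat \<Rightarrow> ('o, 'm) arr) \<Rightarrow> nat \<Rightarrow> nat \<Rightarrow> ('o, 'm) arr" where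
  "postnikov_map C Q \<iota> m 0 = ident C (Q m)"
| "postnikov_map C Q \<iota> m (Suc k) = cmp C (\<iota> (m + Suc k)) (postnikov_map C Q \<iota> m k)"

text \<open>\<open>\<delta> i\<close> is the connecting map \<open>H^i \<rightarrow> Q_(i-1)[1]\<close>.\<close>

definition postnikov_system ::
  "nat \<Rightarrow> ('k, 'o, 'm::ab_group_add) dgcat \<Rightarrow> ('o, 'm, 'o, 'm) enhfun \<Rightarrow>
   (nat \<Rightarrow> ('o, 'm, 'o, 'm) enhfun) \<Rightarrow> (nat \<Rightarrow> ('o, 'm, 'o, 'm) tarr) \<Rightarrow>
   (nat \<Rightarrow> ('o, 'm, 'o, 'm) tarr) \<Rightarrow> (nat \<Rightarrow> ('o, 'm, 'o, 'm) tarr) \<Rightarrow> bool" where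
  "postnikov_system n A H Q \<iota> \<mu> \<delta> \<longleftrightarrow>
     Q 0 = Idf \<and>
     (\<forall>i\<in>{1..n}.
        arrow_in (Fun A A) (\<iota> i) (Q (i - 1)) (Q i) 0 \<and>
        arrow_in (Fun A A) (\<mu> i) (Q i) (fpow H i) 0 \<and>
        arrow_in (Fun A A) (\<delta> i) (fpow H i) (Q (i - 1)) 1 \<and>
        exact_triangle (Fun A A) (\<iota> i) (\<mu> i) (\<delta> i))"

text \<open>
  \<open>\<psi> : FHR \<rightarrow> FR\<close> with \<open>\<psi> \<circ> F\<mu>\<^sub>1R = (FR tr - tr FR) \<circ> (FQ\<^sub>1R \<rightarrow> FQ\<^sub>nR \<cong> FRFR)\<close>; such a \<open>\<psi>\<close> is unique.
\<close>

definition is_psi ::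
  "nat \<Rightarrow> ('k, 'o, 'm::ab_group_add) dgcat \<Rightarrow> ('k, 'p, 'n::ab_group_add) dgcat \<Rightarrow>
   ('o, 'm, 'p, 'n) enhfun \<Rightarrow> ('p, 'n, 'o, 'm) enhfun \<Rightarrow> ('p, 'n, 'p, 'n) tarr \<Rightarrow>
   ('o, 'm, 'o, 'm) enhfun \<Rightarrow> (nat \<Rightarrow> ('o, 'm, 'o, 'm) enhfun) \<Rightarrow>
   (nat \<Rightarrow> ('o, 'm, 'o, 'm) tarr) \<Rightarrow> (nat \<Rightarrow> ('o, 'm, 'o, 'm) tarr) \<Rightarrow> ('o, 'm, 'o, 'm) tarr \<Rightarrow>
   ('p, 'n, 'p, 'n) tarr \<Rightarrow> bool" where
  "is_psi n A B F R tr H Q \<iota> \<mu> \<gamma> \<psi> \<longleftrightarrow>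
     closed_arrow (Fun B B) \<psi> (F \<bullet> H \<bullet> R) (F \<bullet> R) 0 \<and>
     heq (Fun B B)
       (cmp (Fun B B) \<psi> (wl B F (wr B (\<mu> 1) R)))
       (cmp (Fun B B)
         (asub (wl B (F \<bullet> R) tr) (wr B tr (F \<bullet> R)))
         (wl B F (wr B (cmp (Fun A A) \<gamma> (postnikov_map (Fun A A) Q \<iota> 1 (n - 1))) R)))"

text \<open>
  The mate \<open>FL \<rightarrow> FH'L\<close> of \<open>\<psi> : FHR \<rightarrow> FR\<close>, where \<open>FH'L\<close> is left adjoint to \<open>FHR\<close> with unit
  \<open>id \<rightarrow> FL \<rightarrow> FHH'L \<rightarrow> FHRFH'L\<close>, and \<open>FL\<close> is left adjoint to \<open>FR\<close> with counit \<open>FLFR \<rightarrow> FR \<rightarrow> id\<close>.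
  Here \<open>\<eta> : id \<rightarrow> FL\<close>, \<open>\<epsilon> : LF \<rightarrow> id\<close>, \<open>act : id \<rightarrow> RF\<close>, \<open>tr : FR \<rightarrow> id\<close>, \<open>u : id \<rightarrow> HH'\<close>.
\<close>

definition psi_mate ::
  "('k, 'o, 'm::ab_group_add) dgcat \<Rightarrow> ('k, 'p, 'n::ab_group_add) dgcat \<Rightarrow>
   ('o, 'm, 'p, 'n) enhfun \<Rightarrow> ('p, 'n, 'o, 'm) enhfun \<Rightarrow> ('p, 'n, 'o, 'm) enhfun \<Rightarrow>
   ('p, 'n, 'p, 'n) tarr \<Rightarrow> ('o, 'm, 'o, 'm) tarr \<Rightarrow>
   ('o, 'm, 'o, 'm) tarr \<Rightarrow> ('p, 'n, 'p, 'n) tarr \<Rightarrow>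
   ('o, 'm, 'o, 'm) enhfun \<Rightarrow> ('o, 'm, 'o, 'm) enhfun \<Rightarrow> ('o, 'm, 'o, 'm) tarr \<Rightarrow>
   ('p, 'n, 'p, 'n) tarr \<Rightarrow> ('p, 'n, 'p, 'n) tarr" where
  "psi_mate A B F L R \<eta> \<epsilon> act tr H H' u \<psi> =
    (let c = cmp (Fun B B);
         unit = c (wl B F (wl B H (wr B act (H' \<bullet> L)))) (c (wl B F (wr B u L)) \<eta>);
         counit = c tr (wl B F (wr B \<epsilon> R))
     in c (wr B counit (F \<bullet> H' \<bullet> L))
          (c (wl B (F \<bullet> L) (wr B \<psi> (F \<bullet> H' \<bullet> L)))
             (wl B (F \<bullet> L) unit)))"

text \<open>
  Below, \<open>\<gamma>'\<close> is the inverse \<open>RF \<rightarrow> Q_n\<close> of \<open>\<gamma>\<close>.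
  In the monad condition \<open>c : RF \<rightarrow> Cone act\<close> is the map to the cone.
\<close>

definition monad_condition where
  "monad_condition n A B F R act H Q \<iota> \<gamma> \<psi> \<longleftrightarrow>
     (\<exists>c e. exact_triangle (Fun A A) act c e \<and>
        hiso (Fun A B)
          (cmp (Fun A B) (wl A F c)
            (cmp (Fun A B) (wr A \<psi> F)
              (wl A F (wl A H (cmp (Fun A A) \<gamma> (\<iota> n)))))))"

definition adjoints_condition where
  "adjoints_condition n A B F L R \<eta> \<mu> \<gamma>' \<longleftrightarrow>
     hiso (Fun B B)
       (cmp (Fun B B) (wl B F (wr B (cmp (Fun A A) (\<mu> n) \<gamma>') L)) (wl B (F \<bullet> R) \<eta>))"

definition highest_degree_condition where
  "highest_degree_condition n A B F L R H H' \<iota> \<mu> \<gamma> \<gamma>' \<psi> \<psi>' \<longleftrightarrow>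
    (let c = cmp (Fun B B);
         incl = wl B F (wl B H (wr B (cmp (Fun A A) \<gamma> (\<iota> n)) L));
         proj = cmp (Fun A A) (\<mu> n) \<gamma>'
     in \<exists>\<theta>. arrow_in (Fun B B) \<theta> (F \<bullet> fpow H n \<bullet> L) (F \<bullet> H \<bullet> fpow H n \<bullet> H' \<bullet> L) 0 \<and>
          hiso (Fun B B) \<theta> \<and>
          heq (Fun B B)
            (c \<theta> (c (wl B F (wr B proj L)) (c (wr B \<psi> (F \<bullet> L)) incl)))
            (c (wl B F (wl B H (wr B proj (H' \<bullet> L)))) (c (wl B F (wl B H (wl B R \<psi>'))) incl)))"

text \<open>
  \<open>F\<close> admits the structure of a \<open>P^n\<close>-functor.  An autoequivalence \<open>H\<close> comes with an inverse \<open>H'\<close>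
  as an adjoint equivalence.
\<close>

definition Pn_functor ::
  "nat \<Rightarrow> ('k, 'o, 'm::ab_group_add) dgcat \<Rightarrow> ('k, 'p, 'n::ab_group_add) dgcat \<Rightarrow>
   ('o, 'm, 'p, 'n) enhfun \<Rightarrow> bool" where
  "Pn_functor n A B F \<longleftrightarrow>
     enh_functor A B F \<and>
     (\<exists>L R \<eta> \<epsilon> act tr H H' u v Q \<iota> \<mu> \<delta> \<gamma> \<gamma>' \<psi>.
        adjunction B A L F \<eta> \<epsilon> \<and>
        adjunction A B F R act tr \<and>
        adjunction A A H' H u v \<and> hiso (Fun A A) u \<and> hiso (Fun A A) v \<and>
        ess_image A H (fker A B F) = fker A B F \<and>
        postnikov_system n A H Q \<iota> \<mu> \<delta> \<and>
        arrow_in (Fun A A) \<gamma> (Q n) (R \<bullet> F) 0 \<and> hinverse (Fun A A) \<gamma> \<gamma>' \<and>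
        heq (Fun A A) (cmp (Fun A A) \<gamma> (postnikov_map (Fun A A) Q \<iota> 0 n)) act \<and>
        is_psi n A B F R tr H Q \<iota> \<mu> \<gamma> \<psi> \<and>
        monad_condition n A B F R act H Q \<iota> \<gamma> \<psi> \<and>
        adjoints_condition n A B F L R \<eta> \<mu> \<gamma>' \<and>
        highest_degree_condition n A B F L R H H' \<iota> \<mu> \<gamma> \<gamma>' \<psi>
          (psi_mate A B F L R \<eta> \<epsilon> act tr H H' u \<psi>))"

definition P_functor ::
  "('k, 'o, 'm::ab_group_add) dgcat \<Rightarrow> ('k, 'p, 'n::ab_group_add) dgcat \<Rightarrow>
   ('o, 'm, 'p, 'n) enhfun \<Rightarrow> bool" where
  "P_functor A B F \<longleftrightarrow> (\<exists>n\<ge>1. Pn_functor n A B F)"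


section \<open>Carrier types\<close>

text \<open>
  HOL cannot quantify existentially over types, so the categories to be exhibited live on these
  carriers, which accommodate finitely generated complexes over small quivers: an object may be a
  list of shifted vertices with a matrix, and a morphism a matrix.
\<close>

type_synonym 'k matr = "nat \<Rightarrow> nat \<Rightarrow> 'k"
type_synonym 'k cob = "(nat \<times> int) list \<times> 'k matr"
type_synonym 'k small_dgcat = "('k, 'k cob, 'k matr) dgcat"
type_synonym 'k small_functor = "('k cob, 'k matr, 'k cob, 'k matr) enhfun"

end

theory Submission
  imports Defs
begin

text \<open>
  Let \<open>\<A>\<close> be the category of finite-dimensional vector spaces with a periodic grading, and let
  \<open>F : \<A> \<rightarrow> \<A>\<^sup>4\<close> be \<open>X \<mapsto> (X, X, X, 0)\<close>.  Both adjoints send \<open>(X\<^sub>1, \<dots>, X\<^sub>4)\<close> to \<open>X\<^sub>1 \<oplus> X\<^sub>2 \<oplus> X\<^sub>3\<close>.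
  The monad \<open>RF\<close> is the algebra \<open>k[x]/(x (x - 1) (x - 2))\<close> tensored with the identity, and its filtration
  by degree makes \<open>F\<close> a \<open>P\<^sup>2\<close>-functor with \<open>H = id\<close>.

  Suppose that the common adjoint \<open>G\<close> is a \<open>P\<^sup>m\<close>-functor.  An autoequivalence preserves objects with
  one-dimensional endomorphism algebra, so if \<open>S\<close> has total dimension 1, then so has every \<open>H\<^sup>i S\<close>, and
  by additivity of the parity of the total dimension \<open>G\<^sup>R G S\<close> has dimension \<open>m + 1\<close> modulo 2.  But
  \<open>G\<^sup>R G S\<close> is \<open>F G S\<close>, which has dimension 0 if \<open>S\<close> lives in the fourth component, and 3 otherwise.
\<close>

section \<open>Periodic graded vector spaces\<close>

text \<open>Parity is the only invariant at hand: a shift does not change the dimension in a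
  periodic grading, so a triangle \<open>X \<rightarrow> Y \<rightarrow> Z\<close> whose first map
  has rank \<open>r\<close> gives \<open>dim Z = dim X + dim Y - 2 r\<close>. This dictates the
  shape of \<open>F\<close>. The component 0, killed by the adjoints, contributes the dimension 0;
  the number of copies of \<open>X\<close> must then be odd, since two copies would give the
  dimensions 0 and 2, which do not contradict each other.

  On the positive side, \<open>\<psi>\<close> multiplies by a difference of two values of
  \<open>x\<close>. The three conditions thereby become statements about polynomials of degree at
  most 2 on the points 0, 1, 2, and the only number that has to be inverted is 2.

  On the negative side, the hypothetical structure consists of arbitrary A-infinity functors and
  transformations, known only up to homotopy. Their higher components are never analysed. All
  differentials in the two categories vanish, so a boundary in the functor category takes the value
  0 at every object. Evaluation at objects turns each equation up to homotopy into an equation of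
  matrices.\<close>

text \<open>
  An object is read as a list of labels.  A position labelled \<open>l \<in> {1..N}\<close> is a one-dimensional space
  over the \<open>l\<close>-th point; every other label stands for a zero space.  This makes every element of
  the carrier type an object.  The Hom spaces do not depend on the degree, so that \<open>vcat N\<close> is
  the category of graded modules over \<open>N\<close> copies of \<open>k[t, 1/t]\<close> with \<open>t\<close> of degree 1.
\<close>

abbreviation sz :: "'k cob \<Rightarrow> nat" where "sz X \<equiv> length (fst X)"

text \<open>The default 0 is never live, so positions beyond the end of the list behave like zero
  spaces, and membership in \<open>mats\<close> already bounds the indices.\<close>

definition lab :: "'k cob \<Rightarrow> nat \<Rightarrow> nat" where
  "lab X i = (if i < sz X then fst (fst X ! i) else 0)"

definition live :: "nat \<Rightarrow> nat \<Rightarrow> bool" where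
  "live N l \<longleftrightarrow> 1 \<le> l \<and> l \<le> N"

lemma not_live_0 [simp]: "\<not> live N 0"
  by (simp add: live_def)

lemma live_lab_less: "live N (lab X i) \<Longrightarrow> i < sz X"
  by (auto simp: lab_def split: if_splits)

definition mats :: "nat \<Rightarrow> 'k cob \<Rightarrow> 'k cob \<Rightarrow> 'k::field matr set" where
  "mats N X Y = {f. \<forall>j i. f j i \<noteq> 0 \<longrightarrow> lab Y j = lab X i \<and> live N (lab X i)}"

definition mprod :: "nat \<Rightarrow> 'k::field matr \<Rightarrow> 'k matr \<Rightarrow> 'k matr" where
  "mprod n g f = (\<lambda>j i. \<Sum>k<n. g j k * f k i)"

text \<open>Matrices in \<open>mats\<close> vanish at dead positions, so the identity has to vanish
  there as well.\<close>

definition unitm :: "nat \<Rightarrow> 'k cob \<Rightarrow> 'k::field matr" where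
  "unitm N X = (\<lambda>j i. if j = i \<and> live N (lab X i) then 1 else 0)"

definition vcat :: "nat \<Rightarrow> 'k::field small_dgcat" where
  "vcat N = \<lparr>Obj = UNIV, Hom = (\<lambda>X Y n. mats N X Y), smul = (\<lambda>c f j i. c * f j i),
     dgdiff = (\<lambda>a. 0), dgcomp = (\<lambda>b a. mprod (sz (tgt a)) (val b) (val a)), dgunit = unitm N\<rparr>"

lemma vcat_sel [simp]:
  "Obj (vcat N) = UNIV" "Hom (vcat N) X Y n = mats N X Y" "smul (vcat N) = (\<lambda>c f j i. c * f j i)"
  "dgdiff (vcat N) a = 0" "dgcomp (vcat N) b a = mprod (sz (tgt a)) (val b) (val a)"
  "dgunit (vcat N) = unitm N"
  by (simp_all add: vcat_def)

lemma matsD: "f \<in> mats N X Y \<Longrightarrow> f j i \<noteq> 0 \<Longrightarrow> lab Y j = lab X i \<and> live N (lab X i)"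
  by (auto simp: mats_def)

lemma mats_less: "f \<in> mats N X Y \<Longrightarrow> f j i \<noteq> 0 \<Longrightarrow> j < sz Y \<and> i < sz X"
  by (metis live_lab_less matsD)

lemma zero_mats [simp]: "0 \<in> mats N X Y"
  by (simp add: mats_def)

lemma add_mats: "f \<in> mats N X Y \<Longrightarrow> g \<in> mats N X Y \<Longrightarrow> f + g \<in> mats N X Y"
  by (auto simp: mats_def) (metis add.right_neutral add_0)+

lemma smul_mats: "f \<in> mats N X Y \<Longrightarrow> (\<lambda>j i. c * f j i) \<in> mats N X Y"
  by (auto simp: mats_def)

lemma uminus_mats: "f \<in> mats N X Y \<Longrightarrow> - f \<in> mats N X Y"
  by (auto simp: mats_def)

lemma diff_mats: "f \<in> mats N X Y \<Longrightarrow> g \<in> mats N X Y \<Longrightarrow> f - g \<in> mats N X Y"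
  using add_mats[of f N X Y "- g"] uminus_mats[of g N X Y] by simp

lemma unitm_mats [simp]: "unitm N X \<in> mats N X X"
  by (auto simp: mats_def unitm_def)

lemma mprod_mats: "g \<in> mats N Y Z \<Longrightarrow> f \<in> mats N X Y \<Longrightarrow> mprod n g f \<in> mats N X Z"
  unfolding mats_def mprod_def
  by (auto elim!: sum.not_neutral_contains_not_neutral)

lemma mprod_mats_sz [simp]:
  "g \<in> mats N Y Z \<Longrightarrow> f \<in> mats N X Y \<Longrightarrow> mprod (sz Y) g f \<in> mats N X Z"
  by (rule mprod_mats)

lemma mprod_assoc: "mprod n h (mprod m g f) = mprod m (mprod n h g) f"
proof (intro ext)
  fix j i
  have "mprod n h (mprod m g f) j i = (\<Sum>k<n. \<Sum>l<m. h j k * g k l * f l i)"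
    by (simp add: mprod_def sum_distrib_left mult.assoc)
  also have "\<dots> = (\<Sum>l<m. \<Sum>k<n. h j k * g k l * f l i)"
    by (rule sum.swap)
  finally show "mprod n h (mprod m g f) j i = mprod m (mprod n h g) f j i"
    by (simp add: mprod_def sum_distrib_right)
qed

lemma mprod_lin [simp]:
  "mprod n 0 f = 0" "mprod n g 0 = 0"
  "mprod n (g + g') f = mprod n g f + mprod n g' f" "mprod n g (f + f') = mprod n g f + mprod n g f'"
  "mprod n (- g) f = - mprod n g f" "mprod n g (- f) = - mprod n g f"
  "mprod n (g - g') f = mprod n g f - mprod n g' f" "mprod n g (f - f') = mprod n g f - mprod n g f'"
  by (auto simp: mprod_def fun_eq_iff algebra_simps sum.distrib sum_negf sum_subtractf)

lemma mprod_scale [simp]: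
  "mprod n (\<lambda>j i. c * g j i) f = (\<lambda>j i. c * mprod n g f j i)"
  "mprod n g (\<lambda>j i. c * f j i) = (\<lambda>j i. c * mprod n g f j i)"
  by (auto simp: mprod_def fun_eq_iff sum_distrib_left algebra_simps)

lemma mprod_unitm [simp]:
  assumes "f \<in> mats N X Y"
  shows "mprod (sz X) f (unitm N X) = f" "mprod (sz Y) (unitm N Y) f = f"
proof -
  have "mprod (sz X) f (unitm N X) j i = f j i" for j i
  proof -
    have "mprod (sz X) f (unitm N X) j i = (\<Sum>k<sz X. if k = i then f j k * unitm N X k i else 0)"
      unfolding mprod_def by (rule sum.cong) (auto simp: unitm_def)
    also have "\<dots> = f j i"
      using matsD[OF assms, of j i] mats_less[OF assms, of j i]
      by (cases "f j i = 0") (auto simp: unitm_def)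
    finally show ?thesis .
  qed
  moreover have "mprod (sz Y) (unitm N Y) f j i = f j i" for j i
  proof -
    have "mprod (sz Y) (unitm N Y) f j i = (\<Sum>k<sz Y. if k = j then unitm N Y j k * f k i else 0)"
      unfolding mprod_def by (rule sum.cong) (auto simp: unitm_def)
    also have "\<dots> = f j i"
      using matsD[OF assms, of j i] mats_less[OF assms, of j i]
      by (cases "f j i = 0") (auto simp: unitm_def)
    finally show ?thesis .
  qed
  ultimately show "mprod (sz X) f (unitm N X) = f" "mprod (sz Y) (unitm N Y) f = f"
    by (auto simp: fun_eq_iff)
qed

lemma mprod_unitm_unitm [simp]: "mprod (sz X) (unitm N X) (unitm N X) = unitm N X"
  by (rule mprod_unitm(1)[OF unitm_mats])

lemma arrow_vcat: "arrow (vcat N) a \<longleftrightarrow> val a \<in> mats N (src a) (tgt a)"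
  by (simp add: arrow_def)

lemma ksign_zero [simp]: "ksign d 0 = 0"
  by (auto simp: ksign_def)

abbreviation "VF N N' \<equiv> Fun (vcat N) (vcat N')"

lemma dg_category_vcat: "dg_category (vcat N :: 'k::field small_dgcat)"
proof -
  have vs: "vector_space (\<lambda>c (f :: 'k matr) j i. c * f j i)"
    by unfold_locales (auto simp: fun_eq_iff algebra_simps)
  interpret vector_space "\<lambda>c (f :: 'k matr) j i. c * f j i" by (fact vs)
  have sub: "module.subspace (\<lambda>c (f :: 'k matr) j i. c * f j i) (mats N X Y)" for X Y
    unfolding subspace_def by (auto intro: add_mats smul_mats)
  show ?thesis
    unfolding dg_category_def arrow_vcat
    by (simp add: vs sub dd_def cmp_def ident_def mprod_mats mprod_assoc)
      (auto intro: mprod_mats simp: fun_eq_iff mprod_assoc arr.expand)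
qed

lemma heq_vcat: "heq (vcat N) a b \<longleftrightarrow> val a = val b"
proof -
  have "\<exists>s. arrow_in (vcat N) s (src a) (tgt a) (deg a - 1)"
    by (rule exI[of _ "Arr (src a) (tgt a) (deg a - 1) 0"]) (simp add: arrow_in_def arrow_vcat)
  then show ?thesis by (auto simp: heq_def)
qed

section \<open>Direct sums\<close>

definition oplus :: "'k::field cob \<Rightarrow> 'k cob \<Rightarrow> 'k cob" where
  "oplus X Y = (fst X @ fst Y, 0)"

text \<open>The first summand occupies the initial positions of the concatenated list, so its
  inclusion and its projection are both given by the identity matrix of \<open>X\<close>.\<close>

definition in1 :: "nat \<Rightarrow> 'k::field cob \<Rightarrow> 'k cob \<Rightarrow> 'k matr" where
  "in1 N X Y = unitm N X"

definition pr1 :: "nat \<Rightarrow> 'k::field cob \<Rightarrow> 'k cob \<Rightarrow> 'k matr" where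
  "pr1 N X Y = unitm N X"

definition in2 :: "nat \<Rightarrow> 'k::field cob \<Rightarrow> 'k cob \<Rightarrow> 'k matr" where
  "in2 N X Y = (\<lambda>j i. if j = i + sz X \<and> live N (lab Y i) then 1 else 0)"

definition pr2 :: "nat \<Rightarrow> 'k::field cob \<Rightarrow> 'k cob \<Rightarrow> 'k matr" where
  "pr2 N X Y = (\<lambda>j i. if i = j + sz X \<and> live N (lab Y j) then 1 else 0)"

lemma lab_oplus: "lab (oplus X Y) i = (if i < sz X then lab X i else lab Y (i - sz X))"
  by (auto simp: lab_def oplus_def nth_append)

lemma biproduct_mats [simp]:
  "in1 N X Y \<in> mats N X (oplus X Y)" "pr1 N X Y \<in> mats N (oplus X Y) X"
  "in2 N X Y \<in> mats N Y (oplus X Y)" "pr2 N X Y \<in> mats N (oplus X Y) Y"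
  by (auto simp: mats_def unitm_def in1_def pr1_def in2_def pr2_def lab_oplus dest: live_lab_less)

lemma sum_single:
  fixes f :: "nat \<Rightarrow> 'a::comm_monoid_add"
  assumes "\<And>k. k < n \<Longrightarrow> k \<noteq> a \<Longrightarrow> f k = 0" and "\<not> a < n \<Longrightarrow> f a = 0"
  shows "(\<Sum>k<n. f k) = f a"
proof -
  have "(\<Sum>k<n. f k) = (\<Sum>k<n. if k = a then f k else 0)"
    by (rule sum.cong) (auto simp: assms(1))
  then show ?thesis using assms(2) by auto
qed

lemma biproduct_eqs [simp]:
  "mprod (sz (oplus X Y)) (pr1 N X Y) (in1 N X Y) = unitm N X"
  "mprod (sz (oplus X Y)) (pr2 N X Y) (in2 N X Y) = unitm N Y"
  "mprod (sz (oplus X Y)) (pr1 N X Y) (in2 N X Y) = 0"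
  "mprod (sz (oplus X Y)) (pr2 N X Y) (in1 N X Y) = 0"
  "mprod (sz X) (in1 N X Y) (pr1 N X Y) + mprod (sz Y) (in2 N X Y) (pr2 N X Y) =
     unitm N (oplus X Y)"
proof -
  have sz: "sz (oplus X Y) = sz X + sz Y" by (simp add: oplus_def)
  note defs = in1_def pr1_def in2_def pr2_def unitm_def
  show "mprod (sz (oplus X Y)) (pr1 N X Y) (in1 N X Y) = unitm N X"
  proof (intro ext)
    fix j i
    show "mprod (sz (oplus X Y)) (pr1 N X Y) (in1 N X Y) j i = unitm N X j i"
      unfolding mprod_def
      by (subst sum_single[of _ j]) (auto simp: defs sz dest: live_lab_less)
  qed
  show "mprod (sz (oplus X Y)) (pr2 N X Y) (in2 N X Y) = unitm N Y"
  proof (intro ext)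
    fix j i
    show "mprod (sz (oplus X Y)) (pr2 N X Y) (in2 N X Y) j i = unitm N Y j i"
      unfolding mprod_def
      by (subst sum_single[of _ "j + sz X"]) (auto simp: defs sz dest: live_lab_less)
  qed
  show "mprod (sz (oplus X Y)) (pr1 N X Y) (in2 N X Y) = 0"
    by (auto simp: mprod_def fun_eq_iff defs intro!: sum.neutral dest: live_lab_less)
  show "mprod (sz (oplus X Y)) (pr2 N X Y) (in1 N X Y) = 0"
    by (auto simp: mprod_def fun_eq_iff defs intro!: sum.neutral dest: live_lab_less)
  show "mprod (sz X) (in1 N X Y) (pr1 N X Y) + mprod (sz Y) (in2 N X Y) (pr2 N X Y) =
     unitm N (oplus X Y)"
  proof (intro ext)
    fix j i
    have "mprod (sz X) (in1 N X Y) (pr1 N X Y) = unitm N X" by (simp add: in1_def pr1_def)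
    moreover have "mprod (sz Y) (in2 N X Y) (pr2 N X Y) j i =
        (if j = i \<and> sz X \<le> i \<and> live N (lab Y (i - sz X)) then 1 else 0)"
      unfolding mprod_def
      by (subst sum_single[of _ "j - sz X"]) (auto simp: in2_def pr2_def dest: live_lab_less)
    ultimately show "(mprod (sz X) (in1 N X Y) (pr1 N X Y) +
        mprod (sz Y) (in2 N X Y) (pr2 N X Y)) j i = unitm N (oplus X Y) j i"
      by (auto simp: unitm_def lab_oplus dest: live_lab_less)
  qed
qed

lemma mprod_ext: "mprod n a b = c \<Longrightarrow> mprod n a (mprod m b x) = mprod m c x"
  by (simp add: mprod_assoc)

text \<open>Gaussian elimination, by induction on the number of nonzero rows. \<open>u\<close> is
  split mono and \<open>v\<close> split epi, so \<open>Z\<close> is the image of \<open>f\<close>.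
  The explicit one-sided inverses are what later yields generalised inverses and split
  idempotents.\<close>

lemma rank_factorization:
  assumes "f \<in> mats N X Y"
  shows "\<exists>Z u u' v v'. u \<in> mats N Z Y \<and> u' \<in> mats N Y Z \<and> v \<in> mats N X Z \<and> v' \<in> mats N Z X \<and>
    f = mprod (sz Z) u v \<and> mprod (sz Y) u' u = unitm N Z \<and> mprod (sz X) v v' = unitm N Z"
  using assms
proof (induction "card {j. f j \<noteq> 0}" arbitrary: f rule: less_induct)
  case less
  note f [simp] = \<open>f \<in> mats N X Y\<close>
  show ?case
  proof (cases "f = 0")
    case True
    let ?Z = "([], 0) :: 'a cob"
    have "unitm N ?Z = 0" by (auto simp: unitm_def lab_def fun_eq_iff)
    with True show ?thesis by (intro exI[of _ ?Z] exI[of _ 0]) auto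
  next
    case False
    then obtain j0 i0 where nz: "f j0 i0 \<noteq> 0" by (auto simp: fun_eq_iff)
    define a where "a = f j0 i0"
    have j0: "j0 < sz Y" and i0: "i0 < sz X" and l0: "lab X i0 = lab Y j0" "live N (lab Y j0)"
      using matsD[OF f nz] mats_less[OF f nz] by auto
    have a: "a \<noteq> 0" using nz by (simp add: a_def)
    \<comment> \<open>\<open>W\<close> is one-dimensional, at the label of the pivot.
      \<open>p\<close> is the pivot column divided by the pivot and \<open>q\<close> is the pivot
      row, so subtracting \<open>p q\<close> clears row \<open>j0\<close>.\<close>
    define W :: "'a cob" where "W = ([(lab Y j0, 0)], 0)"
    have szW: "sz W = 1" and labW: "lab W i = (if i = 0 then lab Y j0 else 0)" for i
      by (simp_all add: W_def lab_def)
    define p where "p = (\<lambda>j i::nat. if i = 0 then f j i0 / a else 0)"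
    define q where "q = (\<lambda>(j::nat) i. if j = 0 then f j0 i else 0)"
    define ej where "ej = (\<lambda>(j::nat) k. if j = 0 \<and> k = j0 then 1 else 0 :: 'a)"
    define ei where "ei = (\<lambda>k (i::nat). if i = 0 \<and> k = i0 then 1 / a else 0)"
    have [simp]: "p \<in> mats N W Y" "q \<in> mats N X W" "ej \<in> mats N Y W" "ei \<in> mats N W X"
      using l0 f by (auto simp: mats_def p_def q_def ej_def ei_def labW split: if_splits)
    have ejf: "mprod (sz Y) ej f = q"
      unfolding mprod_def using j0
      by (intro ext, subst sum_single[of _ j0]) (auto simp: ej_def q_def)
    have fei: "mprod (sz X) f ei = p"
      unfolding mprod_def using i0
      by (intro ext, subst sum_single[of _ i0]) (auto simp: ei_def p_def)
    have ejp: "mprod (sz Y) ej p = unitm N W"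
      unfolding mprod_def using j0 l0 a
      by (intro ext, subst sum_single[of _ j0]) (auto simp: ej_def p_def unitm_def labW a_def)
    have qei: "mprod (sz X) q ei = unitm N W"
      unfolding mprod_def using i0 l0 a
      by (intro ext, subst sum_single[of _ i0]) (auto simp: ei_def q_def unitm_def labW a_def)
    define f1 where "f1 = f - mprod (sz W) p q"
    have f1 [simp]: "f1 \<in> mats N X Y" by (simp add: f1_def diff_mats)
    have ejf1: "mprod (sz Y) ej f1 = 0"
      by (simp add: f1_def ejf mprod_ext[OF ejp] mprod_unitm(2)[of q N X])
    have f1ei: "mprod (sz X) f1 ei = 0"
      by (simp add: f1_def fei mprod_assoc[symmetric] qei mprod_unitm(1)[of p N W Y])
    have "{j. f1 j \<noteq> 0} \<subset> {j. f j \<noteq> 0}"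
    proof
      have "f1 j = 0" if "f j = 0" for j
        using that by (auto simp: f1_def mprod_def szW p_def fun_eq_iff)
      then show "{j. f1 j \<noteq> 0} \<subseteq> {j. f j \<noteq> 0}" by auto
      have "f1 j0 = 0"
        using a by (auto simp: f1_def mprod_def szW p_def q_def fun_eq_iff a_def)
      moreover have "f j0 \<noteq> 0" using nz by auto
      ultimately show "{j. f1 j \<noteq> 0} \<noteq> {j. f j \<noteq> 0}" by blast
    qed
    moreover have "finite {j. f j \<noteq> 0}"
      by (rule finite_subset[of _ "{..<sz Y}"])
        (use mats_less[OF f] in \<open>auto simp: fun_eq_iff\<close>)
    ultimately have "card {j. f1 j \<noteq> 0} < card {j. f j \<noteq> 0}" by (rule psubset_card_mono[rotated])
    from less.hyps[OF this f1] obtain Z u u' v v' where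
      [simp]: "u \<in> mats N Z Y" "u' \<in> mats N Y Z" "v \<in> mats N X Z" "v' \<in> mats N Z X" and
      f1uv: "f1 = mprod (sz Z) u v" and u'u: "mprod (sz Y) u' u = unitm N Z" and
      vv': "mprod (sz X) v v' = unitm N Z" by blast
    \<comment> \<open>\<open>ej\<close> kills \<open>f1 = u v\<close>, and the split epimorphism
      \<open>v\<close> can be cancelled on the right.\<close>
    have "mprod (sz Y) ej u = mprod (sz X) (mprod (sz Z) (mprod (sz Y) ej u) v) v'"
      by (simp add: mprod_assoc[symmetric] vv' mprod_unitm(1)[of u N Z Y])
    also have "\<dots> = 0" using ejf1 by (simp add: mprod_assoc[symmetric] f1uv)
    finally have eju: "mprod (sz Y) ej u = 0" .
    have "mprod (sz X) v ei = mprod (sz Y) u' (mprod (sz Z) u (mprod (sz X) v ei))"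
      by (simp add: mprod_assoc u'u mprod_unitm(2)[of v N X Z])
    also have "\<dots> = 0" using f1ei by (simp add: mprod_assoc f1uv)
    finally have vei: "mprod (sz X) v ei = 0" .
    let ?Z = "oplus Z W"
    let ?i1 = "in1 N Z W" and ?i2 = "in2 N Z W" and ?p1 = "pr1 N Z W" and ?p2 = "pr2 N Z W"
    \<comment> \<open>The inverses belonging to \<open>f1\<close> are corrected by a multiple of the
      pivot part, such that \<open>?A p = 0\<close> and \<open>q ?B = 0\<close>. This makes the
      matrices on \<open>Z \<oplus> W\<close> inverse to each other block by block.\<close>
    let ?A = "u' - mprod (sz W) (mprod (sz Y) u' p) ej"
    let ?B = "v' - mprod (sz W) ei (mprod (sz X) q v')"
    let ?U = "mprod (sz Z) u ?p1 + mprod (sz W) p ?p2"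
    let ?V = "mprod (sz Z) ?i1 v + mprod (sz W) ?i2 q"
    let ?U' = "mprod (sz Z) ?i1 ?A + mprod (sz W) ?i2 ej"
    let ?V' = "mprod (sz Z) ?B ?p1 + mprod (sz W) ei ?p2"
    note ext = mprod_ext[OF ejp] mprod_ext[OF eju] mprod_ext[OF u'u] mprod_ext[OF vei]
      mprod_ext[OF vv'] mprod_ext[OF qei] mprod_ext[OF biproduct_eqs(1)]
      mprod_ext[OF biproduct_eqs(2)] mprod_ext[OF biproduct_eqs(3)] mprod_ext[OF biproduct_eqs(4)]
      mprod_unitm(2)[of v N X Z] mprod_unitm(2)[of q N X W] mprod_unitm(2)[of ?p1 N ?Z Z]
      mprod_unitm(2)[of ?p2 N ?Z W] mprod_unitm(1)[of p N W Y] mprod_unitm(1)[of ?i1 N Z ?Z]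
    have "mprod (sz ?Z) ?U ?V = f"
      by (simp add: mprod_assoc[symmetric] ext flip: f1uv) (simp add: f1_def)
    moreover have "mprod (sz Y) ?U' ?U = unitm N ?Z"
      by (simp add: mprod_assoc[symmetric] ext u'u ejp eju)
    moreover have "mprod (sz X) ?V ?V' = unitm N ?Z"
      by (simp add: mprod_assoc[symmetric] ext vv' vei qei
          mprod_ext[OF mprod_unitm(1)[of ?i2 N W ?Z]])
    moreover have "?U \<in> mats N ?Z Y" "?V \<in> mats N X ?Z" "?U' \<in> mats N Y ?Z" "?V' \<in> mats N ?Z X"
      by (intro add_mats diff_mats mprod_mats_sz; simp add: add_mats diff_mats)+
    ultimately show ?thesis
      by (intro exI[of _ ?Z] exI[of _ ?U] exI[of _ ?U'] exI[of _ ?V] exI[of _ ?V']) simp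
  qed
qed

text \<open>For \<open>e = u v\<close> as in the rank factorization, \<open>u v u v = u v\<close>
  can be cancelled by \<open>u\<close> on the left and \<open>v\<close> on the right, which leaves
  \<open>v u = 1\<close>.\<close>

lemma idempotent_splits:
  assumes "e \<in> mats N X X" "mprod (sz X) e e = e"
  obtains Z s t where "s \<in> mats N Z X" "t \<in> mats N X Z" "e = mprod (sz Z) s t"
    "mprod (sz X) t s = unitm N Z"
proof -
  obtain Z u u' v v' where
    [simp]: "u \<in> mats N Z X" "u' \<in> mats N X Z" "v \<in> mats N X Z" "v' \<in> mats N Z X" and
    e: "e = mprod (sz Z) u v" and u'u: "mprod (sz X) u' u = unitm N Z" and
    vv': "mprod (sz X) v v' = unitm N Z"
    using rank_factorization[OF assms(1)] by metis
  have "mprod (sz X) v u =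
      mprod (sz X) (mprod (sz X) u' (mprod (sz X) (mprod (sz Z) u v) (mprod (sz Z) u v))) v'"
    by (simp add: mprod_assoc u'u mprod_unitm(2)[of v N X Z])
      (simp add: mprod_assoc[symmetric] vv' mprod_unitm(1)[of u N Z X])
  also have "\<dots> = mprod (sz X) (mprod (sz X) u' (mprod (sz Z) u v)) v'"
    using assms(2) by (simp add: e)
  also have "\<dots> = unitm N Z"
    by (simp add: mprod_assoc u'u mprod_unitm(2)[of v N X Z] vv')
  finally show ?thesis using that[of u Z v] e by simp
qed

text \<open>The category is semisimple, so a cone is the sum of cokernel and shifted kernel. By
  periodicity the kernel serves as its own shift, and in the same way every \<open>X\<close> is its
  own shift through its identity matrix, placed in degree \<open>n\<close>.\<close>

lemma enhanced_triangulated_vcat: "enhanced_triangulated (vcat N :: 'k::field small_dgcat)"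
proof -
  have "\<exists>g h. exact_triangle (vcat N) a g h"
    if a: "closed_arrow (vcat N) a X Y 0" for X Y and a :: "('k cob, 'k matr) arr"
  proof -
    define f where "f = val a"
    have af: "a = Arr X Y 0 f" and f [simp]: "f \<in> mats N X Y"
      using a by (cases a, auto simp: closed_arrow_def arrow_in_def arrow_vcat f_def)+
    obtain Z u u' v v' where
      [simp]: "u \<in> mats N Z Y" "u' \<in> mats N Y Z" "v \<in> mats N X Z" "v' \<in> mats N Z X" and
      uv: "f = mprod (sz Z) u v" and u'u: "mprod (sz Y) u' u = unitm N Z" and
      vv': "mprod (sz X) v v' = unitm N Z"
      using rank_factorization[OF f] by metis
    \<comment> \<open>A generalised inverse, \<open>f \<phi> f = f\<close>. Hence \<open>e\<close>
      and \<open>e'\<close> below are idempotents onto the kernel of \<open>f\<close> and onto a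
      complement of its image.\<close>
    define \<phi> where "\<phi> = mprod (sz Z) v' u'"
    have \<phi> [simp]: "\<phi> \<in> mats N Y X" by (simp add: \<phi>_def)
    have reg: "mprod (sz Y) (mprod (sz X) f \<phi>) f = f"
    proof -
      have "mprod (sz X) f \<phi> = mprod (sz Z) u u'"
        by (simp add: uv \<phi>_def mprod_assoc[symmetric] mprod_ext[OF vv']
            mprod_unitm(2)[of u' N Y Z])
      then show ?thesis
        by (simp add: uv mprod_assoc[symmetric] mprod_ext[OF u'u] mprod_unitm(2)[of v N X Z])
    qed
    define e where "e = unitm N X - mprod (sz Y) \<phi> f"
    define e' where "e' = unitm N Y - mprod (sz X) f \<phi>"
    have eM: "e \<in> mats N X X" "e' \<in> mats N Y Y"
      by (simp_all add: e_def e'_def diff_mats)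
    have fe: "mprod (sz X) f e = 0" and e'f: "mprod (sz Y) e' f = 0"
      using reg by (simp_all add: e_def e'_def mprod_assoc mprod_unitm[of f N X Y])
    have "mprod (sz X) e e = mprod (sz X) (unitm N X) e - mprod (sz Y) \<phi> (mprod (sz X) f e)"
      by (subst (1) e_def) (simp only: mprod_lin mprod_assoc)
    then have ee: "mprod (sz X) e e = e"
      by (simp add: fe mprod_unitm[OF eM(1)])
    have "mprod (sz Y) e' e' = mprod (sz Y) e' (unitm N Y) - mprod (sz X) (mprod (sz Y) e' f) \<phi>"
      by (subst (2) e'_def) (simp only: mprod_lin mprod_assoc)
    then have ee': "mprod (sz Y) e' e' = e'"
      by (simp add: e'f mprod_unitm[OF eM(2)])
    obtain K s t where
      [simp]: "s \<in> mats N K X" "t \<in> mats N X K" and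
      st: "e = mprod (sz K) s t" and ts: "mprod (sz X) t s = unitm N K"
      using idempotent_splits[OF eM(1) ee] .
    obtain C s' t' where
      [simp]: "s' \<in> mats N C Y" "t' \<in> mats N Y C" and
      st': "e' = mprod (sz C) s' t'" and ts': "mprod (sz Y) t' s' = unitm N C"
      using idempotent_splits[OF eM(2) ee'] .
    have "mprod (sz X) f s = mprod (sz X) (mprod (sz X) f (mprod (sz K) s t)) s"
      by (simp add: mprod_assoc[symmetric] ts mprod_unitm(1)[of s N K X])
    also have "\<dots> = 0" using fe by (simp only: st mprod_lin)
    finally have fs: "mprod (sz X) f s = 0" .
    have "mprod (sz Y) t' f = mprod (sz Y) t' (mprod (sz Y) (mprod (sz C) s' t') f)"
      by (simp add: mprod_assoc ts' mprod_unitm(2)[of t' N Y C])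
    also have "\<dots> = 0" using e'f by (simp only: st' mprod_lin)
    finally have t'f: "mprod (sz Y) t' f = 0" .
    let ?Z = "oplus K C"
    let ?g = "Arr Y ?Z 0 (mprod (sz C) (in2 N K C) t')"
    let ?h = "Arr ?Z X 1 (mprod (sz K) s (pr1 N K C))"
    note ext = mprod_ext[OF biproduct_eqs(1)] mprod_ext[OF biproduct_eqs(2)]
        mprod_ext[OF biproduct_eqs(3)] mprod_ext[OF biproduct_eqs(4)] mprod_unitm(2)[of t N X K]
        mprod_unitm(2)[of t' N Y C] mprod_unitm(2)[of "pr1 N K C" N "oplus K C" K]
        mprod_unitm(2)[of "pr2 N K C" N "oplus K C" C]
        mprod_ext[OF ts] mprod_ext[OF ts'] mprod_ext[OF fs] mprod_ext[OF t'f]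
    have "exact_triangle (vcat N) a ?g ?h"
      unfolding exact_triangle_def
      apply (rule exI[of _ X], rule exI[of _ Y], rule exI[of _ ?Z])
      apply (rule exI[of _ "Arr X ?Z (-1) (mprod (sz K) (in1 N K C) t)"])
      apply (rule exI[of _ "Arr ?Z Y 0 (mprod (sz C) s' (pr2 N K C))"])
      apply (rule exI[of _ "Arr ?Z ?Z (-1) 0"], rule exI[of _ "Arr X X (-1) 0"])
      \<comment> \<open>The equations \<open>s t - 1 = - \<phi> f\<close> and
        \<open>s' t' - 1 = - f \<phi>\<close> force this entry of the homotopy on the cone; all
        other entries can be 0.\<close>
      apply (rule exI[of _ "Arr Y X 0 (- \<phi>)"])
      apply (rule exI[of _ "Arr X Y (-2) 0"], rule exI[of _ "Arr Y Y (-1) 0"])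
      unfolding closed_arrow_def arrow_in_def arrow_vcat vcat_sel af arr.sel
      apply (intro conjI)
      apply (simp_all add: uminus_mats)
      apply (simp_all add: mprod_assoc[symmetric] ext fs t'f)
      apply (simp_all add: e_def e'_def flip: st st')
      done
    then show ?thesis by blast
  qed
  moreover have "\<exists>X. hzero (vcat N) (X :: 'k cob)"
    by (rule exI[of _ "([], 0)"])
      (auto simp: hzero_def heq_vcat ident_def unitm_def lab_def fun_eq_iff)
  moreover have "\<exists>Y s. arrow_in (vcat N :: 'k small_dgcat) s Y X n \<and> hiso (vcat N) s" for X :: "'k cob" and n
  proof (intro exI conjI)
    show "arrow_in (vcat N) (Arr X X n (unitm N X)) X X n"
      by (simp add: arrow_in_def arrow_vcat)
    have "hinverse (vcat N) (Arr X X n (unitm N X)) (Arr X X (-n) (unitm N X))"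
      by (simp add: hinverse_def closed_arrow_def arrow_in_def arrow_vcat heq_vcat cmp_def ident_def)
    then show "hiso (vcat N) (Arr X X n (unitm N X))" by (auto simp: hiso_def)
  qed
  ultimately show ?thesis
    unfolding enhanced_triangulated_def by (intro conjI dg_category_vcat ballI allI impI) 
qed

section \<open>Strict functors and transformations\<close>

text \<open>
  A pair \<open>(r, l)\<close> encodes the functor that replaces each position with label \<open>a\<close> by \<open>r\<close> positions
  with labels \<open>l a 0, \<dots>, l a (r - 1)\<close>; position \<open>i\<close> of the result comes from position \<open>i div r\<close>.
  The label 0 discards a position.
\<close>

type_synonym twd = "nat \<times> (nat \<Rightarrow> nat \<Rightarrow> nat)"

definition tob :: "twd \<Rightarrow> 'k cob \<Rightarrow> 'k cob" where
  "tob D X = (map (\<lambda>i. (snd D (lab X (i div fst D)) (i mod fst D), snd (fst X ! (i div fst D))))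
     [0..<sz X * fst D], snd X)"

text \<open>The Kronecker product with an identity matrix, restricted to the positions that are
  kept. Entries at old label 0 vanish for matrices in \<open>mats\<close>, but a functor is a
  function on all lists of arrows, meaningless ones included; keeping these entries makes
  \<open>tw idd\<close> literally equal to \<open>Idf\<close>.\<close>

definition tmat :: "twd \<Rightarrow> 'k cob \<Rightarrow> 'k matr \<Rightarrow> 'k::field matr" where
  "tmat D X f = (\<lambda>j i. if j mod fst D = i mod fst D \<and>
      (lab X (i div fst D) = 0 \<or> snd D (lab X (i div fst D)) (i mod fst D) \<noteq> 0)
    then f (j div fst D) (i div fst D) else 0)"

definition tw :: "twd \<Rightarrow> 'k::field small_functor" where
  "tw D = \<lparr>fob = tob D, fmap = (\<lambda>p. case p of [a] \<Rightarrow> tmat D (src a) (val a) | _ \<Rightarrow> 0)\<rparr>"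

definition okd :: "twd \<Rightarrow> bool" where
  "okd D \<longleftrightarrow> fst D > 0 \<and> (\<forall>c. snd D 0 c = 0)"

definition okf :: "nat \<Rightarrow> nat \<Rightarrow> twd \<Rightarrow> bool" where
  "okf N N' D \<longleftrightarrow> okd D \<and>
     (\<forall>l c. c < fst D \<longrightarrow> live N' (snd D l c) = (live N l \<and> snd D l c \<noteq> 0))"

definition idd :: twd where "idd = (1, \<lambda>l c. l)"

text \<open>Positions are read as digits: \<open>c div fst E\<close> is the copy made by the inner
  functor \<open>D\<close>, and \<open>c mod fst E\<close> the one made by the outer functor
  \<open>E\<close>.\<close>

definition compd :: "twd \<Rightarrow> twd \<Rightarrow> twd" (infixr \<open>\<odot>\<close> 70) where
  "E \<odot> D = (fst D * fst E, \<lambda>l c. snd E (snd D l (c div fst E)) (c mod fst E))"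

lemma okd_pos: "okd D \<Longrightarrow> 0 < fst D" and okd_0: "okd D \<Longrightarrow> snd D 0 c = 0"
  by (auto simp: okd_def)

lemma sz_tob [simp]: "sz (tob D X) = sz X * fst D"
  by (simp add: tob_def)

lemma lab_tob: "okd D \<Longrightarrow> lab (tob D X) i = snd D (lab X (i div fst D)) (i mod fst D)"
  by (auto simp: lab_def tob_def okd_def less_mult_imp_div_less div_less_iff_less_mult)

lemma tmat_zero [simp]: "tmat D X 0 = 0"
  by (auto simp: tmat_def fun_eq_iff)

lemma fob_tw [simp]: "fob (tw D) = tob D"
  by (simp add: tw_def)

lemma fmap_tw [simp]:
  "fmap (tw D) [] = 0" "fmap (tw D) [a] = tmat D (src a) (val a)" "fmap (tw D) (a # b # p) = 0"
  by (simp_all add: tw_def)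

lemma fmap_tw_long: "length p \<noteq> 1 \<Longrightarrow> fmap (tw D) p = 0"
  by (cases p; cases "tl p") auto

lemma tw_idd: "tw idd = (Idf :: 'k::field small_functor)"
proof -
  have "tob idd X = (X :: 'k cob)" for X
    by (auto simp: tob_def idd_def lab_def prod_eq_iff intro!: nth_equalityI)
  moreover have "(case p of [a] \<Rightarrow> tmat idd (src a) (val a) | _ \<Rightarrow> 0) = (case p of [a] \<Rightarrow> val a | _ \<Rightarrow> 0)"
    for p :: "('k cob, 'k matr) arr list"
    by (auto simp: tmat_def idd_def fun_eq_iff split: list.splits)
  ultimately show ?thesis by (auto simp: tw_def Idf_def)
qed

lemma okd_idd [simp]: "okd idd" and okf_idd [simp]: "okf N N idd"
  by (auto simp: okd_def okf_def idd_def live_def)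

lemma okd_compd [simp]: "okd D \<Longrightarrow> okd E \<Longrightarrow> okd (E \<odot> D)"
  by (auto simp: okd_def compd_def)

lemma okf_compd: "okf N N' D \<Longrightarrow> okf N' N'' E \<Longrightarrow> okf N N'' (E \<odot> D)"
  unfolding okf_def
  by (auto simp: compd_def less_mult_imp_div_less okd_def intro!: Suc_leI gr0I)

lemma blocks_Nil: "blocks [] = {[]}"
  by (auto simp: blocks_def) (metis list.set_intros(1) neq_Nil_conv)

lemma blocks_single: "blocks [a] = {[[a]]}"
proof -
  have "bs = [[a]]" if "concat bs = [a]" "[] \<notin> set bs" for bs
    using that by (cases bs; cases "hd bs"; cases "tl bs"; cases "hd (tl bs)") auto
  then show ?thesis by (auto simp: blocks_def)
qed

lemma wl_index_Nil:
  "{(bs, m, cs). concat bs @ m @ concat cs = [] \<and> [] \<notin> set bs \<union> set cs} =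
    {([], [] :: 'a list, [])}"
proof -
  have "concat bs = [] \<and> [] \<notin> set bs \<longleftrightarrow> bs = []" for bs :: "'a list list"
    by (cases bs) auto
  then show ?thesis by auto
qed

lemma idx_simps:
  "i div (r * s) = i div s div r" "i mod (r * s) div s = i div s mod r" "i mod (r * s) mod s = i mod s"
  if "0 < s" for i r s :: nat
proof -
  show "i div (r * s) = i div s div r" by (metis div_mult2_eq mult.commute)
  show "i mod (r * s) div s = i div s mod r"
    using that mod_mult2_eq[of i s r] by (simp add: mult.commute)
  show "i mod (r * s) mod s = i mod s" by (simp add: mod_mod_cancel)
qed

lemma mod_mult_eq_iff:
  "j mod (r * s) = i mod (r * s) \<longleftrightarrow> j mod s = i mod s \<and> j div s mod r = i div s mod r"
  if "0 < s" for i r s :: nat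
proof -
  have "j mod (r * s) = s * (j div s mod r) + j mod s" for j
    by (metis mod_mult2_eq mult.commute)
  then show ?thesis using idx_simps[OF that] by metis
qed

lemma tob_tob:
  assumes "okd D" "okd E"
  shows "tob E (tob D X) = tob (E \<odot> D) X"
proof -
  note p = okd_pos[OF assms(1)] okd_pos[OF assms(2)]
  have "fst (tob E (tob D X)) ! i = fst (tob (E \<odot> D) X) ! i"
    if i: "i < sz X * (fst D * fst E)" for i
  proof -
    have "i div fst E < sz X * fst D"
      using i by (simp add: less_mult_imp_div_less mult.assoc)
    then have "snd (fst (tob D X) ! (i div fst E)) = snd (fst X ! (i div fst E div fst D))"
      by (simp add: tob_def)
    then show ?thesis
      using i p
      by (simp add: tob_def[of E] tob_def[of "E \<odot> D"] lab_tob assms idx_simps mult.assoc)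
        (simp add: compd_def idx_simps)
  qed
  then have "fst (tob E (tob D X)) = fst (tob (E \<odot> D) X)"
    by (intro nth_equalityI) (auto simp: compd_def mult.assoc)
  moreover have "snd (tob E (tob D X)) = snd (tob (E \<odot> D) X)"
    by (simp add: tob_def)
  ultimately show ?thesis by (simp add: prod_eq_iff)
qed

lemma tmat_tmat:
  assumes "okd D" "okd E"
  shows "tmat E (tob D X) (tmat D X f) = tmat (E \<odot> D) X f"
proof (intro ext)
  fix j i
  note p = okd_pos[OF assms(1)] okd_pos[OF assms(2)]
  show "tmat E (tob D X) (tmat D X f) j i = tmat (E \<odot> D) X f j i"
    using p okd_0[OF assms(1)] okd_0[OF assms(2)]
    by (auto simp: tmat_def lab_tob assms compd_def idx_simps mod_mult_eq_iff)
qed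

lemma farr_tw: "farr (tw D) [a] = Arr (tob D (src a)) (tob D (tgt a)) (deg a) (tmat D (src a) (val a))"
  by (simp add: farr_def red_def)

lemma farr_tw_long: "length p \<noteq> 1 \<Longrightarrow> val (farr (tw D) p) = 0"
  by (simp add: farr_def fmap_tw_long)

text \<open>An equality of records, not only up to homotopy: a strict functor sees a path only if it
  is a single arrow, and such a path has one division into blocks.\<close>

lemma fcomp_tw:
  assumes "okd D" "okd E"
  shows "tw E \<bullet> tw D = tw (E \<odot> D)"
proof -
  have "(\<Sum>bs\<in>blocks p. fmap (tw E) (map (farr (tw D)) bs)) = fmap (tw (E \<odot> D)) p"
    for p :: "('b cob, 'b::field matr) arr list"
  proof (cases "\<exists>a. p = [a]")
    case True
    then obtain a where a: "p = [a]" by blast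
    then show ?thesis by (simp add: blocks_single farr_tw tmat_tmat assms)
  next
    case False
    have "fmap (tw E) (map (farr (tw D)) bs) = 0" if "bs \<in> blocks p" for bs
    proof (cases "length bs = 1")
      case True
      then obtain b where "bs = [b]" by (cases bs) auto
      then have "bs = [p]" using that by (simp add: blocks_def)
      moreover have "length p \<noteq> 1" using False by (cases p) auto
      ultimately show ?thesis by (simp add: farr_tw_long)
    qed (simp add: fmap_tw_long)
    moreover have "length p \<noteq> 1" using False by (cases p) auto
    ultimately show ?thesis by (simp add: fmap_tw_long)
  qed
  then show ?thesis
    by (auto simp: fcomp_def tw_def[of "E \<odot> D"] tob_tob assms fun_eq_iff)
qed

lemma tmat_mats:
  assumes "okf N N' D" "f \<in> mats N X Y"
  shows "tmat D X f \<in> mats N' (tob D X) (tob D Y)"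
proof -
  have "okd D" using assms by (simp add: okf_def)
  note p = okd_pos[OF this] okd_0[OF this]
  show ?thesis
    using assms p unfolding mats_def okf_def
    by (auto simp: lab_tob tmat_def split: if_splits) (metis not_live_0)
qed

lemma sum_nat_group: "(\<Sum>k<n * r. f k) = (\<Sum>k<n. \<Sum>c<r. f (k * r + c :: nat))"
proof -
  have "(\<Sum>k<n * r. f k) = (\<Sum>k<n. sum f {k * r..<k * r + r})"
    by (simp add: sum.nat_group)
  also have "\<dots> = (\<Sum>k<n. \<Sum>c<r. f (k * r + c))"
    by (rule sum.cong, rule refl, subst sum.atLeastLessThan_shift_0)
      (simp add: lessThan_atLeast0 comp_def)
  finally show ?thesis .
qed

text \<open>A middle position is a pair of an old position and a copy, and only the copy
  \<open>i mod fst D\<close> contributes. Since \<open>f\<close> relates equal labels only, the test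
  on labels gives the same answer at the middle position as at \<open>i\<close>.\<close>

lemma tmat_mprod:
  assumes "okd D" "f \<in> mats N X Y"
  shows "tmat D X (mprod (sz Y) g f) = mprod (sz (tob D Y)) (tmat D Y g) (tmat D X f)"
proof (intro ext)
  fix j i
  let ?r = "fst D"
  note p = okd_pos[OF assms(1)]
  let ?K = "lab X (i div ?r) = 0 \<or> snd D (lab X (i div ?r)) (i mod ?r) \<noteq> 0"
  have "mprod (sz (tob D Y)) (tmat D Y g) (tmat D X f) j i =
    (\<Sum>k<sz Y. \<Sum>c<?r. tmat D Y g j (k * ?r + c) * tmat D X f (k * ?r + c) i)"
    by (simp add: mprod_def sum_nat_group)
  also have "\<dots> = (\<Sum>k<sz Y. if j mod ?r = i mod ?r \<and> ?K then g (j div ?r) k * f k (i div ?r) else 0)"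
  proof (rule sum.cong)
    fix k assume "k \<in> {..<sz Y}"
    have "(\<Sum>c<?r. tmat D Y g j (k * ?r + c) * tmat D X f (k * ?r + c) i) =
      tmat D Y g j (k * ?r + i mod ?r) * tmat D X f (k * ?r + i mod ?r) i"
      by (rule sum_single) (use p in \<open>auto simp: tmat_def\<close>)
    also have "\<dots> = (if j mod ?r = i mod ?r \<and> ?K then g (j div ?r) k * f k (i div ?r) else 0)"
      using p matsD[OF assms(2), of k "i div ?r"]
      by (cases "f k (i div ?r) = 0") (auto simp: tmat_def)
    finally show "(\<Sum>c<?r. tmat D Y g j (k * ?r + c) * tmat D X f (k * ?r + c) i) = \<dots>" .
  qed simp
  also have "\<dots> = tmat D X (mprod (sz Y) g f) j i"
    by (auto simp: tmat_def mprod_def)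
  finally show "tmat D X (mprod (sz Y) g f) j i =
    mprod (sz (tob D Y)) (tmat D Y g) (tmat D X f) j i" by simp
qed

lemma tmat_ksign: "tmat D X (ksign n f) = ksign n (tmat D X f)"
  by (auto simp: ksign_def tmat_def fun_eq_iff)

lemma tmat_lin: "tmat D X ((\<lambda>j i. c * f j i) + g) = (\<lambda>j i. c * tmat D X f j i) + tmat D X g"
  by (auto simp: tmat_def fun_eq_iff)

lemma tmat_unitm:
  assumes "okf N N' D"
  shows "tmat D X (unitm N X) = unitm N' (tob D X)"
proof (intro ext)
  fix j i
  have D: "okd D" using assms by (simp add: okf_def)
  have "j = i \<longleftrightarrow> j mod fst D = i mod fst D \<and> j div fst D = i div fst D"
    by (metis div_mod_decomp)
  moreover have "live N' (snd D (lab X (i div fst D)) (i mod fst D)) \<longleftrightarrow>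
      live N (lab X (i div fst D)) \<and> snd D (lab X (i div fst D)) (i mod fst D) \<noteq> 0"
    using assms okd_pos[OF D] by (simp add: okf_def)
  ultimately show "tmat D X (unitm N X) j i = unitm N' (tob D X) j i"
    using okd_pos[OF D] by (auto simp: tmat_def unitm_def lab_tob[OF D])
qed

text \<open>Of all insertions only the product of two arrows survives, so that the A-infinity
  equations of a strict functor shrink to ordinary functoriality.\<close>

lemma insert_mu_strict:
  assumes \<phi>: "\<And>q. length q \<noteq> 1 \<Longrightarrow> \<phi> q = 0" and mu1: "\<And>a. \<phi> [mu1 C a] = 0"
  shows "insert_mu C \<phi> p = (case p of [a, b] \<Rightarrow> \<phi> [mu2 C b a] | _ \<Rightarrow> 0)"
proof -
  have "\<phi> (l @ mu1 C a # r) = 0" for l a r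
    by (cases "l = [] \<and> r = []") (auto simp: \<phi> mu1)
  then have 1: "(\<Sum>(l, a, r) \<in> {(l, a, r). l @ a # r = p}. ksign (red l) (\<phi> (l @ mu1 C a # r))) = 0"
    by (auto intro!: sum.neutral simp: ksign_def)
  show ?thesis
  proof (cases "length p = 2")
    case True
    then obtain a b where p: "p = [a, b]"
      by (cases p; cases "tl p") auto
    have "{(l, a', b', r). l @ a' # b' # r = p} = {([], a, b, [])}"
      by (auto simp: p append_eq_Cons_conv)
    then show ?thesis
      using 1 by (simp add: insert_mu_def p red_def ksign_def)
  next
    case False
    then have "\<phi> (l @ mu2 C b a # r) = 0" if "l @ a # b # r = p" for l a b r
      using that by (auto intro!: \<phi>)
    then have "(\<Sum>(l, a, b, r) \<in> {(l, a, b, r). l @ a # b # r = p}.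
        ksign (red l) (\<phi> (l @ mu2 C b a # r))) = 0"
      by (auto intro!: sum.neutral simp: ksign_def)
    with 1 False show ?thesis
      by (auto simp: insert_mu_def split: list.splits)
  qed
qed

lemma val_mu1_vcat [simp]: "val (mu1 (vcat N) a) = 0"
  by (simp add: mu1_def)

lemma strict_multilinear:
  assumes "\<And>q. length q \<noteq> 1 \<Longrightarrow> \<phi> q = 0"
    and "\<And>Y Z n u v c. \<phi> [Arr Y Z n (smul (vcat N) c u + v)] =
      smul (vcat N') c (\<phi> [Arr Y Z n u]) + \<phi> [Arr Y Z n v]"
  shows "multilinear (vcat N) (smul (vcat N')) X \<phi>"
  unfolding multilinear_def
proof (intro allI impI)
  fix l r Y Z n u v c
  show "\<phi> (l @ Arr Y Z n (smul (vcat N) c u + v) # r) =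
     smul (vcat N') c (\<phi> (l @ Arr Y Z n u # r)) + \<phi> (l @ Arr Y Z n v # r)"
  proof (cases "l = [] \<and> r = []")
    case False
    then have "\<phi> (l @ a # r) = 0" for a by (intro assms(1)) auto
    then show ?thesis by (simp add: fun_eq_iff)
  qed (use assms(2) in simp)
qed

lemma enh_functor_tw:
  assumes "okf N N' D"
  shows "enh_functor (vcat N) (vcat N') (tw D)"
proof -
  have D: "okd D" using assms by (simp add: okf_def)
  have "arrow (vcat N') (farr (tw D) p)" if "path (vcat N) X p" for X p
  proof (cases "length p = 1")
    case True
    then obtain a where "p = [a]" by (cases p) auto
    then show ?thesis using that by (auto simp: farr_tw arrow_vcat intro: tmat_mats[OF assms])
  next
    case False
    then show ?thesis by (simp add: arrow_vcat farr_tw_long)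
  qed
  moreover have "multilinear (vcat N) (smul (vcat N')) X (fmap (tw D))" for X
    by (rule strict_multilinear) (simp_all add: fmap_tw_long tmat_lin)
  moreover have "val (mu1 (vcat N') (farr (tw D) p)) +
        (\<Sum>(l, r) \<in> {(l, r). l @ r = p \<and> l \<noteq> [] \<and> r \<noteq> []}.
          val (mu2 (vcat N') (farr (tw D) r) (farr (tw D) l))) =
        insert_mu (vcat N) (fmap (tw D)) p"
    if "path (vcat N) X p" for X and p :: "('a cob, 'a matr) arr list"
  proof -
    have ins: "insert_mu (vcat N) (fmap (tw D)) p =
        (case p of [a, b] \<Rightarrow> fmap (tw D) [mu2 (vcat N) b a] | _ \<Rightarrow> 0)"
      by (rule insert_mu_strict) (simp_all add: fmap_tw_long)
    show ?thesis
    proof (cases "length p = 2")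
      case True
      then obtain a b where p: "p = [a, b]"
        by (cases p; cases "tl p") auto
      have "{(l, r). l @ r = p \<and> l \<noteq> [] \<and> r \<noteq> []} = {([a], [b])}"
        by (auto simp: p append_eq_Cons_conv)
      moreover have a: "val a \<in> mats N (src a) (tgt a)" and "src b = tgt a"
        using that unfolding p by (auto simp: arrow_vcat)
      ultimately show ?thesis
        by (simp add: ins[unfolded p] p mu2_def farr_tw tmat_ksign tmat_mprod[OF D a])
    next
      case False
      have "val (mu2 (vcat N') (farr (tw D) r) (farr (tw D) l)) = 0" if "l @ r = p" for l r
      proof -
        have "length l \<noteq> 1 \<or> length r \<noteq> 1" using that False by auto
        then show ?thesis by (auto simp: mu2_def farr_tw_long)
      qed
      then have "(\<Sum>(l, r) \<in> {(l, r). l @ r = p \<and> l \<noteq> [] \<and> r \<noteq> []}.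
          val (mu2 (vcat N') (farr (tw D) r) (farr (tw D) l))) = 0"
        by (auto intro!: sum.neutral)
      then show ?thesis using False by (auto simp: ins split: list.splits)
    qed
  qed
  moreover have "heq (vcat N') (farr (tw D) [ident (vcat N) X]) (ident (vcat N') (fob (tw D) X))" for X
    by (simp add: heq_vcat farr_tw ident_def tmat_unitm[OF assms])
  ultimately show ?thesis by (auto simp: enh_functor_def)
qed

section \<open>Strict natural transformations given by matrices\<close>

type_synonym 'k tmx = "nat \<Rightarrow> nat \<Rightarrow> nat \<Rightarrow> 'k"

text \<open>
  An \<open>r' \<times> r\<close> matrix \<open>M a\<close> for every label \<open>a\<close> encodes a natural transformation from \<open>(r, l)\<close> to
  \<open>(r', l')\<close>, which is strict: its components on nonempty paths vanish.
\<close>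

definition tcomp :: "twd \<Rightarrow> twd \<Rightarrow> 'k tmx \<Rightarrow> 'k cob \<Rightarrow> 'k::field matr" where
  "tcomp D D' M X = (\<lambda>j i. if j div fst D' = i div fst D
     then M (lab X (i div fst D)) (j mod fst D') (i mod fst D) else 0)"

definition ct :: "twd \<Rightarrow> twd \<Rightarrow> 'k tmx \<Rightarrow> ('k cob, 'k::field matr, 'k cob, 'k matr) tarr" where
  "ct D D' M = Arr (tw D) (tw D') 0 (\<lambda>X p. if p = [] then tcomp D D' M X else 0)"

definition okm :: "nat \<Rightarrow> twd \<Rightarrow> twd \<Rightarrow> 'k::field tmx \<Rightarrow> bool" where
  "okm N' D D' M \<longleftrightarrow> (\<forall>l c c'. c < fst D \<longrightarrow> c' < fst D' \<longrightarrow> M l c' c \<noteq> 0 \<longrightarrow>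
     live N' (snd D l c) \<and> snd D' l c' = snd D l c)"

definition idm :: "nat \<Rightarrow> twd \<Rightarrow> 'k::field tmx" where
  "idm N' D l c' c = (if c' = c \<and> live N' (snd D l c) then 1 else 0)"

definition mulm :: "twd \<Rightarrow> 'k tmx \<Rightarrow> 'k tmx \<Rightarrow> 'k::field tmx" where
  "mulm D' M' M l c'' c = (\<Sum>c'<fst D'. M' l c'' c' * M l c' c)"

text \<open>Whiskering with an outer functor is again a Kronecker product with an identity, whereas
  whiskering with an inner functor, \<open>wrm\<close> below, reads \<open>M\<close> at the labels
  which that functor produces.\<close>

definition wlm :: "twd \<Rightarrow> twd \<Rightarrow> 'k tmx \<Rightarrow> 'k::field tmx" where
  "wlm E D M l c' c = (if c' mod fst E = c mod fst E \<and>
     snd E (snd D l (c div fst E)) (c mod fst E) \<noteq> 0 then M l (c' div fst E) (c div fst E) else 0)"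

definition wrm :: "twd \<Rightarrow> twd \<Rightarrow> 'k tmx \<Rightarrow> twd \<Rightarrow> 'k::field tmx" where
  "wrm D D' M E l c' c = (if c' div fst D' = c div fst D
     then M (snd E l (c div fst D)) (c' mod fst D') (c mod fst D) else 0)"

lemma ct_sel [simp]: "src (ct D D' M) = tw D" "tgt (ct D D' M) = tw D'" "deg (ct D D' M) = 0"
  "val (ct D D' M) X [] = tcomp D D' M X" "p \<noteq> [] \<Longrightarrow> val (ct D D' M) X p = 0"
  by (simp_all add: ct_def)

lemma ct_eqI:
  assumes "okd D" "okd D'" "\<And>l c' c. c < fst D \<Longrightarrow> c' < fst D' \<Longrightarrow> M l c' c = M' l c' c"
  shows "ct D D' M = ct D D' M'"
  using assms by (auto simp: ct_def tcomp_def fun_eq_iff okd_pos)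

lemma okmD:
  "okm N' D D' M \<Longrightarrow> M l c' c \<noteq> 0 \<Longrightarrow> c < fst D \<Longrightarrow> c' < fst D' \<Longrightarrow>
     live N' (snd D l c) \<and> snd D' l c' = snd D l c"
  by (auto simp: okm_def)

lemma tcomp_mats:
  assumes "okd D" "okd D'" "okm N' D D' M"
  shows "tcomp D D' M X \<in> mats N' (tob D X) (tob D' X)"
  using okmD[OF assms(3)] okd_pos[OF assms(1)] okd_pos[OF assms(2)]
  by (auto simp: mats_def tcomp_def lab_tob assms(1,2) split: if_splits)

lemma val_mu2_zero:
  "val b = 0 \<Longrightarrow> val (mu2 (vcat N) b a) = 0" "val a = 0 \<Longrightarrow> val (mu2 (vcat N) b a) = 0"
  by (simp_all add: mu2_def)

lemma tarr_ct [simp]: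
  "tarr (ct D D' M) X [] = Arr (tob D X) (tob D' X) 0 (tcomp D D' M X)"
  "p \<noteq> [] \<Longrightarrow> val (tarr (ct D D' M) X p) = 0"
  by (auto simp: tarr_def path_end_def red_def)

lemma Fun_sel [simp]:
  "Obj (Fun A B) = {F. enh_functor A B F}" "Hom (Fun A B) = trans_hom A B"
  "dgdiff (Fun A B) \<alpha> = ksign (deg \<alpha>) (trans_mu1 A B \<alpha>)"
  "dgcomp (Fun A B) \<beta> \<alpha> = ksign (deg \<alpha>) (trans_mu2 A B \<beta> \<alpha>)"
  by (simp_all add: Fun_def)

lemma ct_arrow:
  assumes "okf N N' D" "okf N N' D'" "okm N' D D' M"
  shows "arrow_in (VF N N') (ct D D' M) (tw D) (tw D') 0"
proof -
  have D: "okd D" "okd D'" using assms by (auto simp: okf_def)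
  have "arrow (vcat N') (tarr (ct D D' M) X p)" for X p
    by (cases "p = []") (simp_all add: arrow_vcat tcomp_mats[OF D assms(3)])
  moreover have "ct D D' M = Arr (tw D) (tw D') 0 (val (ct D D' M))"
    by (metis arr.collapse ct_sel(1,2,3))
  moreover have "multilinear (vcat N) (smul (vcat N')) X (val (ct D D' M) X)" for X
    unfolding multilinear_def by (simp add: fun_eq_iff)
  moreover have "val (ct D D' M) X p = 0" if "\<not> path (vcat N) X p" for X p
    using that by (cases p) simp_all
  ultimately show ?thesis
    using assms by (simp add: arrow_in_def arrow_def trans_hom_def enh_functor_tw)
qed

lemma lin_less: "q < n \<Longrightarrow> c < r \<Longrightarrow> q * r + c < n * r" for q n c r :: nat
  using mult_le_mono1[of "Suc q" n r] by simp

text \<open>Each side has at most one nonzero summand, an entry of \<open>f\<close> times an entry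
  of \<open>M\<close>. The two entries of \<open>M\<close> are taken at the labels of a row and of a
  column of \<open>f\<close>, which agree wherever \<open>f\<close> is nonzero.\<close>

lemma tcomp_natural:
  assumes D: "okd D" "okd D'" and M: "okm N' D D' M" and f: "f \<in> mats N X Y"
  shows "mprod (sz (tob D Y)) (tcomp D D' M Y) (tmat D X f) =
    mprod (sz (tob D' X)) (tmat D' X f) (tcomp D D' M X)"
proof (intro ext)
  fix j i
  let ?r = "fst D" and ?r' = "fst D'"
  note p = okd_pos[OF D(1)] okd_pos[OF D(2)]
  let ?v = "if f (j div ?r') (i div ?r) = 0 then 0
    else f (j div ?r') (i div ?r) * M (lab X (i div ?r)) (j mod ?r') (i mod ?r)"
  have idx: "k = (j div ?r') * ?r + i mod ?r" if "j div ?r' = k div ?r" "k mod ?r = i mod ?r" for k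
    using that by (metis div_mult_mod_eq)
  have "mprod (sz (tob D Y)) (tcomp D D' M Y) (tmat D X f) j i =
     tcomp D D' M Y j ((j div ?r') * ?r + i mod ?r) * tmat D X f ((j div ?r') * ?r + i mod ?r) i"
    unfolding mprod_def
  proof (rule sum_single)
    fix k assume "k \<noteq> j div fst D' * fst D + i mod fst D"
    then show "tcomp D D' M Y j k * tmat D X f k i = 0"
      using idx[of k] by (auto simp: tcomp_def tmat_def)
  next
    assume *: "\<not> j div ?r' * ?r + i mod ?r < sz (tob D Y)"
    have "f (j div ?r') (i div ?r) = 0"
    proof (rule ccontr)
      assume "f (j div ?r') (i div ?r) \<noteq> 0"
      then have "j div ?r' < sz Y" using mats_less[OF f] by blast
      then have "j div ?r' * ?r + i mod ?r < sz Y * ?r"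
        using p by (intro lin_less) auto
      with * show False by simp
    qed
    then show "tcomp D D' M Y j (j div ?r' * ?r + i mod ?r) *
        tmat D X f (j div ?r' * ?r + i mod ?r) i = 0"
      using p by (simp add: tmat_def)
  qed
  also have "\<dots> = ?v"
    using p matsD[OF f, of "j div ?r'" "i div ?r"]
      okmD[OF M, of "lab X (i div ?r)" "j mod ?r'" "i mod ?r"]
    by (cases "f (j div ?r') (i div ?r) = 0";
        cases "M (lab X (i div ?r)) (j mod ?r') (i mod ?r) = 0") (auto simp: tcomp_def tmat_def)
  also have "\<dots> = tmat D' X f j ((i div ?r) * ?r' + j mod ?r') *
      tcomp D D' M X ((i div ?r) * ?r' + j mod ?r') i"
    using p matsD[OF f, of "j div ?r'" "i div ?r"]
      okmD[OF M, of "lab X (i div ?r)" "j mod ?r'" "i mod ?r"]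
    by (cases "f (j div ?r') (i div ?r) = 0";
        cases "M (lab X (i div ?r)) (j mod ?r') (i mod ?r) = 0") (auto simp: tcomp_def tmat_def)
  also have "\<dots> = mprod (sz (tob D' X)) (tmat D' X f) (tcomp D D' M X) j i"
    unfolding mprod_def
  proof (rule sum_single[symmetric])
    fix k assume "k \<noteq> i div ?r * ?r' + j mod ?r'"
    then have "\<not> (k div ?r' = i div ?r \<and> k mod ?r' = j mod ?r')"
      by (metis div_mult_mod_eq)
    then show "tmat D' X f j k * tcomp D D' M X k i = 0"
      by (auto simp: tcomp_def tmat_def)
  next
    assume *: "\<not> i div ?r * ?r' + j mod ?r' < sz (tob D' X)"
    have "f (j div ?r') (i div ?r) = 0"
    proof (rule ccontr)
      assume "f (j div ?r') (i div ?r) \<noteq> 0"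
      then have "i div ?r < sz X" using mats_less[OF f] by blast
      then have "i div ?r * ?r' + j mod ?r' < sz X * ?r'"
        using p by (intro lin_less) auto
      with * show False by simp
    qed
    then show "tmat D' X f j (i div ?r * ?r' + j mod ?r') *
        tcomp D D' M X (i div ?r * ?r' + j mod ?r') i = 0"
      using p by (simp add: tmat_def)
  qed
  finally show "mprod (sz (tob D Y)) (tcomp D D' M Y) (tmat D X f) j i =
    mprod (sz (tob D' X)) (tmat D' X f) (tcomp D D' M X) j i" .
qed

lemma insert_mu_zero:
  assumes "\<And>q. q \<noteq> [] \<Longrightarrow> \<phi> q = 0"
  shows "insert_mu C \<phi> p = 0"
proof -
  have "\<phi> (l @ a # r) = 0" for l a r using assms by simp
  then show ?thesis unfolding insert_mu_def by (simp add: case_prod_unfold)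
qed

lemma ksign_ksign: "ksign m (ksign n x) = ksign (m + n) x"
  by (auto simp: ksign_def)

lemma path_end_simps [simp]: "path_end X [] = X" "path_end X [a] = tgt a"
  by (simp_all add: path_end_def)

text \<open>Closedness of a strict transformation has content only on paths with exactly one arrow,
  where it is naturality.\<close>

lemma trans_mu1_ct:
  assumes D: "okd D" "okd D'" and M: "okm N' D D' M"
  shows "trans_mu1 (vcat N) (vcat N') (ct D D' M) = 0"
proof (rule ext, rule ext)
  fix X :: "'a cob" and p :: "('a cob, 'a matr) arr list"
  let ?\<alpha> = "ct D D' M" and ?B = "vcat N' :: 'a small_dgcat"
  have ins: "insert_mu (vcat N) (val ?\<alpha> X) p = 0"
    by (rule insert_mu_zero) simp
  have "trans_mu1 (vcat N) ?B ?\<alpha> X p = 0" if path: "path (vcat N :: 'a small_dgcat) X p"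
  proof (cases "length p = 1")
    case True
    then obtain a where p: "p = [a]" by (cases p) auto
    have "{(l, r). l @ r = p \<and> l \<noteq> []} = {([a], [])}" "{(l, r). l @ r = p \<and> r \<noteq> []} = {([], [a])}"
      by (auto simp: p append_eq_Cons_conv)
    moreover have a: "val a \<in> mats N X (tgt a)" "src a = X"
      using path unfolding p by (auto simp: arrow_vcat)
    ultimately show ?thesis
      using path ins tcomp_natural[OF D M a(1)]
      by (simp add: trans_mu1_def mu2_def farr_tw ksign_ksign red_def p) (simp add: ksign_def)
  next
    case False
    have "val (mu2 ?B (tarr ?\<alpha> (path_end X l) r) (farr (src ?\<alpha>) l)) = 0"
      if "l @ r = p" "l \<noteq> []" for l r
      using that False by (cases "r = []") (simp_all add: mu2_def farr_tw_long)
    moreover have "val (mu2 ?B (farr (tgt ?\<alpha>) r) (tarr ?\<alpha> X l)) = 0"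
      if "l @ r = p" "r \<noteq> []" for l r
      using that False by (cases "l = []") (simp_all add: mu2_def farr_tw_long)
    ultimately have
      "(\<Sum>(l, r) \<in> {(l, r). l @ r = p \<and> l \<noteq> []}. ksign ((deg ?\<alpha> - 1) * red l)
         (val (mu2 ?B (tarr ?\<alpha> (path_end X l) r) (farr (src ?\<alpha>) l)))) = 0"
      "(\<Sum>(l, r) \<in> {(l, r). l @ r = p \<and> r \<noteq> []}.
         val (mu2 ?B (farr (tgt ?\<alpha>) r) (tarr ?\<alpha> X l))) = 0"
      by (auto intro!: sum.neutral)
    then show ?thesis by (simp add: trans_mu1_def ins)
  qed
  then show "trans_mu1 (vcat N) ?B ?\<alpha> X p = 0 X p"
    by (cases "path (vcat N :: 'a small_dgcat) X p") (simp_all add: trans_mu1_def)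
qed

lemma closed_ct:
  assumes "okf N N' D" "okf N N' D'" "okm N' D D' M"
  shows "closed_arrow (VF N N') (ct D D' M) (tw D) (tw D') 0"
  using ct_arrow[OF assms] trans_mu1_ct[OF _ _ assms(3)] assms(1,2)
  by (simp add: closed_arrow_def okf_def)

lemma tcomp_mulm:
  assumes D: "okd D" "okd D'" and M: "okm N' D D' M" and D'': "okd D''"
  shows "mprod (sz (tob D' X)) (tcomp D' D'' M' X) (tcomp D D' M X) = tcomp D D'' (mulm D' M' M) X"
proof (intro ext)
  fix j i
  let ?r = "fst D" and ?r' = "fst D'" and ?r'' = "fst D''"
  note p = okd_pos[OF D(1)] okd_pos[OF D(2)] okd_pos[OF D'']
  have 0: "M 0 c' (i mod ?r) = 0" if "c' < ?r'" for c'
    using okmD[OF M, of 0 c' "i mod ?r"] that p okd_0[OF D(1)] by auto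
  have "mprod (sz (tob D' X)) (tcomp D' D'' M' X) (tcomp D D' M X) j i =
    (\<Sum>k<sz X. \<Sum>c<?r'. tcomp D' D'' M' X j (k * ?r' + c) * tcomp D D' M X (k * ?r' + c) i)"
    by (simp add: mprod_def sum_nat_group)
  also have "\<dots> = (\<Sum>c<?r'. tcomp D' D'' M' X j (i div ?r * ?r' + c) *
      tcomp D D' M X (i div ?r * ?r' + c) i)"
    by (rule sum_single) (auto simp: tcomp_def lab_def 0 intro!: sum.neutral)
  also have "\<dots> = tcomp D D'' (mulm D' M' M) X j i"
    by (auto simp: tcomp_def mulm_def intro!: sum.cong)
  finally show "mprod (sz (tob D' X)) (tcomp D' D'' M' X) (tcomp D D' M X) j i =
    tcomp D D'' (mulm D' M' M) X j i" .
qed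

lemma cmp_ct:
  assumes D: "okd D" "okd D'" and M: "okm N' D D' M" and D'': "okd D''"
  shows "cmp (VF N N') (ct D' D'' M') (ct D D' M) = ct D D'' (mulm D' M' M)"
proof -
  let ?A = "vcat N :: 'a small_dgcat" and ?B = "vcat N' :: 'a small_dgcat"
  have "trans_mu2 ?A ?B (ct D' D'' M') (ct D D' M) X p = val (ct D D'' (mulm D' M' M)) X p" for X p
  proof (cases "p = []")
    case True
    have "{(l, r). l @ r = []} = {([] :: ('a cob, 'a matr) arr list, [])}" by auto
    then show ?thesis
      using tcomp_mulm[OF assms, of X M'] True
      by (simp add: trans_mu2_def mu2_def red_def ksign_def)
  next
    case False
    then have "val (mu2 ?B (tarr (ct D' D'' M') (path_end X l) r) (tarr (ct D D' M) X l)) = 0"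
      if "l @ r = p" for l r
      using that by (cases "l = []") (auto simp: val_mu2_zero)
    then show ?thesis
      using False by (auto simp: trans_mu2_def intro!: sum.neutral)
  qed
  then have "trans_mu2 ?A ?B (ct D' D'' M') (ct D D' M) = val (ct D D'' (mulm D' M' M))"
    by blast
  then show ?thesis
    by (simp add: cmp_def ksign_def) (simp add: ct_def)
qed

lemma ident_ct: "okd D \<Longrightarrow> ident (VF N N') (tw D) = ct D D (idm N' D)"
  by (auto simp: ident_def Fun_def ct_def fun_eq_iff unitm_def tcomp_def idm_def lab_tob)
    (metis div_mult_mod_eq)+

lemma asub_ct: "asub (ct D D' M) (ct D D' M') = ct D D' (\<lambda>l c' c. M l c' c - M' l c' c)"
  by (auto simp: asub_def ct_def fun_eq_iff tcomp_def)

lemma tmat_tcomp: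
  assumes D: "okd D" "okd D'" and M: "okm N' D D' M" and E: "okd E"
  shows "tmat E (tob D X) (tcomp D D' M X) = tcomp (E \<odot> D) (E \<odot> D') (wlm E D M) X"
proof (intro ext)
  fix j i
  note p = okd_pos[OF D(1)] okd_pos[OF D(2)] okd_pos[OF E]
  show "tmat E (tob D X) (tcomp D D' M X) j i = tcomp (E \<odot> D) (E \<odot> D') (wlm E D M) X j i"
    using p okmD[OF M, of "lab X (i div fst E div fst D)" "j div fst E mod fst D'" "i div fst E mod fst D"]
    by (cases "M (lab X (i div fst E div fst D)) (j div fst E mod fst D') (i div fst E mod fst D) = 0")
      (auto simp: tmat_def tcomp_def wlm_def compd_def lab_tob[OF D(1)] idx_simps)
qed

lemma wl_ct:
  assumes D: "okd D" "okd D'" and M: "okm N' D D' M" and E: "okd E"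
  shows "wl (vcat N) (tw E) (ct D D' M) = ct (E \<odot> D) (E \<odot> D') (wlm E D M)"
proof -
  let ?A = "vcat N :: 'a small_dgcat"
  have "val (wl ?A (tw E) (ct D D' M)) X p = val (ct (E \<odot> D) (E \<odot> D') (wlm E D M)) X p" for X p
  proof (cases "p = []")
    case True
    then show ?thesis
      using tmat_tcomp[OF assms, of X] wl_index_Nil[where 'a = "('a cob, 'a matr) arr"]
      by (simp add: wl_def red_def ksign_def)
  next
    case False
    have "fmap (tw E) (map (farr (tw D)) bs @ tarr (ct D D' M) (path_end X (concat bs)) m #
        map (farr (tw D')) cs) = 0" if "concat bs @ m @ concat cs = p" for bs m cs
    proof (cases "bs = [] \<and> cs = []")
      case True
      with that False show ?thesis by simp
    qed (auto intro!: fmap_tw_long)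
    with False show ?thesis
      by (auto simp: wl_def intro!: sum.neutral)
  qed
  then have "val (wl ?A (tw E) (ct D D' M)) = val (ct (E \<odot> D) (E \<odot> D') (wlm E D M))"
    by blast
  then show ?thesis
    by (intro arr.expand) (simp add: wl_def fcomp_tw D E)
qed

lemma tcomp_tob:
  assumes D: "okd D" "okd D'" and E: "okd E"
  shows "tcomp D D' M (tob E X) = tcomp (D \<odot> E) (D' \<odot> E) (wrm D D' M E) X"
proof (intro ext)
  fix j i
  note p = okd_pos[OF D(1)] okd_pos[OF D(2)] okd_pos[OF E]
  have "j div fst D' = i div fst D \<longleftrightarrow> j div fst D' div fst E = i div fst D div fst E \<and>
      j div fst D' mod fst E = i div fst D mod fst E"
    by (metis div_mult_mod_eq)
  then show "tcomp D D' M (tob E X) j i = tcomp (D \<odot> E) (D' \<odot> E) (wrm D D' M E) X j i"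
    using p by (auto simp: tcomp_def wrm_def compd_def lab_tob[OF E] idx_simps)
qed

lemma wr_ct:
  assumes D: "okd D" "okd D'" and E: "okd E"
  shows "wr (vcat N) (ct D D' M) (tw E) = ct (D \<odot> E) (D' \<odot> E) (wrm D D' M E)"
proof -
  let ?A = "vcat N :: 'a small_dgcat"
  have "val (wr ?A (ct D D' M) (tw E)) X p = val (ct (D \<odot> E) (D' \<odot> E) (wrm D D' M E)) X p" for X p
  proof (cases "p = []")
    case True
    then show ?thesis
      using True tcomp_tob[OF assms, of M X] by (simp add: wr_def blocks_Nil)
  next
    case False
    then have "bs \<noteq> []" if "bs \<in> blocks p" for bs
      using that by (auto simp: blocks_def)
    with False show ?thesis
      by (auto simp: wr_def intro!: sum.neutral)
  qed
  then have "val (wr ?A (ct D D' M) (tw E)) = val (ct (D \<odot> E) (D' \<odot> E) (wrm D D' M E))"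
    by blast
  then show ?thesis
    by (intro arr.expand) (simp add: wr_def fcomp_tw D E)
qed

lemma okm_idm [simp]: "okm N' D D (idm N' D)"
  by (auto simp: okm_def idm_def)

lemma okm_mulm: "okm N' D D' M \<Longrightarrow> okm N' D' D'' M' \<Longrightarrow> okm N' D D'' (mulm D' M' M)"
  unfolding okm_def mulm_def by (auto elim!: sum.not_neutral_contains_not_neutral)

lemma okm_diff: "okm N' D D' M \<Longrightarrow> okm N' D D' M' \<Longrightarrow> okm N' D D' (\<lambda>l c' c. M l c' c - M' l c' c)"
  unfolding okm_def by (metis diff_0_right diff_self)

lemma okm_wlm:
  assumes M: "okm N' D D' M" and D: "okd D" "okd D'" and E: "okf N' N'' E"
  shows "okm N'' (E \<odot> D) (E \<odot> D') (wlm E D M)"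
proof -
  have "okd E" using E by (simp add: okf_def)
  note p = okd_pos[OF D(1)] okd_pos[OF D(2)] okd_pos[OF this]
  show ?thesis
    unfolding okm_def
  proof (intro allI impI)
    fix l c c'
    assume *: "c < fst (E \<odot> D)" "c' < fst (E \<odot> D')" "wlm E D M l c' c \<noteq> 0"
    then have "c div fst E < fst D" "c' div fst E < fst D'"
      by (auto simp: compd_def less_mult_imp_div_less)
    with * M E p show "live N'' (snd (E \<odot> D) l c) \<and> snd (E \<odot> D') l c' = snd (E \<odot> D) l c"
      by (auto simp: compd_def wlm_def okm_def okf_def split: if_splits)
  qed
qed

lemma okm_wrm:
  assumes M: "okm N'' D D' M" and D: "okd D" "okd D'"
  shows "okm N'' (D \<odot> E) (D' \<odot> E) (wrm D D' M E)"
  unfolding okm_def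
proof (intro allI impI)
  fix l c c'
  assume "c < fst (D \<odot> E)" "c' < fst (D' \<odot> E)" "wrm D D' M E l c' c \<noteq> 0"
  then show "live N'' (snd (D \<odot> E) l c) \<and> snd (D' \<odot> E) l c' = snd (D \<odot> E) l c"
    using okmD[OF M, of "snd E l (c div fst D)" "c' mod fst D'" "c mod fst D"]
      okd_pos[OF D(1)] okd_pos[OF D(2)]
    by (auto simp: wrm_def compd_def split: if_splits)
qed

lemma zero_arrow:
  "enh_functor (vcat N) (vcat N') F \<Longrightarrow> enh_functor (vcat N) (vcat N') G \<Longrightarrow>
    arrow_in (VF N N') (Arr F G n 0) F G n"
  by (auto simp: arrow_in_def arrow_def trans_hom_def multilinear_def tarr_def fun_eq_iff)

lemma tarr_zero [simp]: "val (tarr (Arr F G n 0) X p) = 0"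
  by (simp add: tarr_def)

lemma trans_mu2_zero:
  "trans_mu2 (vcat N) (vcat N') (Arr F G n 0) \<alpha> = 0"
  "trans_mu2 (vcat N) (vcat N') \<alpha> (Arr F G n 0) = 0"
  by (auto simp: trans_mu2_def val_mu2_zero fun_eq_iff)

lemma trans_mu1_zero: "trans_mu1 (vcat N) (vcat N') (Arr F G n 0) = 0"
proof (rule ext, rule ext)
  fix X :: "'a cob" and p :: "('a cob, 'a matr) arr list"
  have "insert_mu (vcat N) 0 p = (0 :: 'a matr)"
    by (rule insert_mu_zero) simp
  then show "trans_mu1 (vcat N) (vcat N') (Arr F G n 0) X p = 0 X p"
    by (simp add: trans_mu1_def val_mu2_zero)
qed

lemma heq_Fun_refl:
  assumes "enh_functor (vcat N) (vcat N') (src a)" "enh_functor (vcat N) (vcat N') (tgt a)"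
    "val a = val b"
  shows "heq (VF N N') a b"
  unfolding heq_def
  using zero_arrow[OF assms(1,2), of "deg a - 1"] assms(3)
  by (intro exI[of _ "Arr (src a) (tgt a) (deg a - 1) 0"]) (simp add: trans_mu1_zero)

lemma heq_ct:
  assumes "okf N N' D" "okf N N' D'"
    "\<And>l c' c. c < fst D \<Longrightarrow> c' < fst D' \<Longrightarrow> M l c' c = M' l c' c"
  shows "heq (VF N N') (ct D D' M) (ct D D' M')"
proof -
  have "ct D D' M = ct D D' M'"
    using assms by (intro ct_eqI) (auto simp: okf_def)
  then show ?thesis
    by (intro heq_Fun_refl) (simp_all add: enh_functor_tw assms)
qed

lemma hinverse_ct:
  assumes D: "okf N N' D" "okf N N' D'" and M: "okm N' D D' M" "okm N' D' D M'"
    and "\<And>l c' c. c < fst D \<Longrightarrow> c' < fst D \<Longrightarrow> mulm D' M' M l c' c = idm N' D l c' c"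
    and "\<And>l c' c. c < fst D' \<Longrightarrow> c' < fst D' \<Longrightarrow> mulm D M M' l c' c = idm N' D' l c' c"
  shows "hinverse (VF N N') (ct D D' M) (ct D' D M')"
proof -
  have d: "okd D" "okd D'" using D by (auto simp: okf_def)
  show ?thesis
    unfolding hinverse_def
    using closed_ct[OF D M(1)] closed_ct[OF D(2,1) M(2)]
    by (simp add: cmp_ct[OF d M(1)] cmp_ct[OF d(2,1) M(2)] ident_ct d heq_ct assms)
qed

text \<open>A split short exact sequence is an exact triangle with zero connecting map.
  \<open>q\<close> is a section of \<open>g\<close>, and \<open>- b\<close> is a retraction of
  \<open>f\<close>; the sign is that of the homotopy in \<open>exact_triangle\<close>.\<close>

lemma exact_triangle_ct:
  assumes D: "okf N N' D1" "okf N N' D2" "okf N N' D3"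
    and M: "okm N' D1 D2 f" "okm N' D2 D3 g" "okm N' D3 D2 q" "okm N' D2 D1 b"
    and gf: "\<And>l c' c. c < fst D1 \<Longrightarrow> c' < fst D3 \<Longrightarrow> mulm D2 g f l c' c = 0"
    and gq: "\<And>l c' c. c < fst D3 \<Longrightarrow> c' < fst D3 \<Longrightarrow> mulm D2 g q l c' c = idm N' D3 l c' c"
    and bf: "\<And>l c' c. c < fst D1 \<Longrightarrow> c' < fst D1 \<Longrightarrow> mulm D2 b f l c' c = - idm N' D1 l c' c"
    and qg: "\<And>l c' c. c < fst D2 \<Longrightarrow> c' < fst D2 \<Longrightarrow>
      mulm D3 q g l c' c - idm N' D2 l c' c = mulm D1 f b l c' c"
  shows "exact_triangle (VF N N') (ct D1 D2 f) (ct D2 D3 g) (Arr (tw D3) (tw D1) 1 0)"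
proof -
  let ?F = "VF N N' :: ('a, _, ('a cob, 'a matr, 'a matr) trans) dgcat"
  have d: "okd D1" "okd D2" "okd D3" using D by (auto simp: okf_def)
  note e = enh_functor_tw[OF D(1)] enh_functor_tw[OF D(2)] enh_functor_tw[OF D(3)]
  have comp: "dgcomp ?F (ct D' D'' M') (ct D D' M) = val (ct D D'' (mulm D' M' M))"
    if "okd D" "okd D'" "okm N' D D' M" "okd D''" for D D' D'' M M'
    using cmp_ct[OF that, of N M'] by (metis arr.sel(4) cmp_def)
  have unit: "dgunit ?F (tw D) = val (ct D D (idm N' D))" if "okd D" for D
    using ident_ct[OF that, of N N'] by (metis arr.sel(4) ident_def)
  have val: "val (ct D D' M) - val (ct D D' M') = val (ct D D' (\<lambda>l c' c. M l c' c - M' l c' c))"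
     "- val (ct D D' M) = val (ct D D' (\<lambda>l c' c. - M l c' c))" "val (ct D D' (\<lambda>l c' c. 0)) = 0"
     for D D' and M M' :: "'a tmx"
    by (auto simp: ct_def fun_eq_iff tcomp_def)
  have "val (ct D1 D3 (mulm D2 g f)) = val (ct D1 D3 (\<lambda>l c' c. 0))"
    by (rule arg_cong[of _ _ val], rule ct_eqI) (simp_all add: d gf)
  then have 1: "val (ct D1 D3 (mulm D2 g f)) = 0"
    by (simp only: val)
  have 2: "val (ct D3 D3 (mulm D2 g q)) = val (ct D3 D3 (idm N' D3))"
    by (rule arg_cong[of _ _ val], rule ct_eqI) (simp_all add: d gq)
  have 3: "val (ct D1 D1 (mulm D2 b f)) = - val (ct D1 D1 (idm N' D1))"
    unfolding val by (rule arg_cong[of _ _ val], rule ct_eqI) (simp_all add: d bf)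
  have 4: "val (ct D2 D2 (mulm D3 q g)) - val (ct D2 D2 (idm N' D2)) = val (ct D2 D2 (mulm D1 f b))"
    unfolding val by (rule arg_cong[of _ _ val], rule ct_eqI) (simp_all add: d qg)
  show ?thesis
    unfolding exact_triangle_def
    apply (rule exI[of _ "tw D1"], rule exI[of _ "tw D2"], rule exI[of _ "tw D3"])
    apply (rule exI[of _ "Arr (tw D1) (tw D3) (-1) 0"], rule exI[of _ "ct D3 D2 q"])
    apply (rule exI[of _ "Arr (tw D3) (tw D3) (-1) 0"], rule exI[of _ "Arr (tw D1) (tw D1) (-1) 0"])
    apply (rule exI[of _ "ct D2 D1 b"])
    apply (rule exI[of _ "Arr (tw D1) (tw D2) (-2) 0"], rule exI[of _ "Arr (tw D2) (tw D2) (-1) 0"])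
    using closed_ct[OF D(1,2) M(1)] closed_ct[OF D(2,3) M(2)] ct_arrow[OF D(3,2) M(3)]
      ct_arrow[OF D(2,1) M(4)] closed_ct[OF D(3,2) M(3)] closed_ct[OF D(2,1) M(4)]
      comp[OF d(1,2) M(1) d(3)] comp[OF d(3,2) M(3) d(3)] comp[OF d(1,2) M(1) d(1)]
      comp[OF d(2,3) M(2) d(2)] comp[OF d(2,1) M(4) d(2)] 1 2 3 4
    by (simp add: closed_arrow_def zero_arrow e trans_mu1_zero trans_mu2_zero unit d)

qed

section \<open>The diagonal functor is a \<open>P\<^sup>2\<close>-functor\<close>

declare One_nat_def [simp del]

text \<open>
  With \<open>\<Delta>(X) = (X, X, X, 0)\<close> and \<open>\<Sigma>(X\<^sub>1, \<dots>, X\<^sub>4) = X\<^sub>1 \<oplus> X\<^sub>2 \<oplus> X\<^sub>3\<close>, the following encode \<open>n\<close>-fold direct sums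
  of \<open>id\<close>, \<open>\<Delta>\<close>, \<open>\<Sigma>\<close> and \<open>\<Delta>\<Sigma>\<close>.
\<close>

definition tD :: "nat \<Rightarrow> twd" where "tD n = (n, \<lambda>l c. if l = 1 then 1 else 0)"
definition fD :: "nat \<Rightarrow> twd" where "fD n = (n * 3, \<lambda>l c. if l = 1 then c mod 3 + 1 else 0)"
definition sD :: "nat \<Rightarrow> twd" where "sD n = (n, \<lambda>l c. if live 3 l then 1 else 0)"
definition pD :: "nat \<Rightarrow> twd" where "pD n = (n * 3, \<lambda>l c. if live 3 l then c mod 3 + 1 else 0)"

lemma data_sel [simp]:
  "fst (tD n) = n" "fst (fD n) = n * 3" "fst (sD n) = n" "fst (pD n) = n * 3" "fst idd = 1"
  "snd (tD n) l c = (if l = 1 then 1 else 0)" "snd (fD n) l c = (if l = 1 then c mod 3 + 1 else 0)"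
  "snd (sD n) l c = (if live 3 l then 1 else 0)"
  "snd (pD n) l c = (if live 3 l then c mod 3 + 1 else 0)" "snd idd l c = l"
  by (simp_all add: tD_def fD_def sD_def pD_def idd_def)

lemma live3: "live 3 (c mod 3 + 1)"
  by (simp add: live_def Suc_le_eq)

text \<open>The four families are closed under the composites that occur, so each composite is known
  by a multiplicity. In particular \<open>\<Sigma>\<Delta>\<close> is \<open>tD 3\<close>.\<close>

lemma data_comp [simp]:
  "sD m \<odot> fD n = tD (n * 3 * m)" "fD n \<odot> sD m = pD (m * n)" "fD n \<odot> tD m = fD (m * n)"
  "tD n \<odot> sD m = sD (m * n)" "tD n \<odot> tD m = tD (m * n)" "pD n \<odot> fD m = fD (m * 3 * n)"
  "pD n \<odot> pD m = pD (m * 3 * n)" "sD n \<odot> pD m = sD (m * 3 * n)"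
  "idd \<odot> D = D" "tD n \<odot> idd = tD n" "fD n \<odot> idd = fD n" "sD n \<odot> idd = sD n" "pD n \<odot> idd = pD n"
  by (auto simp: prod_eq_iff compd_def fun_eq_iff live3[simplified] mod_mult_right_eq mod_mod_cancel)

lemma okf_data [simp]:
  "0 < n \<Longrightarrow> okf 1 1 (tD n)" "0 < n \<Longrightarrow> okf 1 4 (fD n)" "0 < n \<Longrightarrow> okf 4 1 (sD n)"
  "0 < n \<Longrightarrow> okf 4 4 (pD n)"
  by (auto simp: okf_def okd_def live_def)

lemma okf_okd: "okf N N' D \<Longrightarrow> okd D"
  by (simp add: okf_def)

lemma okd_data [simp]: "0 < n \<Longrightarrow> okd (tD n)" "0 < n \<Longrightarrow> okd (fD n)" "0 < n \<Longrightarrow> okd (sD n)"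
  "0 < n \<Longrightarrow> okd (pD n)"
  using okf_data okf_okd by metis+

lemma Idf_fcomp [simp]: "okd D \<Longrightarrow> Idf \<bullet> tw D = tw D" "Idf \<bullet> Idf = (Idf :: 'k::field small_functor)"
  and fcomp_Idf: "okd D \<Longrightarrow> tw D \<bullet> Idf = tw (D \<odot> idd)"
  by (simp_all add: fcomp_tw flip: tw_idd)

lemma fpow_Idf [simp]: "fpow Idf n = (Idf :: 'k::field small_functor)"
  by (induction n) simp_all

text \<open>A presentation of \<open>\<alpha>\<close> by a matrix, bundled with the side conditions.
  The rules below compute the matrices of composites and whiskerings symbolically, so that an
  identity of transformations ends as a finite check over labels and indices.\<close>

definition is_ct :: "nat \<Rightarrow> nat \<Rightarrow> ('k cob, 'k matr, 'k cob, 'k matr) tarr \<Rightarrow>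
    twd \<Rightarrow> twd \<Rightarrow> 'k::field tmx \<Rightarrow> bool" where
  "is_ct N N' \<alpha> D D' M \<longleftrightarrow> \<alpha> = ct D D' M \<and> okf N N' D \<and> okf N N' D' \<and> okm N' D D' M"

lemma is_ct_cmp:
  "is_ct N N' \<alpha> D D' M \<Longrightarrow> is_ct N N' \<beta> D' D'' M' \<Longrightarrow>
    is_ct N N' (cmp (VF N N') \<beta> \<alpha>) D D'' (mulm D' M' M)"
  by (auto simp: is_ct_def okm_mulm intro: cmp_ct okf_okd)

lemma is_ct_wl:
  "is_ct N N' \<alpha> D D' M \<Longrightarrow> okf N' N'' E \<Longrightarrow>
    is_ct N N'' (wl (vcat N) (tw E) \<alpha>) (E \<odot> D) (E \<odot> D') (wlm E D M)"
  by (auto simp: is_ct_def intro: wl_ct okm_wlm okf_okd okf_compd)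

lemma is_ct_wr:
  "is_ct N' N'' \<alpha> D D' M \<Longrightarrow> okf N N' E \<Longrightarrow>
    is_ct N N'' (wr (vcat N) \<alpha> (tw E)) (D \<odot> E) (D' \<odot> E) (wrm D D' M E)"
  by (auto simp: is_ct_def intro: wr_ct okm_wrm okf_okd okf_compd)

lemma is_ct_ident:
  "okf N N' D \<Longrightarrow> is_ct N N' (ident (VF N N') (tw D)) D D (idm N' D)"
  by (auto simp: is_ct_def ident_ct okf_okd)

lemma is_ct_asub:
  "is_ct N N' \<alpha> D D' M \<Longrightarrow> is_ct N N' \<beta> D D' M' \<Longrightarrow>
    is_ct N N' (asub \<alpha> \<beta>) D D' (\<lambda>l c' c. M l c' c - M' l c' c)"
  by (auto simp: is_ct_def asub_ct intro: okm_diff)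

lemma is_ct_dead:
  assumes "is_ct N N' \<alpha> D D' M" "\<not> live N l" "c < fst D" "c' < fst D'"
  shows "M l c' c = 0"
proof -
  have "\<not> live N' (snd D l c)" using assms by (auto simp: is_ct_def okf_def)
  then show ?thesis using assms unfolding is_ct_def okm_def by blast
qed

text \<open>Replaces a symbolic product by a closed formula, which keeps the next product small.
  Entries at dead labels vanish on their own, so only the live labels have to be inspected.\<close>

lemma is_ct_cong:
  assumes \<alpha>: "is_ct N N' \<alpha> D D' M"
    and 0: "\<And>l c' c. \<not> live N l \<Longrightarrow> M' l c' c = 0"
    and eq: "\<And>l c' c. live N l \<Longrightarrow> c < fst D \<Longrightarrow> c' < fst D' \<Longrightarrow> M l c' c = M' l c' c"
  shows "is_ct N N' \<alpha> D D' M'"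
proof -
  have "M l c' c = M' l c' c" if c: "c < fst D" "c' < fst D'" for l c' c
    using is_ct_dead[OF \<alpha>, of l c c'] 0[of l] eq[of l c c'] c by (cases "live N l") auto
  then show ?thesis
    using \<alpha> ct_eqI[of D D' M M'] by (auto simp: is_ct_def okm_def okf_okd)
qed

lemma is_ct_wl_Idf:
  assumes "is_ct N N' \<alpha> D D' M"
  shows "is_ct N N' (wl (vcat N) Idf \<alpha>) D D' M"
proof -
  have "is_ct N N' (wl (vcat N) Idf \<alpha>) D D' (wlm idd D M)"
    using is_ct_wl[OF assms, of N' idd] by (simp add: tw_idd)
  moreover have "wlm idd D M l c' c = M l c' c" if "c < fst D" "c' < fst D'" for l c' c
    using assms that okmD[of N' D D' M l c' c]
    by (cases "M l c' c = 0") (auto simp: is_ct_def wlm_def intro!: gr0I)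
  ultimately show ?thesis
    using assms ct_eqI[of D D' "wlm idd D M" M] by (auto simp: is_ct_def okf_okd)
qed

lemma is_ct_heq:
  assumes \<alpha>: "is_ct N N' \<alpha> D D' M" and \<beta>: "is_ct N N' \<beta> D D' M'"
    and eq: "\<And>l c' c. live N l \<Longrightarrow> c < fst D \<Longrightarrow> c' < fst D' \<Longrightarrow> M l c' c = M' l c' c"
  shows "heq (VF N N') \<alpha> \<beta>"
proof -
  have "M l c' c = M' l c' c" if c: "c < fst D" "c' < fst D'" for l c' c
    using is_ct_dead[OF \<alpha>, of l c c'] is_ct_dead[OF \<beta>, of l c c'] eq[of l c c'] c
    by (cases "live N l") auto
  then show ?thesis
    using \<alpha> \<beta> by (auto simp: is_ct_def intro: heq_ct)
qed

lemma is_ct_closed: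
  "is_ct N N' \<alpha> D D' M \<Longrightarrow> closed_arrow (VF N N') \<alpha> (tw D) (tw D') 0"
  by (auto simp: is_ct_def closed_ct)

lemma nat_sums:
  fixes f :: "nat \<Rightarrow> 'a::comm_monoid_add"
  shows "(\<Sum>k<1. f k) = f 0" "(\<Sum>k<2. f k) = f 0 + f 1" "(\<Sum>k<3. f k) = f 0 + f 1 + f 2"
    "(\<Sum>k<6. f k) = f 0 + f 1 + f 2 + f 3 + f 4 + f 5"
    "(\<Sum>k<9. f k) = f 0 + f 1 + f 2 + f 3 + f 4 + f 5 + f 6 + f 7 + f 8"
  by (simp_all add: eval_nat_numeral One_nat_def)

lemma less_cases:
  "c < 1 \<longleftrightarrow> c = 0" "c < 2 \<longleftrightarrow> c = 0 \<or> c = 1" "c < 3 \<longleftrightarrow> c = 0 \<or> c = 1 \<or> c = 2"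
  "c < 6 \<longleftrightarrow> c = 0 \<or> c = 1 \<or> c = 2 \<or> c = 3 \<or> c = 4 \<or> c = 5"
  "c < 9 \<longleftrightarrow> c = 0 \<or> c = 1 \<or> c = 2 \<or> c = 3 \<or> c = 4 \<or> c = 5 \<or> c = 6 \<or> c = 7 \<or> c = 8"
  for c :: nat
  by auto

lemma live_cases: "live 1 l \<longleftrightarrow> l = 1" "live 3 l \<longleftrightarrow> l = 1 \<or> l = 2 \<or> l = 3"
    "live 4 l \<longleftrightarrow> l = 1 \<or> l = 2 \<or> l = 3 \<or> l = 4"
  by (auto simp: live_def)

text \<open>On component \<open>l\<close>, the unit \<open>id \<rightarrow> \<Delta>\<Sigma>\<close>
  includes into the one copy that carries the label \<open>l\<close>, and the counit
  \<open>tr_mx\<close> projects from it. Copies are counted from 0 and labels from 1.\<close>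

definition eta_mx :: "'k::field tmx" where
  "eta_mx l c' c = (if live 3 l \<and> l = c' + 1 then 1 else 0)"
definition tr_mx :: "'k::field tmx" where
  "tr_mx l c' c = (if live 3 l \<and> l = c + 1 then 1 else 0)"
text \<open>As a column this is the diagonal \<open>id \<rightarrow> \<Sigma>\<Delta>\<close>, as a
  row the summation \<open>\<Sigma>\<Delta> \<rightarrow> id\<close>; hence one matrix serves both
  adjunctions.\<close>

definition one_mx :: "'k::field tmx" where
  "one_mx l c' c = (if l = 1 then 1 else 0)"

abbreviation "unitFS \<equiv> ct idd (pD 1) eta_mx"
abbreviation "counitSF \<equiv> ct (tD 3) idd one_mx"
abbreviation "unitSF \<equiv> ct idd (tD 3) one_mx"
abbreviation "counitFS \<equiv> ct (pD 1) idd tr_mx"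

lemma is_ct_unit_counit:
  "is_ct 4 4 unitFS idd (pD 1) eta_mx" "is_ct 4 4 counitFS (pD 1) idd tr_mx"
  "is_ct 1 1 unitSF idd (tD 3) one_mx" "is_ct 1 1 counitSF (tD 3) idd one_mx"
  by (auto simp: is_ct_def okm_def eta_mx_def tr_mx_def one_mx_def live_cases)

lemma adjunction_sum_diag: "adjunction (vcat 4) (vcat 1) (tw (sD 1)) (tw (fD 1)) unitFS counitSF"
proof -
  have 1: "is_ct 1 4 (cmp (VF 1 4) (wl (vcat 1) (tw (fD 1)) counitSF) (wr (vcat 1) unitFS (tw (fD 1))))
    (fD 1) (fD 1) (mulm (fD 3) (wlm (fD 1) (tD 3) one_mx) (wrm idd (pD 1) eta_mx (fD 1)))"
    by (rule is_ct_cmp)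
     (use is_ct_wl[OF is_ct_unit_counit(4), of 4 "fD 1"] is_ct_wr[OF is_ct_unit_counit(1), of 1 "fD 1"] in simp_all)
  have 2: "is_ct 4 1 (cmp (VF 4 1) (wr (vcat 4) counitSF (tw (sD 1))) (wl (vcat 4) (tw (sD 1)) unitFS))
    (sD 1) (sD 1) (mulm (sD 3) (wrm (tD 3) idd one_mx (sD 1)) (wlm (sD 1) idd eta_mx))"
    by (rule is_ct_cmp)
     (use is_ct_wr[OF is_ct_unit_counit(4), of 4 "sD 1"] is_ct_wl[OF is_ct_unit_counit(1), of 1 "sD 1"] in simp_all)
  have "heq (VF 1 4) (cmp (VF 1 4) (wl (vcat 1) (tw (fD 1)) counitSF) (wr (vcat 1) unitFS (tw (fD 1))))
    (ident (VF 1 4) (tw (fD 1)))"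
    by (rule is_ct_heq[OF 1 is_ct_ident])
      (auto simp: less_cases live_cases mulm_def nat_sums wlm_def wrm_def eta_mx_def one_mx_def idm_def)
  moreover have "heq (VF 4 1) (cmp (VF 4 1) (wr (vcat 4) counitSF (tw (sD 1))) (wl (vcat 4) (tw (sD 1)) unitFS))
    (ident (VF 4 1) (tw (sD 1)))"
    by (rule is_ct_heq[OF 2 is_ct_ident])
      (auto simp: less_cases live_cases mulm_def nat_sums wlm_def wrm_def eta_mx_def one_mx_def idm_def)
  ultimately show ?thesis
    using is_ct_closed[OF is_ct_unit_counit(1)] is_ct_closed[OF is_ct_unit_counit(4)]
    by (simp add: adjunction_def enh_functor_tw fcomp_tw tw_idd)
qed

lemma adjunction_diag_sum: "adjunction (vcat 1) (vcat 4) (tw (fD 1)) (tw (sD 1)) unitSF counitFS"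
proof -
  have 1: "is_ct 4 1 (cmp (VF 4 1) (wl (vcat 4) (tw (sD 1)) counitFS) (wr (vcat 4) unitSF (tw (sD 1))))
    (sD 1) (sD 1) (mulm (sD 3) (wlm (sD 1) (pD 1) tr_mx) (wrm idd (tD 3) one_mx (sD 1)))"
    by (rule is_ct_cmp)
     (use is_ct_wl[OF is_ct_unit_counit(2), of 1 "sD 1"] is_ct_wr[OF is_ct_unit_counit(3), of 4 "sD 1"] in simp_all)
  have 2: "is_ct 1 4 (cmp (VF 1 4) (wr (vcat 1) counitFS (tw (fD 1))) (wl (vcat 1) (tw (fD 1)) unitSF))
    (fD 1) (fD 1) (mulm (fD 3) (wrm (pD 1) idd tr_mx (fD 1)) (wlm (fD 1) idd one_mx))"
    by (rule is_ct_cmp)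
     (use is_ct_wr[OF is_ct_unit_counit(2), of 1 "fD 1"] is_ct_wl[OF is_ct_unit_counit(3), of 4 "fD 1"] in simp_all)
  have "heq (VF 4 1) (cmp (VF 4 1) (wl (vcat 4) (tw (sD 1)) counitFS) (wr (vcat 4) unitSF (tw (sD 1))))
    (ident (VF 4 1) (tw (sD 1)))"
    by (rule is_ct_heq[OF 1 is_ct_ident])
      (auto simp: less_cases live_cases mulm_def nat_sums wlm_def wrm_def tr_mx_def one_mx_def idm_def)
  moreover have "heq (VF 1 4) (cmp (VF 1 4) (wr (vcat 1) counitFS (tw (fD 1))) (wl (vcat 1) (tw (fD 1)) unitSF))
    (ident (VF 1 4) (tw (fD 1)))"
    by (rule is_ct_heq[OF 2 is_ct_ident])
      (auto simp: less_cases live_cases mulm_def nat_sums wlm_def wrm_def tr_mx_def one_mx_def idm_def)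
  ultimately show ?thesis
    using is_ct_closed[OF is_ct_unit_counit(2)] is_ct_closed[OF is_ct_unit_counit(3)]
    by (simp add: adjunction_def enh_functor_tw fcomp_tw tw_idd)
qed

lemma hinverse_ident:
  assumes "okf N N' D"
  shows "hinverse (VF N N') (ident (VF N N') (tw D))
    (ident (VF N N') (tw D) :: ('k::field cob, 'k matr, 'k cob, 'k matr) tarr)"
proof -
  have "mulm D (idm N' D) (idm N' D) l c' c = (idm N' D l c' c :: 'k)" if "c' < fst D" for l c' c
  proof -
    have "mulm D (idm N' D) (idm N' D) l c' c = (idm N' D l c' c' * idm N' D l c' c :: 'k)"
      unfolding mulm_def by (rule sum_single) (use that in \<open>auto simp: idm_def\<close>)
    then show ?thesis by (auto simp: idm_def)
  qed
  then show ?thesis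
    using assms by (simp add: ident_ct okf_okd hinverse_ct)
qed

lemma hinverse_hiso: "hinverse C a b \<Longrightarrow> hiso C a"
  by (auto simp: hiso_def)

lemma adjunction_Idf:
  "adjunction (vcat N) (vcat N) Idf Idf (ident (VF N N) Idf)
     (ident (VF N N) Idf :: ('k::field cob, 'k matr, 'k cob, 'k matr) tarr)"
proof -
  let ?I = "ident (VF N N) Idf :: ('k cob, 'k matr, 'k cob, 'k matr) tarr"
  have I: "is_ct N N ?I idd idd (idm N idd)"
    using is_ct_ident[OF okf_idd, of N] by (simp add: tw_idd)
  have l: "is_ct N N (wl (vcat N) Idf ?I) idd idd (idm N idd)"
    by (rule is_ct_wl_Idf[OF I])
  have r: "is_ct N N (wr (vcat N) ?I Idf) idd idd (wrm idd idd (idm N idd) idd)"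
    using is_ct_wr[OF I okf_idd] by (simp add: tw_idd)
  have "heq (VF N N) (cmp (VF N N) (wl (vcat N) Idf ?I) (wr (vcat N) ?I Idf)) ?I"
    by (rule is_ct_heq[OF is_ct_cmp[OF r l] I]) (simp add: mulm_def less_cases nat_sums wrm_def idm_def)
  moreover have "heq (VF N N) (cmp (VF N N) (wr (vcat N) ?I Idf) (wl (vcat N) Idf ?I)) ?I"
    by (rule is_ct_heq[OF is_ct_cmp[OF l r] I]) (simp add: mulm_def less_cases nat_sums wrm_def idm_def)
  moreover have "enh_functor (vcat N) (vcat N) (Idf :: 'k small_functor)"
    using enh_functor_tw[OF okf_idd[of N]] by (simp add: tw_idd)
  ultimately show ?thesis
    using is_ct_closed[OF I] by (simp add: adjunction_def tw_idd)
qed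

text \<open>
  \<open>\<Sigma>\<Delta>\<close> is the algebra of functions on three points, and \<open>x = (0, 1, 2)\<close> generates it.  The Postnikov
  system is the filtration by the degree in \<open>x\<close>: \<open>iota2\<close> has columns \<open>1\<close>, \<open>x\<close>, and \<open>proj2\<close> is the
  second difference.
\<close>

definition iota1_mx :: "'k::field tmx" where
  "iota1_mx l c' c = (if l = 1 \<and> c' = 0 then 1 else 0)"
definition proj1_mx :: "'k::field tmx" where
  "proj1_mx l c' c = (if l = 1 \<and> c = 1 then 1 else 0)"
definition iota2_mx :: "'k::field tmx" where
  "iota2_mx l c' c = (if l = 1 then if c = 0 then 1 else of_nat c' else 0)"
definition proj2_mx :: "'k::field tmx" where
  "proj2_mx l c' c = (if l = 1 then if c = 1 then - 2 else 1 else 0)"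
text \<open>The value of \<open>x\<close> at the point \<open>l - 1\<close> minus its value at the
  point \<open>c\<close>: the two whiskered counits evaluate the algebra at these two points. They
  agree on 1, so their difference descends to the quotient by 1, where it is determined by
  \<open>x\<close>.\<close>

definition psi_mx :: "'k::field tmx" where
  "psi_mx l c' c = (if live 3 l \<and> c' = c then of_nat l - 1 - of_nat c else 0)"
text \<open>The quotient of functions by constants: the values at the points 1 and 2, each minus the
  value at 0.\<close>

definition cone_mx :: "'k::field tmx" where
  "cone_mx l c' c = (if l = 1 then if c = 0 then - 1 else if c = c' + 1 then 1 else 0 else 0)"

abbreviation "iota1 \<equiv> ct idd (tD 2) iota1_mx"
abbreviation "proj1 \<equiv> ct (tD 2) idd proj1_mx"
abbreviation "iota2 \<equiv> ct (tD 2) (tD 3) iota2_mx"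
abbreviation "proj2 \<equiv> ct (tD 3) idd proj2_mx"
abbreviation "psi \<equiv> ct (pD 1) (pD 1) psi_mx"
abbreviation "cone \<equiv> ct (tD 3) (tD 2) cone_mx"

lemmas mx_defs = eta_mx_def tr_mx_def one_mx_def iota1_mx_def proj1_mx_def iota2_mx_def proj2_mx_def
  psi_mx_def cone_mx_def idm_def

lemma is_ct_basic:
  "is_ct 1 1 iota1 idd (tD 2) iota1_mx" "is_ct 1 1 proj1 (tD 2) idd proj1_mx"
  "is_ct 1 1 iota2 (tD 2) (tD 3) iota2_mx" "is_ct 1 1 proj2 (tD 3) idd proj2_mx"
  "is_ct 4 4 psi (pD 1) (pD 1) psi_mx" "is_ct 1 1 cone (tD 3) (tD 2) cone_mx"
  by (auto simp: is_ct_def okm_def mx_defs live_cases)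

section \<open>The split triangles of the filtration and of the unit\<close>

lemma exact_triangle1:
  "exact_triangle (VF 1 1) iota1 proj1 (Arr Idf (Idf :: 'k::field small_functor) 1 0)"
proof -
  have "exact_triangle (VF 1 1) iota1 proj1 (Arr (tw idd) (tw idd :: 'k small_functor) 1 0)"
    by (rule exact_triangle_ct[where q = "\<lambda>l c' c. if l = 1 \<and> c' = 1 then 1 else 0"
        and b = "\<lambda>l c' c. if l = 1 \<and> c = 0 then - 1 else 0"])
      (auto simp: okm_def mx_defs live_cases mulm_def nat_sums less_cases)
  then show ?thesis by (simp add: tw_idd)
qed

text \<open>The second difference vanishes exactly on values of linear polynomials. \<open>q\<close>
  is its section \<open>(1, 0, 0)\<close>, and \<open>- b\<close> returns the constant term
  \<open>2 y1 - y2\<close> and the slope \<open>y2 - y1\<close> of the line through the values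
  \<open>y1\<close>, \<open>y2\<close> at the points 1 and 2.\<close>

lemma exact_triangle2:
  "exact_triangle (VF 1 1) iota2 proj2 (Arr Idf (tw (tD 2) :: 'k::field small_functor) 1 0)"
proof -
  have "exact_triangle (VF 1 1) iota2 proj2 (Arr (tw idd) (tw (tD 2) :: 'k small_functor) 1 0)"
    by (rule exact_triangle_ct[where q = "\<lambda>l c' c. if l = 1 \<and> c' = 0 then 1 else 0"
        and b = "\<lambda>l c' c. if l = 1 then
          if c' = 0 then if c = 0 then 0 else if c = 1 then - 2 else 1
          else if c = 0 then 0 else if c = 1 then 1 else - 1 else 0"])
      (auto simp: okm_def mx_defs live_cases mulm_def nat_sums less_cases)
  then show ?thesis by (simp add: tw_idd)
qed

lemma exact_triangle_act:
  "exact_triangle (VF 1 1) unitSF cone (Arr (tw (tD 2)) (Idf :: 'k::field small_functor) 1 0)"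
proof -
  have "exact_triangle (VF 1 1) unitSF cone (Arr (tw (tD 2)) (tw idd :: 'k small_functor) 1 0)"
    by (rule exact_triangle_ct[where q = "\<lambda>l c' c. if l = 1 \<and> c' = c + 1 then 1 else 0"
        and b = "\<lambda>l c' c. if l = 1 \<and> c = 0 then - 1 else 0"])
      (auto simp: okm_def mx_defs live_cases mulm_def nat_sums less_cases)
  then show ?thesis by (simp add: tw_idd)
qed

lemma nat_sums_27:
  fixes f :: "nat \<Rightarrow> 'a::comm_monoid_add"
  shows "(\<Sum>k<27. f k) = f 0 + f 1 + f 2 + f 3 + f 4 + f 5 + f 6 + f 7 + f 8 + f 9 + f 10 + f 11 +
    f 12 + f 13 + f 14 + f 15 + f 16 + f 17 + f 18 + f 19 + f 20 + f 21 + f 22 + f 23 + f 24 +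
    f 25 + f 26"
  by (simp add: eval_nat_numeral One_nat_def)

lemma less_cases_27:
  "c < 27 \<longleftrightarrow> c = 0 \<or> c = 1 \<or> c = 2 \<or> c = 3 \<or> c = 4 \<or> c = 5 \<or> c = 6 \<or> c = 7 \<or> c = 8 \<or>
    c = 9 \<or> c = 10 \<or> c = 11 \<or> c = 12 \<or> c = 13 \<or> c = 14 \<or> c = 15 \<or> c = 16 \<or> c = 17 \<or> c = 18 \<or>
    c = 19 \<or> c = 20 \<or> c = 21 \<or> c = 22 \<or> c = 23 \<or> c = 24 \<or> c = 25 \<or> c = 26"
  for c :: nat
  by presburger

lemmas sizes = data_sel(1-5) arith_simps mult_1 mult_1_right

abbreviation "gammaSF \<equiv> ident (VF 1 1) (tw (tD 3))"

lemmas calc = less_cases live_cases mulm_def nat_sums wlm_def wrm_def mx_defs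

lemma is_ct_gam: "is_ct 1 1 gammaSF (tD 3) (tD 3) (idm 1 (tD 3))"
  by (rule is_ct_ident) simp

lemma is_ct_gam_iota2:
  "is_ct 1 1 (cmp (VF 1 1) gammaSF iota2) (tD 2) (tD 3) iota2_mx"
  by (rule is_ct_cong[OF is_ct_cmp[OF is_ct_basic(3) is_ct_gam]]) (auto simp: calc)

lemma is_ct_proj2_gam:
  "is_ct 1 1 (cmp (VF 1 1) proj2 gammaSF) (tD 3) idd proj2_mx"
  by (rule is_ct_cong[OF is_ct_cmp[OF is_ct_gam is_ct_basic(4)]]) (auto simp: calc)

text \<open>The outer \<open>\<Delta>\<close> contributes the last base-3 digit. The digit before it
  numbers the basis \<open>1, x\<close> in the source and the three points in the target.\<close>

definition FiotaS_mx :: "'k::field tmx" where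
  "FiotaS_mx l c' c = (if live 3 l \<and> c' mod 3 = c mod 3 then
     if c < 3 then 1 else of_nat (c' div 3) else 0)"

lemma is_ct_FiotaS:
  "is_ct 4 4 (wl (vcat 4) (tw (fD 1)) (wr (vcat 4) (cmp (VF 1 1) gammaSF iota2) (tw (sD 1))))
    (pD 2) (pD 3) FiotaS_mx"
proof (rule is_ct_cong)
  show "is_ct 4 4 (wl (vcat 4) (tw (fD 1)) (wr (vcat 4) (cmp (VF 1 1) gammaSF iota2) (tw (sD 1))))
    (pD 2) (pD 3) (wlm (fD 1) (sD 2) (wrm (tD 2) (tD 3) iota2_mx (sD 1)))"
    using is_ct_wl[OF is_ct_wr[OF is_ct_gam_iota2 okf_data(3)], of 1 4 "fD 1"] by simp
qed (force simp: FiotaS_mx_def live_cases, simp only: sizes less_cases live_cases,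
  (elim disjE; simp add: calc FiotaS_mx_def))

section \<open>The map \<open>\<psi>\<close> and the three conditions\<close>

lemma is_psi_psi:
  "is_psi 2 (vcat 1) (vcat 4) (tw (fD 1)) (tw (sD 1)) counitFS Idf Q (\<lambda>i. if i = 1 then iota1 else iota2)
     (\<lambda>i. if i = 1 then proj1 else proj2) gammaSF (psi :: ('k::field cob, 'k matr, 'k cob, 'k matr) tarr)"
  if "Q 1 = tw (tD 2)"
proof -
  let ?B = "VF 4 4 :: ('k, ('k cob, 'k matr, 'k cob, 'k matr) enhfun, _) dgcat"
  have 1: "is_ct 4 4 (wl (vcat 4) (tw (fD 1)) (wr (vcat 4) proj1 (tw (sD 1)))) (pD 2) (pD 1)
      (wlm (fD 1) (sD 2) (wrm (tD 2) idd proj1_mx (sD 1)))"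
    using is_ct_wl[OF is_ct_wr[OF is_ct_basic(2) okf_data(3)], of 1 4 "fD 1"] by simp
  have 2: "is_ct 4 4 (asub (wl (vcat 4) (tw (pD 1)) counitFS) (wr (vcat 4) counitFS (tw (pD 1)))) (pD 3) (pD 1)
      (\<lambda>l c' c. wlm (pD 1) (pD 1) tr_mx l c' c - wrm (pD 1) idd tr_mx (pD 1) l c' c)"
    by (rule is_ct_asub)
      (use is_ct_wl[OF is_ct_unit_counit(2), of 4 "pD 1"]
        is_ct_wr[OF is_ct_unit_counit(2), of 4 "pD 1"] in simp_all)
  have pm: "cmp (VF 1 1) gammaSF (postnikov_map (VF 1 1) Q
      (\<lambda>i. if i = 1 then iota1 else iota2) 1 (2 - 1)) = cmp (VF 1 1) gammaSF iota2"
  proof -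
    have "postnikov_map (VF 1 1) Q (\<lambda>i. if i = 1 then iota1 else iota2) 1 (2 - 1) =
        cmp (VF 1 1) iota2 (ident (VF 1 1) (tw (tD 2)))"
      using that by (simp add: One_nat_def)
    also have "is_ct 1 1 \<dots> (tD 2) (tD 3) iota2_mx"
      by (rule is_ct_cong[OF is_ct_cmp[OF is_ct_ident is_ct_basic(3)]]) (auto simp: calc)
    ultimately show ?thesis by (simp add: is_ct_def)
  qed
  have "heq ?B (cmp ?B psi (wl (vcat 4) (tw (fD 1)) (wr (vcat 4) proj1 (tw (sD 1)))))
    (cmp ?B (asub (wl (vcat 4) (tw (pD 1)) counitFS) (wr (vcat 4) counitFS (tw (pD 1))))
      (wl (vcat 4) (tw (fD 1)) (wr (vcat 4) (cmp (VF 1 1) gammaSF iota2) (tw (sD 1)))))"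
    by (rule is_ct_heq[OF is_ct_cmp[OF 1 is_ct_basic(5)] is_ct_cmp[OF is_ct_FiotaS 2]],
        simp only: sizes less_cases live_cases, (elim disjE; simp add: calc FiotaS_mx_def))
  then show ?thesis
    using is_ct_closed[OF is_ct_basic(5)]
    unfolding is_psi_def pm by (simp add: fcomp_tw)
qed

text \<open>On the copy belonging to the point \<open>p\<close>, a polynomial \<open>f\<close> of
  degree at most 1 goes to \<open>(x - p) f\<close> modulo constants. If \<open>(x - p) f\<close> is
  constant on the three points then it is 0, because it vanishes at \<open>p\<close>; so
  \<open>f\<close> has two zeros and is 0.\<close>

lemma monad_condition_diag:
  "monad_condition (2 :: nat) (vcat 1) (vcat 4) (tw (fD 1)) (tw (sD 1)) unitSF Idf Q
     (\<lambda>i. if i = 1 then iota1 else iota2) gammaSF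
     (psi :: ('k::field_char_0 cob, 'k matr, 'k cob, 'k matr) tarr)"
proof -
  let ?F = "VF 1 4 :: ('k, ('k cob, 'k matr, 'k cob, 'k matr) enhfun, _) dgcat"
  let ?\<alpha> = "cmp ?F (wl (vcat 1) (tw (fD 1)) cone) (cmp ?F (wr (vcat 1) psi (tw (fD 1)))
      (wl (vcat 1) (tw (fD 1)) (wl (vcat 1) Idf (cmp (VF 1 1) gammaSF iota2))))"
  have 1: "is_ct 1 4 (wl (vcat 1) (tw (fD 1)) (wl (vcat 1) Idf
      (cmp (VF 1 1) gammaSF iota2))) (fD 2) (fD 3) (wlm (fD 1) (tD 2) iota2_mx)"
    using is_ct_wl[OF is_ct_wl_Idf[OF is_ct_gam_iota2], of 4 "fD 1"] by simp
  have 2: "is_ct 1 4 (wr (vcat 1) psi (tw (fD 1))) (fD 3) (fD 3) (wrm (pD 1) (pD 1) psi_mx (fD 1))"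
    using is_ct_wr[OF is_ct_basic(5), of 1 "fD 1"] by simp
  have 3: "is_ct 1 4 (wl (vcat 1) (tw (fD 1)) cone) (fD 3) (fD 2) (wlm (fD 1) (tD 3) cone_mx)"
    using is_ct_wl[OF is_ct_basic(6), of 4 "fD 1"] by simp
  \<comment> \<open>With \<open>p = c mod 3\<close>, the images of \<open>1\<close> and
    \<open>x\<close> are \<open>(1, 2)\<close> and \<open>(1 - p, 4 - 2 p)\<close>. The determinant
    is 2 for every \<open>p\<close>, which gives the inverse \<open>M'\<close>.\<close>
  define M :: "'k tmx" where "M = (\<lambda>l c' c. if l = 1 \<and> c' mod 3 = c mod 3 then
    if c < 3 then if c' < 3 then 1 else 2
    else if c' < 3 then 1 - of_nat (c mod 3) else 4 - 2 * of_nat (c mod 3) else 0)"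
  define M' :: "'k tmx" where "M' = (\<lambda>l c' c. if l = 1 \<and> c' mod 3 = c mod 3 then
    if c < 3 then if c' < 3 then 2 - of_nat (c mod 3) else - 1
    else if c' < 3 then (of_nat (c mod 3) - 1) / 2 else 1 / 2 else 0)"
  have 12: "is_ct 1 4 (cmp ?F (wr (vcat 1) psi (tw (fD 1)))
      (wl (vcat 1) (tw (fD 1)) (wl (vcat 1) Idf (cmp (VF 1 1) gammaSF iota2))))
    (fD 2) (fD 3) (\<lambda>l c' c. if l = 1 \<and> c' mod 3 = c mod 3 then
      (of_nat (c' div 3) - of_nat (c mod 3)) * (if c < 3 then 1 else of_nat (c' div 3)) else 0)"
    by (rule is_ct_cong[OF is_ct_cmp[OF 1 2]], force simp: live_cases,
        simp only: sizes less_cases live_cases, (elim disjE; simp add: calc))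
  have "is_ct 1 4 ?\<alpha> (fD 2) (fD 2) M"
    by (rule is_ct_cong[OF is_ct_cmp[OF 12 3]], force simp: M_def live_cases,
        simp only: sizes less_cases live_cases, (elim disjE; simp add: calc M_def))
  then have \<alpha>: "?\<alpha> = ct (fD 2) (fD 2) M" "okm 4 (fD 2) (fD 2) M" by (auto simp: is_ct_def)
  have "hinverse ?F (ct (fD 2) (fD 2) M) (ct (fD 2) (fD 2) M')"
  proof (rule hinverse_ct[OF _ _ \<alpha>(2)])
    show "okm 4 (fD 2) (fD 2) M'" by (auto simp: okm_def M'_def live_def)
    fix l c' c
    assume c: "c < fst (fD 2)" "c' < fst (fD 2)"
    show "mulm (fD 2) M' M l c' c = idm 4 (fD 2) l c' c"
      using c unfolding sizes less_cases
      by (elim disjE; simp add: calc M_def M'_def)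
    show "mulm (fD 2) M M' l c' c = idm 4 (fD 2) l c' c"
      using c unfolding sizes less_cases
      by (elim disjE; simp add: calc M_def M'_def)
  qed simp_all
  then have "hiso ?F ?\<alpha>" by (simp add: \<alpha> hinverse_hiso)
  then show ?thesis
    unfolding monad_condition_def using exact_triangle_act by auto
qed

text \<open>The unit selects the point \<open>l - 1\<close>, so component \<open>l\<close> is
  multiplied by the corresponding coefficient of the second difference \<open>(1, -2, 1)\<close>.
  All three are nonzero in characteristic 0.\<close>

lemma adjoints_condition_diag:
  "adjoints_condition (2 :: nat) (vcat 1) (vcat 4) (tw (fD 1)) (tw (sD 1)) (tw (sD 1))
     (unitFS :: ('k::field_char_0 cob, 'k matr, 'k cob, 'k matr) tarr)
     (\<lambda>i. if i = 1 then proj1 else proj2) gammaSF"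
proof -
  let ?B = "VF 4 4 :: ('k, ('k cob, 'k matr, 'k cob, 'k matr) enhfun, _) dgcat"
  have 1: "is_ct 4 4 (wl (vcat 4) (tw (fD 1)) (wr (vcat 4) (cmp (VF 1 1) proj2 gammaSF) (tw (sD 1))))
      (pD 3) (pD 1) (wlm (fD 1) (sD 3) (wrm (tD 3) idd proj2_mx (sD 1)))"
    using is_ct_wl[OF is_ct_wr[OF is_ct_proj2_gam okf_data(3)], of 1 4 "fD 1"] by simp
  have 2: "is_ct 4 4 (wl (vcat 4) (tw (pD 1)) unitFS) (pD 1) (pD 3) (wlm (pD 1) idd eta_mx)"
    using is_ct_wl[OF is_ct_unit_counit(1), of 4 "pD 1"] by simp
  let ?\<alpha> = "cmp ?B (wl (vcat 4) (tw (fD 1)) (wr (vcat 4) (cmp (VF 1 1) proj2 gammaSF) (tw (sD 1))))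
      (wl (vcat 4) (tw (pD 1)) unitFS)"
  define M :: "'k tmx" where "M = (\<lambda>l c' c. if live 3 l \<and> c' = c then if l = 2 then - 2 else 1 else 0)"
  define M' :: "'k tmx" where "M' = (\<lambda>l c' c. if live 3 l \<and> c' = c then if l = 2 then - 1 / 2 else 1 else 0)"
  have "is_ct 4 4 ?\<alpha> (pD 1) (pD 1) M"
    by (rule is_ct_cong[OF is_ct_cmp[OF 2 1]], force simp: M_def live_cases,
        simp only: sizes less_cases live_cases, (elim disjE; simp add: calc M_def))
  then have \<alpha>: "?\<alpha> = ct (pD 1) (pD 1) M" "okm 4 (pD 1) (pD 1) M" by (auto simp: is_ct_def)
  have "hinverse ?B (ct (pD 1) (pD 1) M) (ct (pD 1) (pD 1) M')"
    by (rule hinverse_ct[OF _ _ \<alpha>(2)]) (auto simp: calc M_def M'_def okm_def)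
  then have "hiso ?B ?\<alpha>" by (simp add: \<alpha> hinverse_hiso)
  then show ?thesis by (simp add: adjoints_condition_def fcomp_tw)
qed

text \<open>The negative of \<open>psi_mx\<close>, as passing to left adjoints interchanges the two
  points of evaluation.\<close>

definition psi_mate_mx :: "'k::field tmx" where
  "psi_mate_mx l c' c = (if live 3 l \<and> c' = c then of_nat c + 1 - of_nat l else 0)"

definition unitF_mx :: "'k::field tmx" where
  "unitF_mx l c' c = (if live 3 l \<and> c' mod 3 + 1 = l then 1 else 0)"
definition counitF_mx :: "'k::field tmx" where
  "counitF_mx l c' c = (if live 3 l \<and> c mod 3 + 1 = l then 1 else 0)"

text \<open>Positions in a composite of three copies of \<open>\<Delta>\<close> are written in base 3, the outermost
  functor giving the last digit.\<close>

definition FLunit_mx :: "'k::field tmx" where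
  "FLunit_mx l c' c = (if live 3 l \<and> c' mod 3 = c \<and> c' div 3 mod 3 + 1 = l then 1 else 0)"
definition FLpsi_mx :: "'k::field tmx" where
  "FLpsi_mx l c' c = (if live 3 l \<and> c' = c then of_nat (c div 9) - of_nat (c div 3 mod 3) else 0)"
definition FLpsiunit_mx :: "'k::field tmx" where
  "FLpsiunit_mx l c' c = (if live 3 l \<and> c' mod 3 = c \<and> c' div 3 mod 3 + 1 = l
     then of_nat (c' div 9) + 1 - of_nat l else 0)"

text \<open>The defining composite passes through 27 copies. Every intermediate map is rewritten in
  terms of base-3 digits before the next product is taken.\<close>

lemma is_ct_psi_mate:
  "is_ct 4 4 (psi_mate (vcat 1) (vcat 4) (tw (fD 1)) (tw (sD 1)) (tw (sD 1)) unitFS counitSF unitSF counitFS Idf Idf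
      (ident (VF 1 1) Idf) psi) (pD 1) (pD 1)
    (psi_mate_mx :: 'k::field tmx)"
proof -
  let ?B = "VF 4 4 :: ('k, ('k cob, 'k matr, 'k cob, 'k matr) enhfun, _) dgcat"
  let ?u = "ident (VF 1 1) Idf :: ('k cob, 'k matr, 'k cob, 'k matr) tarr"
  have "is_ct 1 1 ?u idd idd (idm 1 idd)"
    using is_ct_ident[OF okf_idd, of 1] by (simp add: tw_idd)
  from is_ct_wl[OF is_ct_wr[OF this okf_data(3)], of 1 4 "fD 1"]
  have u: "is_ct 4 4 (wl (vcat 4) (tw (fD 1)) (wr (vcat 4) ?u (tw (sD 1)))) (pD 1) (pD 1)
      (wlm (fD 1) (sD 1) (wrm idd idd (idm 1 idd) (sD 1)))" by simp
  have ueta: "is_ct 4 4 (cmp ?B (wl (vcat 4) (tw (fD 1)) (wr (vcat 4) ?u (tw (sD 1)))) unitFS)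
      idd (pD 1) eta_mx"
    by (rule is_ct_cong[OF is_ct_cmp[OF is_ct_unit_counit(1) u]], force simp: eta_mx_def live_cases,
        simp only: sizes less_cases live_cases, (elim disjE; simp add: calc))
  have "is_ct 4 1 (wr (vcat 4) unitSF (tw (sD 1))) (sD 1) (sD 3) (wrm idd (tD 3) one_mx (sD 1))"
    using is_ct_wr[OF is_ct_unit_counit(3) okf_data(3), of 1] by simp
  from is_ct_wl[OF is_ct_wl_Idf[OF this], of 4 "fD 1"]
  have unitSF: "is_ct 4 4 (wl (vcat 4) (tw (fD 1)) (wl (vcat 4) Idf (wr (vcat 4) unitSF (tw (sD 1)))))
      (pD 1) (pD 3) (wlm (fD 1) (sD 1) (wrm idd (tD 3) one_mx (sD 1)))" by simp
  let ?unit = "cmp ?B (wl (vcat 4) (tw (fD 1)) (wl (vcat 4) Idf (wr (vcat 4) unitSF (tw (sD 1)))))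
      (cmp ?B (wl (vcat 4) (tw (fD 1)) (wr (vcat 4) ?u (tw (sD 1)))) unitFS)"
  have "is_ct 4 4 ?unit idd (pD 3) unitF_mx"
    by (rule is_ct_cong[OF is_ct_cmp[OF ueta unitSF]], force simp: unitF_mx_def live_cases,
        simp only: sizes less_cases live_cases, (elim disjE; simp add: calc unitF_mx_def))
  from is_ct_wl[OF this, of 4 "pD 1"]
  have "is_ct 4 4 (wl (vcat 4) (tw (pD 1)) ?unit) (pD 1) (pD 9) (wlm (pD 1) idd unitF_mx)" by simp
  then have FLunit: "is_ct 4 4 (wl (vcat 4) (tw (pD 1)) ?unit) (pD 1) (pD 9) FLunit_mx"
    by (rule is_ct_cong, force simp: FLunit_mx_def live_cases)
      (simp only: sizes less_cases less_cases_27 live_cases,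
       (elim disjE; simp add: wlm_def unitF_mx_def FLunit_mx_def live_cases))
  have "is_ct 4 4 (wr (vcat 4) psi (tw (pD 1))) (pD 3) (pD 3) (wrm (pD 1) (pD 1) psi_mx (pD 1))"
    using is_ct_wr[OF is_ct_basic(5), of 4 "pD 1"] by simp
  from is_ct_wl[OF this, of 4 "pD 1"]
  have FLpsi: "is_ct 4 4 (wl (vcat 4) (tw (pD 1)) (wr (vcat 4) psi (tw (pD 1)))) (pD 9) (pD 9)
      (wlm (pD 1) (pD 3) (wrm (pD 1) (pD 1) psi_mx (pD 1)))" by simp
  \<comment> \<open>A number is determined by its base-3 digits, so this matrix is diagonal. In the
    product with \<open>FLunit_mx\<close> the sum over 27 positions then has a single term.\<close>
  have FLpsi_eq: "wlm (pD 1) (pD 3) (wrm (pD 1) (pD 1) psi_mx (pD 1)) l c' c = FLpsi_mx l c' c"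
    if "c < 27" "c' < 27" for l c' c
  proof -
    have "c' mod 3 = c mod 3 \<and> c' div 3 div 3 = c div 3 div 3 \<and> c' div 3 mod 3 = c div 3 mod 3 \<longleftrightarrow> c' = c"
      by (metis div_mult_mod_eq)
    moreover have "c div 3 div 3 = c div 9" "c div 9 < 3"
      using that by (simp_all add: div_mult2_eq[symmetric] less_mult_imp_div_less)
    moreover from this have "live 3 (c div 9 + 1)"
      by (simp add: live_def)
    ultimately show ?thesis
      by (auto simp: wlm_def wrm_def psi_mx_def FLpsi_mx_def live3[simplified])
  qed
  have "is_ct 4 4 (cmp ?B (wl (vcat 4) (tw (pD 1)) (wr (vcat 4) psi (tw (pD 1))))
      (wl (vcat 4) (tw (pD 1)) ?unit)) (pD 1) (pD 9) FLpsiunit_mx"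
  proof (rule is_ct_cong[OF is_ct_cmp[OF FLunit FLpsi]])
    fix l c' c assume l: "live 4 l" and "c < fst (pD 1)" "c' < fst (pD 9)"
    then have c: "c < 3" "c' < 27" by simp_all
    have "mulm (pD 9) (wlm (pD 1) (pD 3) (wrm (pD 1) (pD 1) psi_mx (pD 1))) FLunit_mx l c' c =
        (\<Sum>k<27. FLpsi_mx l c' k * FLunit_mx l k c :: 'k)"
      unfolding mulm_def using c by (intro sum.cong) (auto simp: FLpsi_eq)
    also have "\<dots> = FLpsi_mx l c' c' * FLunit_mx l c' c"
      by (rule sum_single) (use c in \<open>auto simp: FLpsi_mx_def\<close>)
    also have "\<dots> = FLpsiunit_mx l c' c"
      by (auto simp: FLpsi_mx_def FLunit_mx_def FLpsiunit_mx_def)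
    finally show "mulm (pD 9) (wlm (pD 1) (pD 3) (wrm (pD 1) (pD 1) psi_mx (pD 1))) FLunit_mx l c' c =
      (FLpsiunit_mx l c' c :: 'k)" .
  qed (force simp: FLpsiunit_mx_def live_cases)
  note psiunit = this
  have "is_ct 4 1 (wr (vcat 4) counitSF (tw (sD 1))) (sD 3) (sD 1) (wrm (tD 3) idd one_mx (sD 1))"
    using is_ct_wr[OF is_ct_unit_counit(4) okf_data(3), of 1] by simp
  from is_ct_wl[OF this, of 4 "fD 1"]
  have counitSF: "is_ct 4 4 (wl (vcat 4) (tw (fD 1)) (wr (vcat 4) counitSF (tw (sD 1))))
      (pD 3) (pD 1) (wlm (fD 1) (sD 3) (wrm (tD 3) idd one_mx (sD 1)))" by simp
  let ?counit = "cmp ?B counitFS (wl (vcat 4) (tw (fD 1)) (wr (vcat 4) counitSF (tw (sD 1))))"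
  have "is_ct 4 4 ?counit (pD 3) idd counitF_mx"
    by (rule is_ct_cong[OF is_ct_cmp[OF counitSF is_ct_unit_counit(2)]], force simp: counitF_mx_def live_cases,
        simp only: sizes less_cases live_cases, (elim disjE; simp add: calc counitF_mx_def))
  from is_ct_wr[OF this, of 4 "pD 1"]
  have counit: "is_ct 4 4 (wr (vcat 4) ?counit (tw (pD 1))) (pD 9) (pD 1) (wrm (pD 3) idd counitF_mx (pD 1))"
    by simp
  have "is_ct 4 4 (cmp ?B (wr (vcat 4) ?counit (tw (pD 1)))
      (cmp ?B (wl (vcat 4) (tw (pD 1)) (wr (vcat 4) psi (tw (pD 1))))
      (wl (vcat 4) (tw (pD 1)) ?unit))) (pD 1) (pD 1) psi_mate_mx"
    by (rule is_ct_cong[OF is_ct_cmp[OF psiunit counit]], force simp: psi_mate_mx_def live_cases,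
        simp only: sizes less_cases live_cases,
        (elim disjE; simp add: mulm_def nat_sums_27 wrm_def counitF_mx_def FLpsiunit_mx_def
          psi_mate_mx_def live_cases))
  then show ?thesis
    by (simp add: psi_mate_def Let_def fcomp_tw)
qed

text \<open>A linear polynomial is multiplied by \<open>x - p\<close> on one side and by
  \<open>x - (l - 1)\<close> on the other, and then the second difference is taken, which sees only
  the coefficient of \<open>x^2\<close>. Both sides send \<open>1\<close> to 0 and \<open>x\<close>
  to 2, so \<open>\<theta>\<close> can be the identity.\<close>

lemma highest_degree_condition_diag:
  "highest_degree_condition (2 :: nat) (vcat 1) (vcat 4) (tw (fD 1)) (tw (sD 1)) (tw (sD 1)) Idf Idf
     (\<lambda>i. if i = 1 then iota1 else iota2) (\<lambda>i. if i = 1 then proj1 else proj2) gammaSF gammaSF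
     (psi :: ('k::field cob, 'k matr, 'k cob, 'k matr) tarr)
     (psi_mate (vcat 1) (vcat 4) (tw (fD 1)) (tw (sD 1)) (tw (sD 1)) unitFS counitSF unitSF counitFS Idf Idf
      (ident (VF 1 1) Idf) psi)"
proof -
  let ?B = "VF 4 4 :: ('k, ('k cob, 'k matr, 'k cob, 'k matr) enhfun, _) dgcat"
  let ?A = "VF 1 1 :: ('k, ('k cob, 'k matr, 'k cob, 'k matr) enhfun, _) dgcat"
  let ?\<psi>' = "psi_mate (vcat 1) (vcat 4) (tw (fD 1)) (tw (sD 1)) (tw (sD 1)) unitFS counitSF unitSF counitFS Idf Idf
      (ident (VF 1 1) Idf) psi :: ('k cob, 'k matr, 'k cob, 'k matr) tarr"
  let ?incl = "wl (vcat 4) (tw (fD 1)) (wl (vcat 4) Idf (wr (vcat 4) (cmp ?A gammaSF iota2) (tw (sD 1))))"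
  have "is_ct 4 1 (wr (vcat 4) (cmp ?A gammaSF iota2) (tw (sD 1))) (sD 2) (sD 3) (wrm (tD 2) (tD 3) iota2_mx (sD 1))"
    using is_ct_wr[OF is_ct_gam_iota2 okf_data(3), of 1] by simp
  from is_ct_wl_Idf[OF this]
  have "wl (vcat 4) Idf (wr (vcat 4) (cmp ?A gammaSF iota2) (tw (sD 1))) = wr (vcat 4) (cmp ?A gammaSF iota2) (tw (sD 1))"
    using \<open>is_ct 4 1 (wr _ _ _) _ _ _\<close> by (simp add: is_ct_def)
  with is_ct_FiotaS have incl: "is_ct 4 4 ?incl (pD 2) (pD 3) FiotaS_mx" by simp
  let ?proj = "cmp ?A proj2 gammaSF"
  have "is_ct 4 1 (wr (vcat 4) ?proj (tw (sD 1))) (sD 3) (sD 1) (wrm (tD 3) idd proj2_mx (sD 1))"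
    using is_ct_wr[OF is_ct_proj2_gam okf_data(3), of 1] by simp
  from is_ct_wl[OF this, of 4 "fD 1"] is_ct_wl[OF is_ct_wl_Idf[OF this], of 4 "fD 1"]
  have proj: "is_ct 4 4 (wl (vcat 4) (tw (fD 1)) (wr (vcat 4) ?proj (tw (sD 1)))) (pD 3) (pD 1)
      (wlm (fD 1) (sD 3) (wrm (tD 3) idd proj2_mx (sD 1)))"
    and proj': "is_ct 4 4 (wl (vcat 4) (tw (fD 1)) (wl (vcat 4) Idf (wr (vcat 4) ?proj (tw (sD 1))))) (pD 3) (pD 1)
      (wlm (fD 1) (sD 3) (wrm (tD 3) idd proj2_mx (sD 1)))" by simp_all
  have psiFL: "is_ct 4 4 (wr (vcat 4) psi (tw (pD 1))) (pD 3) (pD 3) (wrm (pD 1) (pD 1) psi_mx (pD 1))"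
    using is_ct_wr[OF is_ct_basic(5), of 4 "pD 1"] by simp
  have "is_ct 4 1 (wl (vcat 4) (tw (sD 1)) ?\<psi>') (sD 3) (sD 3) (wlm (sD 1) (pD 1) psi_mate_mx)"
    using is_ct_wl[OF is_ct_psi_mate, of 1 "sD 1"] by simp
  from is_ct_wl[OF is_ct_wl_Idf[OF this], of 4 "fD 1"]
  have FRpsi': "is_ct 4 4 (wl (vcat 4) (tw (fD 1)) (wl (vcat 4) Idf (wl (vcat 4) (tw (sD 1)) ?\<psi>')))
      (pD 3) (pD 3) (wlm (fD 1) (sD 3) (wlm (sD 1) (pD 1) psi_mate_mx))" by simp
  define M :: "'k tmx" where
    "M = (\<lambda>l c' c. if live 3 l \<and> c = 3 + c' then 2 else 0)"
  let ?\<theta> = "ident ?B (tw (pD 1))"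
  have "is_ct 4 4 (cmp ?B (wr (vcat 4) psi (tw (pD 1))) ?incl) (pD 2) (pD 3) (\<lambda>l c' c.
      (of_nat (c' div 3) - of_nat (c mod 3)) * FiotaS_mx l c' c)"
    by (rule is_ct_cong[OF is_ct_cmp[OF incl psiFL]], force simp: FiotaS_mx_def live_cases,
        simp only: sizes less_cases live_cases, (elim disjE; simp add: calc FiotaS_mx_def))
  then have "is_ct 4 4 (cmp ?B (wl (vcat 4) (tw (fD 1)) (wr (vcat 4) ?proj (tw (sD 1))))
      (cmp ?B (wr (vcat 4) psi (tw (pD 1))) ?incl)) (pD 2) (pD 1) M"
    by (rule is_ct_cong[OF is_ct_cmp[OF _ proj]], force simp: M_def live_cases,
        simp only: sizes less_cases live_cases, (elim disjE; simp add: calc FiotaS_mx_def M_def))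
  then have lhs: "is_ct 4 4 (cmp ?B ?\<theta> (cmp ?B (wl (vcat 4) (tw (fD 1)) (wr (vcat 4) ?proj (tw (sD 1))))
      (cmp ?B (wr (vcat 4) psi (tw (pD 1))) ?incl))) (pD 2) (pD 1) M"
    by (rule is_ct_cong[OF is_ct_cmp[OF _ is_ct_ident]], simp, force simp: M_def live_cases,
        simp only: sizes less_cases live_cases, (elim disjE; simp add: calc M_def))
  have "is_ct 4 4 (cmp ?B (wl (vcat 4) (tw (fD 1)) (wl (vcat 4) Idf (wl (vcat 4) (tw (sD 1)) ?\<psi>'))) ?incl)
      (pD 2) (pD 3) (\<lambda>l c' c. (of_nat (c' div 3) + 1 - of_nat l) * FiotaS_mx l c' c)"
    by (rule is_ct_cong[OF is_ct_cmp[OF incl FRpsi']], force simp: FiotaS_mx_def live_cases,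
        simp only: sizes less_cases live_cases,
        (elim disjE; simp add: calc FiotaS_mx_def psi_mate_mx_def))
  then have rhs: "is_ct 4 4 (cmp ?B (wl (vcat 4) (tw (fD 1)) (wl (vcat 4) Idf (wr (vcat 4) ?proj (tw (sD 1)))))
      (cmp ?B (wl (vcat 4) (tw (fD 1)) (wl (vcat 4) Idf (wl (vcat 4) (tw (sD 1)) ?\<psi>'))) ?incl))
      (pD 2) (pD 1) M"
    by (rule is_ct_cong[OF is_ct_cmp[OF _ proj']], force simp: M_def live_cases,
        simp only: sizes less_cases live_cases, (elim disjE; simp add: calc FiotaS_mx_def M_def))
  have "is_ct 4 4 ?\<theta> (pD 1) (pD 1) (idm 4 (pD 1))" by (rule is_ct_ident) simp
  from is_ct_closed[OF this]
  have "arrow_in ?B ?\<theta> (tw (pD 1)) (tw (pD 1)) 0" by (simp add: closed_arrow_def)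
  moreover have "hiso ?B ?\<theta>" by (rule hinverse_hiso[OF hinverse_ident]) simp
  moreover note is_ct_heq[OF lhs rhs refl]
  ultimately show ?thesis
    unfolding highest_degree_condition_def Let_def
    by (intro exI[of _ ?\<theta>]) (simp add: fcomp_tw)
qed

section \<open>Parity of dimensions\<close>

definition hm :: "'k small_functor \<Rightarrow> 'k cob \<Rightarrow> 'k cob \<Rightarrow> 'k matr \<Rightarrow> 'k::field matr" where
  "hm G X Y f = fmap G [Arr X Y 0 f]"

lemma multilinear_zero:
  assumes "multilinear (vcat N) (smul (vcat N')) X \<phi>" "path (vcat N) X (l @ Arr Y Z n 0 # r)"
  shows "\<phi> (l @ Arr Y Z n 0 # r) = (0 :: 'k::field matr)"
proof -
  have "\<phi> (l @ Arr Y Z n (smul (vcat N) 1 0 + 0) # r) =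
      smul (vcat N') 1 (\<phi> (l @ Arr Y Z n 0 # r)) + \<phi> (l @ Arr Y Z n 0 # r)"
    using assms unfolding multilinear_def by blast
  then show ?thesis by simp
qed

lemma enh_functorD:
  assumes "enh_functor (vcat N) (vcat N') G"
  shows "path (vcat N) X p \<Longrightarrow> p \<noteq> [] \<Longrightarrow> arrow (vcat N') (farr G p)"
    and "multilinear (vcat N) (smul (vcat N')) X (fmap G)"
    and "path (vcat N) X p \<Longrightarrow> p \<noteq> [] \<Longrightarrow> val (mu1 (vcat N') (farr G p)) +
        (\<Sum>(l, r) \<in> {(l, r). l @ r = p \<and> l \<noteq> [] \<and> r \<noteq> []}.
          val (mu2 (vcat N') (farr G r) (farr G l))) = insert_mu (vcat N) (fmap G) p"
    and "heq (vcat N') (farr G [ident (vcat N) X]) (ident (vcat N') (fob G X))"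
  using assms unfolding enh_functor_def vcat_sel(1) by blast+

lemma hm_mats:
  assumes "enh_functor (vcat N) (vcat N') G" "f \<in> mats N X Y"
  shows "hm G X Y f \<in> mats N' (fob G X) (fob G Y)"
  using enh_functorD(1)[OF assms(1), of X "[Arr X Y 0 f]"] assms(2)
  by (simp add: arrow_vcat farr_def hm_def)

lemma hm_lin:
  assumes "enh_functor (vcat N) (vcat N') G" "f \<in> mats N X Y" "g \<in> mats N X Y"
  shows "hm G X Y ((\<lambda>j i. c * f j i) + g) = (\<lambda>j i. c * hm G X Y f j i) + hm G X Y g"
proof -
  have "path (vcat N) X ([] @ Arr X Y 0 f # [])" "path (vcat N) X ([] @ Arr X Y 0 g # [])"
    using assms(2,3) by (simp_all add: arrow_vcat)
  then have "fmap G ([] @ Arr X Y 0 (smul (vcat N) c f + g) # []) =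
      smul (vcat N') c (fmap G ([] @ Arr X Y 0 f # [])) + fmap G ([] @ Arr X Y 0 g # [])"
    using enh_functorD(2)[OF assms(1), of X] unfolding multilinear_def by blast
  then show ?thesis by (simp add: hm_def)
qed

lemma hm_zero: "enh_functor (vcat N) (vcat N') G \<Longrightarrow> hm G X Y 0 = 0"
  unfolding hm_def
  by (rule multilinear_zero[OF enh_functorD(2), of N N' G X "[]" X Y 0 "[]", simplified])
    (simp_all add: arrow_vcat)

lemma hm_scale:
  assumes "enh_functor (vcat N) (vcat N') G" "f \<in> mats N X Y"
  shows "hm G X Y (\<lambda>j i. c * f j i) = (\<lambda>j i. c * hm G X Y f j i)"
  using hm_lin[OF assms zero_mats, of c] hm_zero[OF assms(1), of X Y] by simp

lemma hm_unitm: "enh_functor (vcat N) (vcat N') G \<Longrightarrow> hm G X X (unitm N X) = unitm N' (fob G X)"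
  using enh_functorD(4)[of N N' G X] by (simp add: heq_vcat farr_def ident_def hm_def)

text \<open>The terms with \<open>mu1\<close> insert a zero arrow and vanish by multilinearity. So
  the linear part of any A-infinity functor between these categories is strictly multiplicative,
  whatever its higher components are.\<close>

lemma hm_mprod:
  assumes G: "enh_functor (vcat N) (vcat N') G" and f: "f \<in> mats N X Y" and g: "g \<in> mats N Y Z"
  shows "hm G X Z (mprod (sz Y) g f) = mprod (sz (fob G Y)) (hm G Y Z g) (hm G X Y f)"
proof -
  let ?a = "Arr X Y 0 f" and ?b = "Arr Y Z 0 g"
  have path: "path (vcat N) X [?a, ?b]" using f g by (simp add: arrow_vcat)
  have s1: "{(l, r). l @ r = [?a, ?b] \<and> l \<noteq> [] \<and> r \<noteq> []} = {([?a], [?b])}"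
    by (auto simp: append_eq_Cons_conv)
  have s2: "{(l, a, r). l @ a # r = [?a, ?b]} = {([], ?a, [?b]), ([?a], ?b, [])}"
    by (auto simp: append_eq_Cons_conv)
  have s3: "{(l, a, b, r). l @ a # b # r = [?a, ?b]} = {([], ?a, ?b, [])}"
    by (auto simp: append_eq_Cons_conv)
  have z1: "fmap G ([] @ Arr X Y 1 0 # [?b]) = 0"
    by (rule multilinear_zero[OF enh_functorD(2)[OF G]]) (use g in \<open>simp add: arrow_vcat\<close>)
  have z2: "fmap G ([?a] @ Arr Y Z 1 0 # []) = 0"
    by (rule multilinear_zero[OF enh_functorD(2)[OF G]]) (use f in \<open>simp add: arrow_vcat\<close>)
  have "val (mu2 (vcat N') (farr G [?b]) (farr G [?a])) = insert_mu (vcat N) (fmap G) [?a, ?b]"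
    using enh_functorD(3)[OF G path] s1 by simp
  also have "\<dots> = fmap G [mu2 (vcat N) ?b ?a]"
    using z1 z2 unfolding insert_mu_def s2 s3 by (simp add: mu1_def red_def ksign_def)
  finally show ?thesis
    by (simp add: mu2_def farr_def red_def ksign_def hm_def)
qed

text \<open>On the empty path all sums are empty, and what remains is the zero differential of the
  target. Homotopic transformations therefore have equal values at objects.\<close>

lemma trans_mu1_Nil: "trans_mu1 (vcat N) (vcat N') \<alpha> X [] = 0"
proof -
  have s: "{(l, r). l @ r = [] \<and> l \<noteq> []} = {}" "{(l, r). l @ r = [] \<and> r \<noteq> []} = {}"
    "{(l, a, r). l @ a # r = []} = {}" "{(l, a, b, r). l @ a # b # r = []} = {}" by auto
  show ?thesis
    unfolding trans_mu1_def[of _ _ _ X "[]"] insert_mu_def s by simp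
qed

lemma heq_Fun_at:
  assumes "heq (VF N N') a b"
  shows "val a X [] = val b X []"
proof -
  obtain s where "val a - val b = ksign (deg s) (trans_mu1 (vcat N) (vcat N') s)"
    using assms unfolding heq_def by auto
  then have "(val a - val b) X [] = 0"
    by (auto simp: ksign_def trans_mu1_Nil)
  then show ?thesis by simp
qed

lemma dgdiff_Fun_at: "dgdiff (VF N N') \<alpha> X [] = 0"
  by (auto simp: ksign_def trans_mu1_Nil)

text \<open>The sign in \<open>mu2\<close> cancels the sign with which \<open>dgcomp\<close> is
  defined from \<open>trans_mu2\<close>.\<close>

lemma dgcomp_Fun_at:
  "dgcomp (VF N N') \<beta> \<alpha> X [] =
    mprod (sz (fob (tgt \<alpha>) X)) (val \<beta> X []) (val \<alpha> X [])"
proof -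
  have s: "{(l, r). l @ r = []} = {([], [])}" by auto
  have "trans_mu2 (vcat N) (vcat N') \<beta> \<alpha> X [] =
      ksign (deg \<alpha>) (mprod (sz (fob (tgt \<alpha>) X)) (val \<beta> X []) (val \<alpha> X []))"
    unfolding trans_mu2_def[of _ _ _ _ X "[]"] s by (simp add: mu2_def red_def tarr_def ksign_def)
  then show ?thesis by (simp add: ksign_def)
qed

lemma cmp_Fun_at:
  "val (cmp (VF N N') \<beta> \<alpha>) X [] =
    mprod (sz (fob (tgt \<alpha>) X)) (val \<beta> X []) (val \<alpha> X [])"
  using dgcomp_Fun_at[of N N' \<beta> \<alpha> X] by (simp only: cmp_def arr.sel)

lemma dgunit_Fun_at: "dgunit (VF N N') F X [] = unitm N' (fob F X)"
  by (simp add: Fun_def)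

lemma ident_Fun_at: "val (ident (VF N N') F) X [] = unitm N' (fob F X)"
  by (simp add: ident_def dgunit_Fun_at)

lemma wl_at:
  "deg \<alpha> = 0 \<Longrightarrow> val (wl (vcat N) G \<alpha>) X [] =
     hm G (fob (src \<alpha>) X) (fob (tgt \<alpha>) X) (val \<alpha> X [])"
  using wl_index_Nil[where 'a = "('a cob, 'a matr) arr"]
  by (simp add: wl_def red_def ksign_def hm_def tarr_def)

lemma wr_at: "val (wr (vcat N) \<alpha> G) X [] = val \<alpha> (fob G X) []"
  by (simp add: wr_def blocks_Nil)

lemma arrow_in_Fun_at:
  assumes "arrow_in (VF N N') T F G n"
  shows "val T X [] \<in> mats N' (fob F X) (fob G X)"
    and "multilinear (vcat N) (smul (vcat N')) X (val T X)"
proof -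
  have T: "src T = F" "tgt T = G" "val T \<in> trans_hom (vcat N) (vcat N') F G n"
    using assms by (auto simp: arrow_in_def arrow_def)
  then have "\<forall>X p. path (vcat N) X p \<longrightarrow> arrow (vcat N') (tarr (Arr F G n (val T)) X p)"
    unfolding trans_hom_def by blast
  moreover have "path (vcat N) X []" by simp
  ultimately have "arrow (vcat N') (tarr (Arr F G n (val T)) X [])" by blast
  then show "val T X [] \<in> mats N' (fob F X) (fob G X)"
    by (simp add: arrow_vcat tarr_def)
  show "multilinear (vcat N) (smul (vcat N')) X (val T X)"
    using T unfolding trans_hom_def by blast
qed

text \<open>Closedness on a path with one arrow. The component of \<open>T\<close> on that path
  enters only together with a differential and drops out.\<close>

lemma closed_natural:
  assumes T: "closed_arrow (VF N N') T F G 0" and f: "f \<in> mats N X Y"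
  shows "mprod (sz (fob F Y)) (val T Y []) (hm F X Y f) =
    mprod (sz (fob G X)) (hm G X Y f) (val T X [])"
proof -
  let ?a = "Arr X Y 0 f"
  have a: "arrow_in (VF N N') T F G 0" and st: "src T = F" "tgt T = G" "deg T = 0"
    and c: "trans_mu1 (vcat N) (vcat N') T = 0"
    using T by (auto simp: closed_arrow_def arrow_in_def ksign_def)
  have s: "{(l, r). l @ r = [?a] \<and> l \<noteq> []} = {([?a], [])}"
    "{(l, r). l @ r = [?a] \<and> r \<noteq> []} = {([], [?a])}"
    "{(l, a, r). l @ a # r = [?a]} = {([], ?a, [])}"
    "{(l, a, b, r). l @ a # b # r = [?a]} = {}"
    by (auto simp: append_eq_Cons_conv)
  have "val T X ([] @ Arr X Y 1 0 # []) = 0"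
    by (rule multilinear_zero[OF arrow_in_Fun_at(2)[OF a]]) (simp add: arrow_vcat)
  then have "insert_mu (vcat N) (val T X) [?a] = 0"
    unfolding insert_mu_def s by (simp add: mu1_def red_def ksign_def)
  moreover have "path (vcat N) X [?a]" using f by (simp add: arrow_vcat)
  moreover have "trans_mu1 (vcat N) (vcat N') T X [?a] = 0" using c by simp
  ultimately have "mprod (sz (fob G X)) (hm G X Y f) (val T X []) -
      mprod (sz (fob F Y)) (val T Y []) (hm F X Y f) = 0"
    unfolding trans_mu1_def s
    by (simp add: mu2_def st farr_def tarr_def red_def ksign_def hm_def)
  then show ?thesis by simp
qed

section \<open>Traces and dimensions\<close>

definition trace :: "nat \<Rightarrow> 'k::field matr \<Rightarrow> 'k" where
  "trace n f = (\<Sum>i<n. f i i)"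

lemma trace_lin: "trace n 0 = 0" "trace n (f + g) = trace n f + trace n g"
  "trace n (f - g) = trace n f - trace n g" "trace n (- f) = - trace n f"
  by (simp_all add: trace_def sum.distrib sum_subtractf sum_negf)

lemma trace_comm: "trace n (mprod m g f) = trace m (mprod n f g)"
  unfolding trace_def mprod_def by (subst sum.swap) (simp add: mult.commute)

definition dm :: "nat \<Rightarrow> 'k::field cob \<Rightarrow> nat" where
  "dm N X = card {i. live N (lab X i)}"

lemma trace_unitm: "trace (sz X) (unitm N X) = of_nat (dm N X)"
proof -
  have "trace (sz X) (unitm N X) = (\<Sum>i\<in>{i. live N (lab X i)}. 1)"
    unfolding trace_def unitm_def
    by (rule sum.mono_neutral_cong_right) (auto dest: live_lab_less)
  then show ?thesis by (simp add: dm_def)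
qed

lemma iso_dm:
  fixes X Y :: "'k::field_char_0 cob"
  assumes "mprod (sz Y) g f = unitm N X" "mprod (sz X) f g = unitm N Y"
  shows "dm N X = dm N Y"
proof -
  have "(of_nat (dm N X) :: 'k) = trace (sz X) (mprod (sz Y) g f)"
    by (simp add: assms trace_unitm)
  also have "\<dots> = trace (sz Y) (mprod (sz X) f g)" by (rule trace_comm)
  also have "\<dots> = of_nat (dm N Y)" by (simp add: assms trace_unitm)
  finally show ?thesis by (simp only: of_nat_eq_iff)
qed

lemma trace_idempotent:
  assumes "e \<in> mats N X X" "mprod (sz X) e e = e"
  obtains r where "trace (sz X) e = of_nat r"
proof -
  from idempotent_splits[OF assms] obtain Z s t where
    "e = mprod (sz Z) s t" "mprod (sz X) t s = unitm N Z" by metis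
  then have "trace (sz X) e = of_nat (dm N Z)"
    by (simp add: trace_comm[of "sz X"] trace_unitm)
  then show ?thesis by (rule that)
qed

text \<open>The homotopy \<open>b : G \<rightarrow> F\<close> of an exact triangle is a generalised inverse of \<open>- f\<close>, so \<open>- b f\<close> is an
  idempotent, whose trace is a natural number.\<close>

lemma exact_triangle_dm:
  assumes "exact_triangle (VF N N') f g h"
  shows "even (dm N' (fob (src f) X) + dm N' (fob (tgt f) X) + dm N' (fob (tgt g) X :: 'k::field_char_0 cob))"
proof -
  let ?C = "VF N N' :: ('k, ('k cob, 'k matr, 'k cob, 'k matr) enhfun, _) dgcat"
  obtain F G Z j q k x b c y where
    cl: "closed_arrow ?C f F G 0" "closed_arrow ?C g G Z 0" "closed_arrow ?C h Z F 1"
    and ar: "arrow_in ?C j F Z (-1)" "arrow_in ?C q Z G 0" "arrow_in ?C k Z Z (-1)"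
      "arrow_in ?C x F F (-1)" "arrow_in ?C b G F 0" "arrow_in ?C c F G (-2)" "arrow_in ?C y G G (-1)"
    and eq: "dgdiff ?C j = dgcomp ?C g f"
      "dgcomp ?C j h + dgcomp ?C g q - dgunit ?C Z = dgdiff ?C k"
      "dgcomp ?C h j - dgunit ?C F = - dgdiff ?C x + dgcomp ?C b f"
      "dgcomp ?C q g - dgunit ?C G = dgdiff ?C y + dgcomp ?C f b"
    using assms unfolding exact_triangle_def by blast
  have t: "src f = F" "tgt f = G" "tgt g = Z" "tgt h = F" "tgt q = G" "tgt j = Z" "tgt b = F"
    using cl ar by (auto simp: closed_arrow_def arrow_in_def)
  let ?F = "fob F X" and ?G = "fob G X" and ?Z = "fob Z X"
  let ?f = "val f X []" and ?g = "val g X []" and ?h = "val h X []" and ?j = "val j X []"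
    and ?q = "val q X []" and ?b = "val b X []"
  note at = dgdiff_Fun_at dgcomp_Fun_at dgunit_Fun_at plus_fun_apply minus_apply uminus_apply
    add_0 minus_zero t
  have e1: "mprod (sz ?G) ?g ?f = 0"
    using fun_cong[OF fun_cong[OF eq(1), of X], of "[]"] unfolding at by simp
  have e2: "mprod (sz ?F) ?j ?h + mprod (sz ?G) ?g ?q - unitm N' ?Z = 0"
    using fun_cong[OF fun_cong[OF eq(2), of X], of "[]"] unfolding at .
  have e3: "mprod (sz ?Z) ?h ?j - unitm N' ?F = mprod (sz ?G) ?b ?f"
    using fun_cong[OF fun_cong[OF eq(3), of X], of "[]"] unfolding at .
  have e4: "mprod (sz ?Z) ?q ?g - unitm N' ?G = mprod (sz ?F) ?f ?b"
    using fun_cong[OF fun_cong[OF eq(4), of X], of "[]"] unfolding at .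
  have m: "?f \<in> mats N' ?F ?G" "?b \<in> mats N' ?G ?F"
    using arrow_in_Fun_at(1)[OF ar(5), of X] cl(1) arrow_in_Fun_at(1)[of N N' f F G 0 X]
    by (auto simp: closed_arrow_def)
  let ?e = "- mprod (sz ?G) ?b ?f"
  have "mprod (sz ?F) ?f (mprod (sz ?G) ?b ?f) = mprod (sz ?G) (mprod (sz ?Z) ?q ?g - unitm N' ?G) ?f"
    by (simp only: e4 mprod_assoc)
  also have "\<dots> = - ?f"
    by (simp add: e1 mprod_unitm(2)[OF m(1)] flip: mprod_assoc)
  finally have "mprod (sz ?F) ?e ?e = ?e"
    by (simp flip: mprod_assoc)
  then obtain r where "trace (sz ?F) ?e = of_nat r"
    using trace_idempotent[of ?e N' ?F] m by (auto simp: uminus_mats)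
  then have r: "trace (sz ?F) (mprod (sz ?G) ?b ?f) = - of_nat r"
    by (simp only: trace_lin) (simp add: minus_equation_iff eq_commute[of _ "- of_nat r"])
  \<comment> \<open>\<open>r\<close> is the rank of \<open>f\<close> at \<open>X\<close>, so the two
    traces are the dimensions of its kernel and cokernel. By cyclicity they add up to the trace of
    \<open>j h + g q\<close>, which is the identity of \<open>Z\<close>.\<close>
  have "trace (sz ?F) (mprod (sz ?Z) ?h ?j) = of_nat (dm N' ?F) - of_nat r"
    using arg_cong[OF e3, of "trace (sz ?F)"] r by (simp add: trace_lin trace_unitm algebra_simps)
  moreover have "trace (sz ?G) (mprod (sz ?Z) ?q ?g) = of_nat (dm N' ?G) - of_nat r"
    using arg_cong[OF e4, of "trace (sz ?G)"] r
    by (simp add: trace_lin trace_unitm algebra_simps trace_comm[of "sz ?G" "sz ?F"])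
  moreover have "trace (sz ?F) (mprod (sz ?Z) ?h ?j) + trace (sz ?G) (mprod (sz ?Z) ?q ?g) =
      of_nat (dm N' ?Z)"
    using arg_cong[OF e2, of "trace (sz ?Z)"]
    by (simp add: trace_lin trace_unitm trace_comm[of "sz ?Z"])
  ultimately have s: "(of_nat (dm N' ?F) - of_nat r) + (of_nat (dm N' ?G) - of_nat r) =
      (of_nat (dm N' ?Z) :: 'k)"
    by (simp only:)
  then have "(of_nat (dm N' ?Z + 2 * r) :: 'k) = of_nat (dm N' ?F + dm N' ?G)"
    by (simp flip: s)
  then have "dm N' ?Z + 2 * r = dm N' ?F + dm N' ?G"
    by (simp only: of_nat_eq_iff)
  then have "dm N' ?F + dm N' ?G + dm N' ?Z = 2 * (dm N' ?Z + r)" by simp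
  then show ?thesis by (simp add: t)
qed

section \<open>Adjoints and autoequivalences at objects\<close>

lemma adjunctionD:
  assumes "adjunction (vcat N) (vcat N') G F \<eta> \<epsilon>"
  shows "enh_functor (vcat N) (vcat N') G" "enh_functor (vcat N') (vcat N) F"
    "closed_arrow (VF N N) \<eta> Idf (F \<bullet> G) 0"
    "closed_arrow (VF N' N') \<epsilon> (G \<bullet> F) Idf 0"
    "val \<eta> X [] \<in> mats N X (fob F (fob G X))" "val \<epsilon> Y [] \<in> mats N' (fob G (fob F Y)) Y"
    "mprod (sz (fob F (fob G (fob F Y)))) (hm F (fob G (fob F Y)) Y (val \<epsilon> Y []))
       (val \<eta> (fob F Y) []) = unitm N (fob F Y)"
    "mprod (sz (fob G (fob F (fob G X)))) (val \<epsilon> (fob G X) [])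
       (hm G X (fob F (fob G X)) (val \<eta> X [])) = unitm N' (fob G X)"
proof -
  show F: "enh_functor (vcat N) (vcat N') G" "enh_functor (vcat N') (vcat N) F"
    and cl: "closed_arrow (VF N N) \<eta> Idf (F \<bullet> G) 0"
      "closed_arrow (VF N' N') \<epsilon> (G \<bullet> F) Idf 0"
    using assms unfolding adjunction_def by blast+
  then have st: "src \<eta> = Idf" "tgt \<eta> = F \<bullet> G" "deg \<eta> = 0" "src \<epsilon> = G \<bullet> F" "tgt \<epsilon> = Idf" "deg \<epsilon> = 0"
    by (auto simp: closed_arrow_def arrow_in_def)
  have ob: "fob (F \<bullet> G) X = fob F (fob G X)" "fob (G \<bullet> F) Y = fob G (fob F Y)"
    "fob (Idf :: 'a small_functor) X = X" "fob (Idf :: 'a small_functor) Y = Y" for X Y :: "'a cob"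
    by (simp_all add: fcomp_def Idf_def)
  show "val \<eta> X [] \<in> mats N X (fob F (fob G X))" "val \<epsilon> Y [] \<in> mats N' (fob G (fob F Y)) Y"
    using cl arrow_in_Fun_at(1)[of N N \<eta>] arrow_in_Fun_at(1)[of N' N' \<epsilon>] ob
    by (metis closed_arrow_def)+
  have h: "heq (VF N' N) (cmp (VF N' N) (wl (vcat N') F \<epsilon>) (wr (vcat N') \<eta> F))
      (ident (VF N' N) F)"
    "heq (VF N N') (cmp (VF N N') (wr (vcat N) \<epsilon> G) (wl (vcat N) G \<eta>))
      (ident (VF N N') G)"
    using assms unfolding adjunction_def by blast+
  have t: "tgt (wr (vcat N') \<eta> F) = (F \<bullet> G) \<bullet> F" "tgt (wl (vcat N) G \<eta>) = G \<bullet> (F \<bullet> G)"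
    by (simp_all add: wr_def wl_def st)
  show "mprod (sz (fob F (fob G (fob F Y)))) (hm F (fob G (fob F Y)) Y (val \<epsilon> Y []))
       (val \<eta> (fob F Y) []) = unitm N (fob F Y)"
    using heq_Fun_at[OF h(1), of Y]
    by (simp add: cmp_Fun_at ident_Fun_at wl_at wr_at st t) (simp add: fcomp_def Idf_def)
  show "mprod (sz (fob G (fob F (fob G X)))) (val \<epsilon> (fob G X) [])
       (hm G X (fob F (fob G X)) (val \<eta> X [])) = unitm N' (fob G X)"
    using heq_Fun_at[OF h(2), of X]
    by (simp add: cmp_Fun_at ident_Fun_at wl_at wr_at st t) (simp add: fcomp_def Idf_def)
qed

lemma hm_fcomp:
  "hm (G \<bullet> F) X Y f = hm G (fob F X) (fob F Y) (hm F X Y f)"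
  "hm Idf X Y f = f"
  by (simp_all add: hm_def fcomp_def farr_def red_def blocks_single Idf_def)

lemma hinverse_at:
  assumes "hinverse (VF N N') a b" "deg a = 0"
  shows "mprod (sz (fob (tgt a) X)) (val b X []) (val a X []) = unitm N' (fob (src a) X)"
    "mprod (sz (fob (src a) X)) (val a X []) (val b X []) = unitm N' (fob (tgt a) X)"
    "val a X [] \<in> mats N' (fob (src a) X) (fob (tgt a) X)"
    "val b X [] \<in> mats N' (fob (tgt a) X) (fob (src a) X)"
proof -
  have h: "heq (VF N N') (cmp (VF N N') b a) (ident (VF N N') (src a))"
    "heq (VF N N') (cmp (VF N N') a b) (ident (VF N N') (tgt a))"
    and cl: "arrow_in (VF N N') a (src a) (tgt a) (deg a)"
      "arrow_in (VF N N') b (tgt a) (src a) (- deg a)"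
    using assms(1) unfolding hinverse_def closed_arrow_def by blast+
  have "tgt b = src a" using cl(2) by (simp add: arrow_in_def)
  with heq_Fun_at[OF h(1), of X] heq_Fun_at[OF h(2), of X]
  show "mprod (sz (fob (tgt a) X)) (val b X []) (val a X []) = unitm N' (fob (src a) X)"
    "mprod (sz (fob (src a) X)) (val a X []) (val b X []) = unitm N' (fob (tgt a) X)"
    by (simp_all add: cmp_Fun_at ident_Fun_at)
  show "val a X [] \<in> mats N' (fob (src a) X) (fob (tgt a) X)"
    "val b X [] \<in> mats N' (fob (tgt a) X) (fob (src a) X)"
    using arrow_in_Fun_at(1)[OF cl(1)] arrow_in_Fun_at(1)[OF cl(2)] by blast+
qed

text \<open>Uniqueness of right adjoints: the canonical maps between \<open>F' Z\<close> and
  \<open>F Z\<close> are mutually inverse. A P-functor structure brings its own right adjoint, whose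
  values have to be compared with a known one.\<close>

lemma adjoint_comparison:
  assumes 1: "adjunction (vcat N) (vcat N') G F \<eta> \<epsilon>"
    and 2: "adjunction (vcat N) (vcat N') G F' \<eta>' \<epsilon>'"
  shows "mprod (sz (fob F Z))
      (mprod (sz (fob F' (fob G (fob F Z)))) (hm F' (fob G (fob F Z)) Z (val \<epsilon> Z [])) (val \<eta>' (fob F Z) []))
      (mprod (sz (fob F (fob G (fob F' Z)))) (hm F (fob G (fob F' Z)) Z (val \<epsilon>' Z [])) (val \<eta> (fob F' Z) []))
    = unitm N (fob F' Z)"
proof -
  note D = adjunctionD[OF 1] and D' = adjunctionD[OF 2]
  let ?P = "fob F Z" and ?P' = "fob F' Z"
  let ?p = "hm F (fob G ?P') Z (val \<epsilon>' Z [])"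
  let ?\<phi> = "mprod (sz (fob F (fob G ?P'))) ?p (val \<eta> ?P' [])"
  have p: "?p \<in> mats N (fob F (fob G ?P')) ?P" by (rule hm_mats[OF D(2) D'(6)])
  have \<phi>: "?\<phi> \<in> mats N ?P' ?P" using p D(5) by (rule mprod_mats_sz)
  have ob: "fob (F' \<bullet> G) X = fob F' (fob G X)" "fob (G \<bullet> F) X = fob G (fob F X)"
    "fob (Idf :: 'a small_functor) X = X" for X :: "'a cob"
    by (simp_all add: fcomp_def Idf_def)
  have n1: "mprod (sz ?P) (val \<eta>' ?P []) ?\<phi> =
      mprod (sz (fob F' (fob G ?P'))) (hm F' (fob G ?P') (fob G ?P) (hm G ?P' ?P ?\<phi>)) (val \<eta>' ?P' [])"
    using closed_natural[OF D'(3) \<phi>] by (simp add: ob hm_fcomp)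
  have n2: "mprod (sz (fob G ?P)) (val \<epsilon> Z []) (hm G (fob F (fob G ?P')) ?P ?p) =
      mprod (sz (fob G ?P')) (val \<epsilon>' Z []) (val \<epsilon> (fob G ?P') [])"
    using closed_natural[OF D(4) D'(6)] by (simp add: ob hm_fcomp)
  have G\<phi>: "hm G ?P' ?P ?\<phi> = mprod (sz (fob G (fob F (fob G ?P'))))
      (hm G (fob F (fob G ?P')) ?P ?p) (hm G ?P' (fob F (fob G ?P')) (val \<eta> ?P' []))"
    by (rule hm_mprod[OF D(1) D(5) p])
  \<comment> \<open>The defining property of the comparison map:
    \<open>\<epsilon> \<circ> G \<phi> = \<epsilon>'\<close>.\<close>
  have "mprod (sz (fob G ?P)) (val \<epsilon> Z []) (hm G ?P' ?P ?\<phi>) =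
      mprod (sz (fob G ?P')) (val \<epsilon>' Z []) (unitm N' (fob G ?P'))"
    unfolding G\<phi> mprod_assoc n2 by (simp only: mprod_assoc[symmetric] D(8))
  also have "\<dots> = val \<epsilon>' Z []" by (rule mprod_unitm(1)[OF D'(6)])
  finally have e: "mprod (sz (fob G ?P)) (val \<epsilon> Z []) (hm G ?P' ?P ?\<phi>) = val \<epsilon>' Z []" .
  have "mprod (sz (fob F' (fob G ?P))) (hm F' (fob G ?P) Z (val \<epsilon> Z []))
      (hm F' (fob G ?P') (fob G ?P) (hm G ?P' ?P ?\<phi>)) = hm F' (fob G ?P') Z (val \<epsilon>' Z [])"
    using hm_mprod[OF D'(2) hm_mats[OF D(1) \<phi>] D(6)] by (simp only: e)
  then show ?thesis
    using D'(7)[of Z] by (simp only: mprod_assoc[symmetric] n1) (simp only: mprod_assoc)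
qed

lemma right_adjoint_dm:
  fixes Z :: "'k::field_char_0 cob"
  assumes "adjunction (vcat N) (vcat N') G F \<eta> \<epsilon>" "adjunction (vcat N) (vcat N') G F' \<eta>' \<epsilon>'"
  shows "dm N (fob F Z) = dm N (fob F' Z)"
  by (rule iso_dm[OF adjoint_comparison[OF assms(2,1)] adjoint_comparison[OF assms]])

lemma dm_1_scalar:
  assumes "dm N X = 1" "f \<in> mats N X X"
  obtains c where "f = (\<lambda>j i. c * unitm N X j i)"
proof -
  obtain a where a: "{i. live N (lab X i)} = {a}"
    using assms(1) unfolding dm_def by (meson card_1_singletonE)
  have "f j i = f a a * unitm N X j i" for j i
  proof (cases "f j i = 0")
    case True
    have "f a a * unitm N X j i = 0" if "f a a \<noteq> 0"
      using True a that by (auto simp: unitm_def)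
    with True show ?thesis by force
  next
    case False
    then have "live N (lab X i)" "live N (lab X j)" using matsD[OF assms(2)] by auto
    then have "i = a" "j = a" using a by auto
    then show ?thesis using \<open>live N (lab X i)\<close> by (simp add: unitm_def)
  qed
  then show ?thesis by (intro that[of "f a a"] ext)
qed

text \<open>A diagonal matrix unit at a live position is a scalar only if no other position is
  live.\<close>

lemma scalar_end_dm_1:
  assumes sc: "\<And>f. f \<in> mats N X X \<Longrightarrow> \<exists>c. f = (\<lambda>j i. c * unitm N X j i)"
    and nz: "unitm N X \<noteq> (0 :: 'k::field matr)"
  shows "dm N X = 1"
proof -
  obtain a where a: "live N (lab X a)"
    using nz by (auto simp: unitm_def fun_eq_iff split: if_splits)
  let ?E = "\<lambda>j i. if j = a \<and> i = a then 1 else 0 :: 'k"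
  have "?E \<in> mats N X X" using a by (auto simp: mats_def)
  then obtain c where c: "?E = (\<lambda>j i. c * unitm N X j i)" using sc by blast
  have "i = a" if "live N (lab X i)" for i
    using fun_cong[OF fun_cong[OF c, of i], of i] fun_cong[OF fun_cong[OF c, of a], of a] that a
    by (auto simp: unitm_def split: if_splits)
  then have "{i. live N (lab X i)} = {a}" using a by blast
  then show ?thesis by (simp add: dm_def)
qed

text \<open>An endomorphism of \<open>H X\<close> is moved by \<open>H'\<close> and conjugated with
  \<open>v\<close> into an endomorphism of \<open>X\<close>, which is a scalar. \<open>H'\<close>
  reflects this equation because it is faithful, by naturality of the isomorphism
  \<open>u\<close>.\<close>

lemma equivalence_simple:
  assumes adj: "adjunction (vcat N) (vcat N) H' H u v"
    and u: "hiso (VF N N) u" and v: "hiso (VF N N) v"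
    and X: "dm N X = 1"
  shows "dm N (fob H X :: 'k::field_char_0 cob) = 1"
proof -
  note D = adjunctionD[OF adj]
  obtain u' v' where inv: "hinverse (VF N N) u u'" "hinverse (VF N N) v v'"
    using u v by (auto simp: hiso_def)
  have st: "src u = Idf" "tgt u = H \<bullet> H'" "deg u = 0" "src v = H' \<bullet> H" "tgt v = Idf" "deg v = 0"
    using D(3,4) by (auto simp: closed_arrow_def arrow_in_def)
  have ob: "fob (H \<bullet> H') Y = fob H (fob H' Y)" "fob (H' \<bullet> H) Y = fob H' (fob H Y)"
    "fob (Idf :: 'k small_functor) Y = Y" for Y :: "'k cob"
    by (simp_all add: fcomp_def Idf_def)
  note u_inv = hinverse_at[OF inv(1) st(3), unfolded st ob]
  note v_inv = hinverse_at[OF inv(2) st(6), unfolded st ob]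
  let ?Y = "fob H X"
  have faithful: "f = g" if "f \<in> mats N ?Y ?Y" "g \<in> mats N ?Y ?Y" "hm H' ?Y ?Y f = hm H' ?Y ?Y g" for f g
  proof -
    have nat: "mprod (sz ?Y) (val u ?Y []) h = mprod (sz (fob H (fob H' ?Y)))
        (hm H (fob H' ?Y) (fob H' ?Y) (hm H' ?Y ?Y h)) (val u ?Y [])" if "h \<in> mats N ?Y ?Y" for h
      using closed_natural[OF D(3) that] by (simp add: ob hm_fcomp)
    have "mprod (sz ?Y) (val u ?Y []) f = mprod (sz ?Y) (val u ?Y []) g"
      using nat[OF that(1)] nat[OF that(2)] that(3) by simp
    then have "mprod (sz (fob H (fob H' ?Y))) (val u' ?Y []) (mprod (sz ?Y) (val u ?Y []) f) =
        mprod (sz (fob H (fob H' ?Y))) (val u' ?Y []) (mprod (sz ?Y) (val u ?Y []) g)" by simp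
    then show "f = g"
      by (simp add: mprod_assoc u_inv mprod_unitm(2)[OF that(1)] mprod_unitm(2)[OF that(2)])
  qed
  have "\<exists>c. f = (\<lambda>j i. c * unitm N ?Y j i)" if f: "f \<in> mats N ?Y ?Y" for f
  proof -
    let ?W = "fob H' ?Y" and ?v = "val v X []" and ?v' = "val v' X []" and ?f = "hm H' ?Y ?Y f"
    have f': "?f \<in> mats N ?W ?W" by (rule hm_mats[OF D(1) f])
    have "mprod (sz ?W) ?v (mprod (sz ?W) ?f ?v') \<in> mats N X X"
      using f' v_inv by (simp)
    then obtain c where c: "mprod (sz ?W) ?v (mprod (sz ?W) ?f ?v') = (\<lambda>j i. c * unitm N X j i)"
      using dm_1_scalar[OF X] by blast
    have "?f = mprod (sz X) (mprod (sz X) ?v' (mprod (sz ?W) ?v (mprod (sz ?W) ?f ?v'))) ?v"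
      by (simp add: mprod_assoc v_inv mprod_unitm(2)[OF f'])
        (simp add: mprod_assoc[symmetric] v_inv mprod_unitm(1)[OF f'])
    also have "\<dots> = (\<lambda>j i. c * unitm N ?W j i)"
      unfolding c by (simp add: v_inv mprod_unitm(1)[OF v_inv(4)])
    also have "\<dots> = hm H' ?Y ?Y (\<lambda>j i. c * unitm N ?Y j i)"
      by (simp add: hm_scale[OF D(1) unitm_mats] hm_unitm[OF D(1)])
    finally have "f = (\<lambda>j i. c * unitm N ?Y j i)"
      by (rule faithful[OF f smul_mats[OF unitm_mats]])
    then show ?thesis by blast
  qed
  moreover have "unitm N ?Y \<noteq> (0 :: 'k matr)"
  proof
    assume "unitm N ?Y = (0 :: 'k matr)"
    then have "unitm N (fob H' ?Y) = (0 :: 'k matr)"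
      using hm_unitm[OF D(1), of ?Y] hm_zero[OF D(1), of ?Y ?Y] by simp
    then have "val v' X [] = 0" using mprod_unitm(2)[OF v_inv(4)[of X]] by simp
    then have "unitm N X = (0 :: 'k matr)" using v_inv(2)[of X] by simp
    then show False using X trace_unitm[of X N] by (simp add: trace_lin)
  qed
  ultimately show ?thesis by (rule scalar_end_dm_1)
qed

lemma hom_functor_zero:
  assumes F: "enh_functor (vcat N) (vcat N') F"
    and X: "X \<in> fker (vcat N) (vcat N') F" and iso: "hisomorphic (vcat N) X Y"
  shows "Y \<in> fker (vcat N) (vcat N') F"
proof -
  obtain a b where ab: "arrow_in (vcat N) a X Y 0" "hinverse (vcat N) a b"
    using iso by (auto simp: hisomorphic_def hiso_def)
  then have m: "val a \<in> mats N X Y" "val b \<in> mats N Y X"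
    and ab1: "mprod (sz X) (val a) (val b) = unitm N Y"
    by (auto simp: hinverse_def closed_arrow_def arrow_in_def arrow_vcat heq_vcat cmp_def ident_def)
  have z: "unitm N' (fob F X) = 0"
    using X by (simp add: fker_def hzero_def heq_vcat ident_def)
  have "hm F X Y (val a) = mprod (sz (fob F X)) (hm F X Y (val a)) (unitm N' (fob F X))"
    by (rule mprod_unitm(1)[OF hm_mats[OF F m(1)], symmetric])
  then have "hm F X Y (val a) = 0" by (simp add: z)
  then have "unitm N' (fob F Y) = 0"
    using hm_mprod[OF F m(2,1)] hm_unitm[OF F, of Y] by (simp add: ab1)
  then show ?thesis
    by (simp add: fker_def hzero_def heq_vcat ident_def)
qed

lemma ess_image_Idf_fker:
  "ess_image (vcat 1) Idf (fker (vcat 1) (vcat 4) (tw (fD 1))) =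
    fker (vcat 1) (vcat 4) (tw (fD 1) :: 'k::field small_functor)"
proof -
  have "hisomorphic (vcat 1) X X" for X :: "'k cob"
  proof -
    have "hinverse (vcat 1) (ident (vcat 1) X) (ident (vcat 1) X)"
      by (simp add: hinverse_def closed_arrow_def arrow_in_def arrow_vcat heq_vcat cmp_def ident_def)
    then show ?thesis
      unfolding hisomorphic_def
      by (intro exI[of _ "ident (vcat 1) X"]) (auto simp: arrow_in_def arrow_vcat ident_def hinverse_hiso)
  qed
  then show ?thesis
    using hom_functor_zero[OF enh_functor_tw[OF okf_data(2)[of 1]]]
    by (auto simp: ess_image_def Idf_def)
qed

text \<open>\<open>Q 2\<close> and \<open>R \<bullet> F\<close> are the same record
  \<open>tw (tD 3)\<close>, so the identity serves as \<open>\<gamma>\<close>. The filtration splits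
  as a filtration of functors, hence the connecting maps are 0.\<close>

lemma Pn_functor_diag: "Pn_functor 2 (vcat 1) (vcat 4) (tw (fD 1) :: 'k::field_char_0 small_functor)"
proof -
  let ?A = "VF 1 1 :: ('k, ('k cob, 'k matr, 'k cob, 'k matr) enhfun, _) dgcat"
  let ?Q = "\<lambda>i::nat. if i = 0 then Idf else if i = 1 then tw (tD 2) else tw (tD 3) :: 'k small_functor"
  let ?\<iota> = "\<lambda>i::nat. if i = 1 then iota1 else iota2 :: ('k cob, 'k matr, 'k cob, 'k matr) tarr"
  let ?\<mu> = "\<lambda>i::nat. if i = 1 then proj1 else proj2 :: ('k cob, 'k matr, 'k cob, 'k matr) tarr"
  let ?\<delta> = "\<lambda>i::nat. Arr Idf (if i = 1 then Idf else tw (tD 2)) 1 0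
    :: ('k cob, 'k matr, 'k cob, 'k matr) tarr"
  let ?u = "ident ?A Idf"
  have e: "enh_functor (vcat 1) (vcat 1) (Idf :: 'k small_functor)"
    using enh_functor_tw[OF okf_idd[of 1]] by (simp add: tw_idd)
  have u: "hiso ?A ?u"
    using hinverse_hiso[OF hinverse_ident[OF okf_idd[of 1]]] by (simp add: tw_idd)
  have arrows: "arrow_in ?A iota1 Idf (tw (tD 2)) 0" "arrow_in ?A proj1 (tw (tD 2)) Idf 0"
    "arrow_in ?A iota2 (tw (tD 2)) (tw (tD 3)) 0" "arrow_in ?A proj2 (tw (tD 3)) Idf 0"
    using is_ct_basic(1-4)[THEN is_ct_closed, where 'a = 'k] by (simp_all add: closed_arrow_def tw_idd)
  have post: "postnikov_system 2 (vcat 1) Idf ?Q ?\<iota> ?\<mu> ?\<delta>"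
  proof -
    have "{1..2::nat} = {1, 2}" by auto
    then show ?thesis
      using arrows exact_triangle1 exact_triangle2
        zero_arrow[OF e e, of 1] zero_arrow[OF e enh_functor_tw[of 1 1 "tD 2"], of 1]
      by (simp add: postnikov_system_def)
  qed
  have "postnikov_map ?A ?Q ?\<iota> 0 2 = cmp ?A iota2 (cmp ?A iota1 ?u)"
    by (simp add: numeral_2_eq_2 One_nat_def)
  moreover have "heq ?A (cmp ?A gammaSF (cmp ?A iota2 (cmp ?A iota1 ?u))) unitSF"
  proof -
    have "is_ct 1 1 ?u idd idd (idm 1 idd)"
      using is_ct_ident[OF okf_idd, of 1] by (simp add: tw_idd)
    then show ?thesis
      by (rule is_ct_heq[OF is_ct_cmp[OF is_ct_cmp[OF is_ct_cmp[OF _ is_ct_basic(1)] is_ct_basic(3)] is_ct_gam]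
          is_ct_unit_counit(3)])
        (simp only: sizes less_cases live_cases, (elim disjE; simp add: calc))
  qed
  ultimately have unit: "heq ?A (cmp ?A gammaSF (postnikov_map ?A ?Q ?\<iota> 0 2)) unitSF" by simp
  have gammaSF: "arrow_in ?A gammaSF (?Q 2) (tw (sD 1) \<bullet> tw (fD 1)) 0" "hinverse ?A gammaSF gammaSF"
    using is_ct_closed[OF is_ct_gam, where 'a = 'k] hinverse_ident[OF okf_data(1)[of 3], where 'k = 'k]
    by (simp_all add: closed_arrow_def fcomp_tw)
  show ?thesis
    unfolding Pn_functor_def
    by (rule conjI, simp add: enh_functor_tw,
      rule exI[of _ "tw (sD 1)"], rule exI[of _ "tw (sD 1)"], rule exI[of _ "unitFS"],
      rule exI[of _ "counitSF"], rule exI[of _ "unitSF"], rule exI[of _ "counitFS"],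
      rule exI[of _ "Idf"], rule exI[of _ "Idf"], rule exI[of _ "?u"],
      rule exI[of _ "?u"], rule exI[of _ "?Q"], rule exI[of _ "?\<iota>"],
      rule exI[of _ "?\<mu>"], rule exI[of _ "?\<delta>"], rule exI[of _ "gammaSF"],
      rule exI[of _ "gammaSF"], rule exI[of _ "psi"],
      intro conjI adjunction_sum_diag adjunction_diag_sum adjunction_Idf u ess_image_Idf_fker
        post gammaSF unit is_psi_psi monad_condition_diag adjoints_condition_diag
        highest_degree_condition_diag) simp_all
qed

lemma postnikov_dm:
  fixes X :: "'k::field_char_0 cob"
  assumes post: "postnikov_system n (vcat N) H Q \<iota> \<mu> \<delta>"
    and adj: "adjunction (vcat N) (vcat N) H' H u v"
    and u: "hiso (VF N N) u" and v: "hiso (VF N N) v"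
    and X: "dm N X = 1"
  shows "even (n + 1 + dm N (fob (Q n) X))"
proof -
  have H: "dm N (fob (fpow H i) X) = 1" for i
  proof (induction i)
    case 0
    show ?case using X by (simp add: Idf_def)
  next
    case (Suc i)
    have "dm N (fob H (fob (fpow H i) X)) = 1"
      by (rule equivalence_simple[OF adj u v Suc])
    then show ?case by (simp add: fcomp_def)
  qed
  have "even (i + 1 + dm N (fob (Q i) X))" if "i \<le> n" for i
    using that
  proof (induction i)
    case 0
    have "Q 0 = Idf" using post by (simp add: postnikov_system_def)
    then show ?case using X by (simp add: Idf_def)
  next
    case (Suc i)
    then have "Suc i \<in> {1..n}" by simp
    with post have a: "arrow_in (VF N N) (\<iota> (Suc i)) (Q (Suc i - 1)) (Q (Suc i)) 0"
      "arrow_in (VF N N) (\<mu> (Suc i)) (Q (Suc i)) (fpow H (Suc i)) 0"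
      and "exact_triangle (VF N N) (\<iota> (Suc i)) (\<mu> (Suc i)) (\<delta> (Suc i))"
      unfolding postnikov_system_def by blast+
    from exact_triangle_dm[OF this(3), of X] H[of "Suc i"]
    have "even (dm N (fob (Q i) X) + dm N (fob (Q (Suc i)) X) + 1)"
      using a by (simp add: arrow_in_def del: fpow.simps)
    then show ?case using Suc by auto
  qed
  then show ?thesis by simp
qed

lemma not_P_functor_sum: "\<not> P_functor (vcat 4) (vcat 1) (tw (sD 1) :: 'k::field_char_0 small_functor)"
proof
  let ?G = "tw (sD 1) :: 'k small_functor" and ?B = "vcat 4 :: 'k small_dgcat" and ?A = "vcat 1 :: 'k small_dgcat"
  let ?T = "\<lambda>l. ([(l, 0)], 0) :: 'k cob"
  assume "P_functor ?B ?A ?G"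
  then obtain n R act' tr' H H' u v Q \<iota> \<mu> \<delta> \<gamma> \<gamma>' where
    R: "adjunction ?B ?A ?G R act' tr'"
    and H: "adjunction ?B ?B H' H u v" "hiso (Fun ?B ?B) u" "hiso (Fun ?B ?B) v"
    and post: "postnikov_system n ?B H Q \<iota> \<mu> \<delta>"
    and \<gamma>: "arrow_in (Fun ?B ?B) \<gamma> (Q n) (R \<bullet> ?G) 0" "hinverse (Fun ?B ?B) \<gamma> \<gamma>'"
    unfolding P_functor_def Pn_functor_def by blast
  have "src \<gamma> = Q n" "tgt \<gamma> = R \<bullet> ?G" "deg \<gamma> = 0" using \<gamma>(1) by (auto simp: arrow_in_def)
  note \<gamma>_inv = hinverse_at[OF \<gamma>(2) this(3), unfolded this]
  have Q: "dm 4 (fob (Q n) X) = dm 4 (fob R (fob ?G X))" for X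
    using iso_dm[OF \<gamma>_inv(1,2), of X] by (simp add: fcomp_def)
  have lab: "lab (?T l) i = (if i = 0 then l else 0)" for l i
    by (simp add: lab_def)
  have T: "dm 4 (?T l) = 1" if "live 4 l" for l
  proof -
    have "{i. live 4 (lab (?T l) i)} = {0}" using that by (auto simp: lab)
    then show ?thesis by (simp add: dm_def)
  qed
  \<comment> \<open>\<open>\<Sigma>\<close> discards label 4, and every enhanced functor preserves
    zero objects, whatever \<open>R\<close> is. At label 1 below, \<open>R\<close> is instead
    compared with the right adjoint \<open>\<Delta>\<close>.\<close>
  have "dm 4 (fob R (fob ?G (?T 4))) = 0"
  proof -
    have "unitm 1 (fob ?G (?T 4)) = (0 :: 'k matr)"
      by (auto simp: unitm_def fun_eq_iff lab_tob lab live_def)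
    then have "unitm 4 (fob R (fob ?G (?T 4))) = (0 :: 'k matr)"
      using hm_unitm[OF adjunctionD(2)[OF R], of "fob ?G (?T 4)"] hm_zero[OF adjunctionD(2)[OF R]]
      by (simp del: fob_tw)
    then show ?thesis
      using trace_unitm[of "fob R (fob ?G (?T 4))" 4] by (simp add: trace_lin)
  qed
  with postnikov_dm[OF post H T[of 4]] have n: "odd n"
    by (simp add: Q live_def)
  have "dm 4 (fob R (fob ?G (?T 1))) = dm 4 (fob (tw (fD 1)) (fob ?G (?T 1)))"
    by (rule right_adjoint_dm[OF R adjunction_sum_diag])
  also have "\<dots> = 3"
  proof -
    have "{i. live 4 (lab (tob (pD 1) (?T 1)) i)} = {..<3}"
      by (auto simp: lab_tob lab live_def)
    then show ?thesis by (simp add: tob_tob dm_def)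
  qed
  finally have "even n"
    using postnikov_dm[OF post H T[of 1]] by (simp add: Q live_def)
  with n show False by simp
qed

theorem mainTheorem1:
  shows "\<exists>(A :: 'k::{alg_closed_field, field_char_0} small_dgcat) (B :: 'k small_dgcat)
           (F :: 'k small_functor) (L :: 'k small_functor) (R :: 'k small_functor) \<eta> \<epsilon> act tr.
           enhanced_triangulated A \<and> enhanced_triangulated B \<and>
           enh_functor A B F \<and>
           adjunction B A L F \<eta> \<epsilon> \<and>
           adjunction A B F R act tr \<and>
           P_functor A B F \<and>
           \<not> P_functor B A L \<and>
           \<not> P_functor B A R"
proof -
  have P: "P_functor (vcat 1) (vcat 4) (tw (fD 1) :: 'k small_functor)"
    unfolding P_functor_def using Pn_functor_diag by (intro exI[of _ 2]) simp
  have F: "enh_functor (vcat 1) (vcat 4) (tw (fD 1) :: 'k small_functor)"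
    by (simp add: enh_functor_tw)
  show ?thesis
    by (rule exI[of _ "vcat 1"], rule exI[of _ "vcat 4"], rule exI[of _ "tw (fD 1)"],
        rule exI[of _ "tw (sD 1)"], rule exI[of _ "tw (sD 1)"], rule exI[of _ unitFS],
        rule exI[of _ counitSF], rule exI[of _ unitSF], rule exI[of _ counitFS])
      (intro conjI P F enhanced_triangulated_vcat adjunction_sum_diag adjunction_diag_sum
        not_P_functor_sum)
qed

end
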